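(* Let $\left((F,\nu,N),[\,,]_{F,h},(\rho,\eta)\right)$ be a generalized Lie algebroid. For $f\in\mathcal F(N)$ and $z\in\Gamma(F,\nu,N)$ put $d^Ff(z)=\Gamma(Th\circ\rho,h\circ\eta)(z)f$. Then the $\mathcal F(N)$-multilinear application $$d^F:\Lambda^q(F,\nu,N)\to\Lambda^{q+1}(F,\nu,N),\qquad \omega\mapsto d^F\omega,$$ defined by $$d^F\omega(z_0,z_1,\dots,z_q)=\sum_{i=0}^q(-1)^i\,\Gamma(Th\circ\rho,h\circ\eta)z_i\big(\omega(z_0,z_1,\dots,\hat z_i,\dots,z_q)\big)+\sum_{i<j}(-1)^{i+j}\omega\big([z_i,z_j]_{F,h},z_0,z_1,\dots,\hat z_i,\dots,\hat z_j,\dots,z_q\big)$$ for any $z_0,z_1,\dots,z_q\in\Gamma(F,\nu,N)$, is unique with the following property: $$L_z=d^F\circ i_z+i_z\circ d^F\qquad\text{for all } z\in\Gamma(F,\nu,N).$$ (This $\mathcal F(N)$-multilinear application is called the exterior differentiation operator for the exterior differential algebra of the generalized Lie algebroid.)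
   Context: All manifolds, maps, bundles and sections are smooth. $\mathcal F(N)$ is the set of smooth real functions on $N$, and $\Gamma(F,\nu,N)$ is the $\mathcal F(N)$-module of sections of a vector bundle $(F,\nu,N)$. A hat denotes omission of the argument. For a vector bundle morphism $(\varphi,\varphi_0)$ from $(E,\pi,M)$ to $(E',\pi',M')$ with $\varphi_0:M\to M'$ a diffeomorphism, $\Gamma(E',\pi',M')$ is regarded as an $\mathcal F(M)$-module through $f\cdot u'=(f\circ\varphi_0^{-1})u'$, and $\Gamma(\varphi,\varphi_0):\Gamma(E,\pi,M)\to\Gamma(E',\pi',M')$ is the module morphism $(\Gamma(\varphi,\varphi_0)u)(y)=\varphi(u(\varphi_0^{-1}(y)))$. Generalized Lie algebroid: let $h:M\to N$ and $\eta:N\to M$ be diffeomorphisms, $(F,\nu,N)$ a vector bundle, $(\rho,\eta)$ a vector bundle morphism from $(F,\nu,N)$ to $(TM,\tau_M,M)$, and $[\,,]_{F,h}:\Gamma(F,\nu,N)\times\Gamma(F,\nu,N)\to\Gamma(F,\nu,N)$ an operation. The triple $((F,\nu,N),[\,,]_{F,h},(\rho,\eta))$ is a generalized Lie algebroid if: (1) $[u,f\cdot v]_{F,h}=f[u,v]_{F,h}+\Gamma(Th\circ\rho,h\circ\eta)(u)f\cdot v$ for all $u,v\in\Gamma(F,\nu,N)$ and $f\in\mathcal F(N)$; (2) $(\Gamma(F,\nu,N),+,\cdot,[\,,]_{F,h})$ is a Lie $\mathcal F(N)$-algebra; (3) the module morphism $\Gamma(Th\circ\rho,h\circ\eta)$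 is a morphism of Lie algebras from $(\Gamma(F,\nu,N),+,\cdot,[\,,]_{F,h})$ to $(\Gamma(TN,\tau_N,N),+,\cdot,[\,,]_{TN})$, where $[\,,]_{TN}$ is the bracket of vector fields. Forms: $\Lambda^q(F,\nu,N)$ is the set of $q$-linear applications $\omega:\Gamma(F,\nu,N)^q\to\mathcal F(N)$ such that $\omega(z_{\sigma(1)},\dots,z_{\sigma(q)})=\operatorname{sgn}(\sigma)\,\omega(z_1,\dots,z_q)$ for every permutation $\sigma$ of $\{1,\dots,q\}$; $\Lambda^0(F,\nu,N)=\mathcal F(N)$; $\Lambda(F,\nu,N)=\bigoplus_{q\ge0}\Lambda^q(F,\nu,N)$. Covariant Lie derivative with respect to $z\in\Gamma(F,\nu,N)$: the $\mathcal F(N)$-multilinear application $L_z:\Lambda(F,\nu,N)\to\Lambda(F,\nu,N)$ defined by $L_z(f)=\Gamma(Th\circ\rho,h\circ\eta)z(f)$ for $f\in\mathcal F(N)$ and, for $\omega\in\Lambda^q(F,\nu,N)$, $$L_z\omega(z_1,\dots,z_q)=\Gamma(Th\circ\rho,h\circ\eta)z\big(\omega(z_1,\dots,z_q)\big)-\sum_{i=1}^q\omega(z_1,\dots,[z,z_i]_{F,h},\dots,z_q).$$ Interior product associated to $z$: the $\mathcal F(N)$-multilinear application $i_z:\Lambda(F,\nu,N)\to\Lambda(F,\nu,N)$ with $i_zf=0$ for $f\in\mathcal F(N)$ and $i_z\omega(z_2,\dots,z_q)=\omega(z,z_2,\dots,z_q)$ for $\omega\in\Lambda^q(F,\nu,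N)$.
   Formalization: The map ω ↦ d^Fω is not F(N)-linear (d(fg) = f dg + g df), so it is shown to be R-linear with each d^Fω an F(N)-multilinear alternating form; the bracket of the Lie F(N)-algebra is taken as R-bilinear, as the Leibniz rule requires. *)

theory Defs
  imports "HOL-Analysis.Analysis" "HOL-Combinatorics.Permutations"
begin

section \<open>Smooth maps between open subsets of finite-dimensional spaces\<close>

text \<open>
  Model spaces are arbitrary types of class \<^class>\<open>real_normed_vector\<close> that are finite-dimensional
  in the sense of \<open>fin_dim\<close>; unlike \<^class>\<open>euclidean_space\<close>, this leaves room for dimension
  \<open>0\<close>.  On an open subset of such a space \<open>C_k\<close> is the usual notion of a
  \<open>k\<close> times continuously differentiable map.
\<close>

definition fin_dim :: "'a::real_normed_vector itself \<Rightarrow> bool"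
  where "fin_dim _ \<longleftrightarrow> (\<exists>B::'a set. finite B \<and> span B = UNIV)"

primrec C_k ::
  "nat \<Rightarrow> 'a::real_normed_vector set \<Rightarrow> ('a \<Rightarrow> 'b::real_normed_vector) \<Rightarrow> bool"
where
  "C_k 0 S f \<longleftrightarrow> continuous_on S f"
| "C_k (Suc k) S f \<longleftrightarrow>
     (\<forall>x\<in>S. f differentiable (at x)) \<and> (\<forall>v. C_k k S (\<lambda>x. frechet_derivative f (at x) v))"

definition smooth_on ::
  "'a::real_normed_vector set \<Rightarrow> ('a \<Rightarrow> 'b::real_normed_vector) \<Rightarrow> bool"
  where "smooth_on S f \<longleftrightarrow> (\<forall>k. C_k k S f)"


section \<open>Manifolds\<close>

text \<open>
  A chart is a domain together with a coordinate map, of which only the values on the domain matter.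
\<close>

type_synonym ('p, 'a) chart = "'p set \<times> ('p \<Rightarrow> 'a)"

record ('p, 'a) manifold =
  pts :: "'p set"
  charts :: "('p, 'a) chart set"

definition chart_inv :: "('p, 'a) chart \<Rightarrow> 'a \<Rightarrow> 'p"
  where "chart_inv c = inv_into (fst c) (snd c)"

text \<open>
  The topology making all charts homeomorphisms onto their images.  The predicate below is a topology
  because charts are injective, see \<open>openin_manifold_topology\<close>.
\<close>

definition manifold_topology :: "('p, 'a::real_normed_vector) manifold \<Rightarrow> 'p topology"
  where "manifold_topology X =
    topology (\<lambda>W. W \<subseteq> pts X \<and> (\<forall>c\<in>charts X. open (snd c ` (fst c \<inter> W))))"

definition smooth_atlas :: "('p, 'a::real_normed_vector) manifold \<Rightarrow> bool"
  where "smooth_atlas X \<longleftrightarrow>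
    (\<forall>c\<in>charts X. fst c \<subseteq> pts X \<and> inj_on (snd c) (fst c) \<and> open (snd c ` fst c)) \<and>
    (\<Union>c\<in>charts X. fst c) = pts X \<and>
    (\<forall>c\<in>charts X. \<forall>d\<in>charts X.
       open (snd c ` (fst c \<inter> fst d)) \<and>
       smooth_on (snd c ` (fst c \<inter> fst d)) (snd d \<circ> chart_inv c))"

definition smooth_manifold :: "('p, 'a::real_normed_vector) manifold \<Rightarrow> bool"
  where "smooth_manifold X \<longleftrightarrow>
    fin_dim TYPE('a) \<and> smooth_atlas X \<and>
    Hausdorff_space (manifold_topology X) \<and> second_countable (manifold_topology X)"

lemma openin_manifold_topology:
  assumes "smooth_atlas X"
  shows "openin (manifold_topology X) W \<longleftrightarrow>
    W \<subseteq> pts X \<and> (\<forall>c\<in>charts X. open (snd c ` (fst c \<inter> W)))"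
proof -
  let ?P = "\<lambda>W. W \<subseteq> pts X \<and> (\<forall>c\<in>charts X. open (snd c ` (fst c \<inter> W)))"
  have "istopology ?P"
    unfolding istopology_def
  proof (intro conjI allI impI)
    fix S T assume S: "?P S" and T: "?P T"
    have "open (snd c ` (fst c \<inter> (S \<inter> T)))" if c: "c \<in> charts X" for c
    proof -
      have "inj_on (snd c) (fst c)"
        using assms c by (simp add: smooth_atlas_def)
      then have "snd c ` ((fst c \<inter> S) \<inter> (fst c \<inter> T)) = snd c ` (fst c \<inter> S) \<inter> snd c ` (fst c \<inter> T)"
        by (rule inj_on_image_Int) auto
      moreover have "fst c \<inter> (S \<inter> T) = (fst c \<inter> S) \<inter> (fst c \<inter> T)"
        by auto
      ultimately show ?thesis
        using S T c by (simp add: open_Int)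
    qed
    then show "S \<inter> T \<subseteq> pts X" "\<forall>c\<in>charts X. open (snd c ` (fst c \<inter> (S \<inter> T)))"
      using S by auto
  next
    fix K assume K: "\<forall>S\<in>K. ?P S"
    have "open (snd c ` (fst c \<inter> \<Union> K))" if c: "c \<in> charts X" for c
    proof -
      have "snd c ` (fst c \<inter> \<Union> K) = (\<Union>S\<in>K. snd c ` (fst c \<inter> S))"
        by auto
      then show ?thesis
        using K c by (auto intro!: open_UN)
    qed
    then show "\<Union> K \<subseteq> pts X" "\<forall>c\<in>charts X. open (snd c ` (fst c \<inter> \<Union> K))"
      using K by auto
  qed
  then show ?thesis
    by (simp add: manifold_topology_def topology_inverse')
qed

text \<open>The openness clause in \<open>smooth_map\<close> expresses continuity.\<close>

definition smooth_map ::
  "('p, 'a::real_normed_vector) manifold \<Rightarrow> ('q, 'b::real_normed_vector) manifold \<Rightarrow> ('p \<Rightarrow> 'q) \<Rightarrow> bool"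
  where "smooth_map X Y f \<longleftrightarrow>
    f ` pts X \<subseteq> pts Y \<and>
    (\<forall>c\<in>charts X. \<forall>d\<in>charts Y.
       open (snd c ` (fst c \<inter> f -` fst d)) \<and>
       smooth_on (snd c ` (fst c \<inter> f -` fst d)) (snd d \<circ> f \<circ> chart_inv c))"

definition diffeomorphism ::
  "('p, 'a::real_normed_vector) manifold \<Rightarrow> ('q, 'b::real_normed_vector) manifold \<Rightarrow> ('p \<Rightarrow> 'q) \<Rightarrow> bool"
  where "diffeomorphism X Y f \<longleftrightarrow>
    bij_betw f (pts X) (pts Y) \<and> smooth_map X Y f \<and> smooth_map Y X (inv_into (pts X) f)"

definition model_manifold :: "('a, 'a::real_normed_vector) manifold"
  where "model_manifold = \<lparr>pts = UNIV, charts = {(UNIV, id)}\<rparr>"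

definition open_submanifold :: "('p, 'a) manifold \<Rightarrow> 'p set \<Rightarrow> ('p, 'a) manifold"
  where "open_submanifold X W = \<lparr>pts = pts X \<inter> W, charts = (\<lambda>c. (fst c \<inter> W, snd c)) ` charts X\<rparr>"

definition product_manifold ::
  "('p, 'a) manifold \<Rightarrow> ('q, 'b) manifold \<Rightarrow> ('p \<times> 'q, 'a \<times> 'b) manifold"
  where "product_manifold X Y =
    \<lparr>pts = pts X \<times> pts Y,
     charts = {(fst c \<times> fst d, map_prod (snd c) (snd d)) | c d. c \<in> charts X \<and> d \<in> charts Y}\<rparr>"

text \<open>
  Functions on \<open>X\<close> are extensional (\<^const>\<open>undefined\<close> off \<open>pts X\<close>), so that equality of
  elements of \<open>smooth_funs X\<close> is equality on \<open>X\<close>.  The same convention is used below for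
  sections, tangent vectors and forms.
\<close>

definition smooth_funs :: "('p, 'a::real_normed_vector) manifold \<Rightarrow> ('p \<Rightarrow> real) set"
  where "smooth_funs X = {f \<in> extensional (pts X). smooth_map X model_manifold f}"


section \<open>Vector bundles\<close>

text \<open>
  The component \<open>vb_trivs\<close> is an atlas of local trivialisations: a pair \<open>(W, \<Phi>)\<close> stands for the
  map \<open>e \<mapsto> (\<pi> e, \<Phi> e)\<close> from the part of the bundle over \<open>W\<close> to \<open>W \<times> 'k\<close>, where
  \<open>'k\<close> is the type fibre.
\<close>

record ('e, 't, 'p, 'a, 'k) vbundle =
  vb_total :: "('e, 't) manifold"
  vb_base :: "('p, 'a) manifold"
  vb_proj :: "'e \<Rightarrow> 'p"
  vb_zero :: "'p \<Rightarrow> 'e"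
  vb_add :: "'e \<Rightarrow> 'e \<Rightarrow> 'e"
  vb_scale :: "real \<Rightarrow> 'e \<Rightarrow> 'e"
  vb_trivs :: "('p set \<times> ('e \<Rightarrow> 'k)) set"

definition fibre :: "('e, 't, 'p, 'a, 'k) vbundle \<Rightarrow> 'p \<Rightarrow> 'e set"
  where "fibre E x = {e \<in> pts (vb_total E). vb_proj E e = x}"

definition local_trivialisation ::
  "('e, 't::real_normed_vector, 'p, 'a::real_normed_vector, 'k::real_normed_vector) vbundle \<Rightarrow>
   'p set \<Rightarrow> ('e \<Rightarrow> 'k) \<Rightarrow> bool"
  where "local_trivialisation E W \<Phi> \<longleftrightarrow>
    openin (manifold_topology (vb_base E)) W \<and>
    diffeomorphism (open_submanifold (vb_total E) (vb_proj E -` W))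
      (product_manifold (open_submanifold (vb_base E) W) model_manifold)
      (\<lambda>e. (vb_proj E e, \<Phi> e)) \<and>
    (\<forall>x\<in>W. \<Phi> (vb_zero E x) = 0 \<and>
       (\<forall>a\<in>fibre E x. \<forall>b\<in>fibre E x. \<Phi> (vb_add E a b) = \<Phi> a + \<Phi> b) \<and>
       (\<forall>r. \<forall>a\<in>fibre E x. \<Phi> (vb_scale E r a) = r *\<^sub>R \<Phi> a))"

text \<open>
  The vector space axioms in the fibres need not be listed: each fibre is closed under the operations,
  and a local trivialisation carries it bijectively and compatibly with them onto \<open>'k\<close>.
\<close>

definition vector_bundle ::
  "('e, 't::real_normed_vector, 'p, 'a::real_normed_vector, 'k::real_normed_vector) vbundle \<Rightarrow> bool"
  where "vector_bundle E \<longleftrightarrow>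
    smooth_manifold (vb_total E) \<and> smooth_manifold (vb_base E) \<and> fin_dim TYPE('k) \<and>
    smooth_map (vb_total E) (vb_base E) (vb_proj E) \<and>
    (\<forall>x\<in>pts (vb_base E).
       vb_zero E x \<in> fibre E x \<and>
       (\<forall>a\<in>fibre E x. \<forall>b\<in>fibre E x. vb_add E a b \<in> fibre E x) \<and>
       (\<forall>r. \<forall>a\<in>fibre E x. vb_scale E r a \<in> fibre E x)) \<and>
    (\<forall>(W, \<Phi>)\<in>vb_trivs E. local_trivialisation E W \<Phi>) \<and>
    (\<Union>(W, \<Phi>)\<in>vb_trivs E. W) = pts (vb_base E)"

definition vb_morphism ::
  "('e, 't::real_normed_vector, 'p, 'a::real_normed_vector, 'k) vbundle \<Rightarrow>
   ('f, 'u::real_normed_vector, 'q, 'b::real_normed_vector, 'l) vbundle \<Rightarrow>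
   ('e \<Rightarrow> 'f) \<Rightarrow> ('p \<Rightarrow> 'q) \<Rightarrow> bool"
  where "vb_morphism E E' \<phi> \<phi>0 \<longleftrightarrow>
    smooth_map (vb_total E) (vb_total E') \<phi> \<and> smooth_map (vb_base E) (vb_base E') \<phi>0 \<and>
    (\<forall>e\<in>pts (vb_total E). vb_proj E' (\<phi> e) = \<phi>0 (vb_proj E e)) \<and>
    (\<forall>x\<in>pts (vb_base E).
       (\<forall>a\<in>fibre E x. \<forall>b\<in>fibre E x. \<phi> (vb_add E a b) = vb_add E' (\<phi> a) (\<phi> b)) \<and>
       (\<forall>r. \<forall>a\<in>fibre E x. \<phi> (vb_scale E r a) = vb_scale E' r (\<phi> a)))"

definition sections ::
  "('e, 't::real_normed_vector, 'p, 'a::real_normed_vector, 'k) vbundle \<Rightarrow> ('p \<Rightarrow> 'e) set"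
  where "sections E =
    {u \<in> extensional (pts (vb_base E)). smooth_map (vb_base E) (vb_total E) u \<and>
       (\<forall>x\<in>pts (vb_base E). vb_proj E (u x) = x)}"

definition sec_zero :: "('e, 't, 'p, 'a, 'k) vbundle \<Rightarrow> 'p \<Rightarrow> 'e"
  where "sec_zero E = (\<lambda>x\<in>pts (vb_base E). vb_zero E x)"

definition sec_add ::
  "('e, 't, 'p, 'a, 'k) vbundle \<Rightarrow> ('p \<Rightarrow> 'e) \<Rightarrow> ('p \<Rightarrow> 'e) \<Rightarrow> 'p \<Rightarrow> 'e"
  where "sec_add E u v = (\<lambda>x\<in>pts (vb_base E). vb_add E (u x) (v x))"

definition sec_mult ::
  "('e, 't, 'p, 'a, 'k) vbundle \<Rightarrow> ('p \<Rightarrow> real) \<Rightarrow> ('p \<Rightarrow> 'e) \<Rightarrow> 'p \<Rightarrow> 'e"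
  where "sec_mult E f u = (\<lambda>x\<in>pts (vb_base E). vb_scale E (f x) (u x))"

definition sec_map ::
  "('e, 't, 'p, 'a, 'k) vbundle \<Rightarrow> ('f, 'u, 'q, 'b, 'l) vbundle \<Rightarrow>
   ('e \<Rightarrow> 'f) \<Rightarrow> ('p \<Rightarrow> 'q) \<Rightarrow> ('p \<Rightarrow> 'e) \<Rightarrow> 'q \<Rightarrow> 'f"
  where "sec_map E E' \<phi> \<phi>0 u =
    (\<lambda>y\<in>pts (vb_base E'). \<phi> (u (inv_into (pts (vb_base E)) \<phi>0 y)))"


section \<open>The tangent bundle\<close>

text \<open>
  A tangent vector at \<open>p\<close> is a derivation of \<open>smooth_funs X\<close> at \<open>p\<close>, written in a chart as a
  directional derivative: \<open>coord_vector X c p w\<close> is \<open>\<Sum>i. w i \<partial>/\<partial>x i\<close> at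
  \<open>p\<close> for the coordinates of \<open>c\<close>.  The fibre coordinates \<open>vector_coord X c (p, v)\<close> of a tangent
  vector are determined uniquely because manifolds are Hausdorff (bump functions).
\<close>

type_synonym 'p tangent_vector = "('p \<Rightarrow> real) \<Rightarrow> real"

definition coord_vector ::
  "('p, 'a::real_normed_vector) manifold \<Rightarrow> ('p, 'a) chart \<Rightarrow> 'p \<Rightarrow> 'a \<Rightarrow> 'p tangent_vector"
  where "coord_vector X c p w =
    (\<lambda>f\<in>smooth_funs X. frechet_derivative (f \<circ> chart_inv c) (at (snd c p)) w)"

definition tangent_space :: "('p, 'a::real_normed_vector) manifold \<Rightarrow> 'p \<Rightarrow> 'p tangent_vector set"
  where "tangent_space X p = {coord_vector X c p w | c w. c \<in> charts X \<and> p \<in> fst c}"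

definition vector_coord ::
  "('p, 'a::real_normed_vector) manifold \<Rightarrow> ('p, 'a) chart \<Rightarrow> 'p \<times> 'p tangent_vector \<Rightarrow> 'a"
  where "vector_coord X c e = inv (coord_vector X c (fst e)) (snd e)"

definition tangent_manifold ::
  "('p, 'a::real_normed_vector) manifold \<Rightarrow> ('p \<times> 'p tangent_vector, 'a \<times> 'a) manifold"
  where "tangent_manifold X =
    \<lparr>pts = Sigma (pts X) (tangent_space X),
     charts = (\<lambda>c. (Sigma (fst c) (tangent_space X), \<lambda>e. (snd c (fst e), vector_coord X c e)))
                ` charts X\<rparr>"

definition tangent_bundle ::
  "('p, 'a::real_normed_vector) manifold \<Rightarrow> ('p \<times> 'p tangent_vector, 'a \<times> 'a, 'p, 'a, 'a) vbundle"
  where "tangent_bundle X =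
    \<lparr>vb_total = tangent_manifold X,
     vb_base = X,
     vb_proj = fst,
     vb_zero = (\<lambda>p. (p, \<lambda>f\<in>smooth_funs X. 0)),
     vb_add = (\<lambda>a b. (fst a, \<lambda>f\<in>smooth_funs X. snd a f + snd b f)),
     vb_scale = (\<lambda>r a. (fst a, \<lambda>f\<in>smooth_funs X. r * snd a f)),
     vb_trivs = (\<lambda>c. (fst c, vector_coord X c)) ` charts X\<rparr>"

definition tangent_map ::
  "('p, 'a::real_normed_vector) manifold \<Rightarrow> ('q, 'b::real_normed_vector) manifold \<Rightarrow> ('p \<Rightarrow> 'q) \<Rightarrow>
   'p \<times> 'p tangent_vector \<Rightarrow> 'q \<times> 'q tangent_vector"
  where "tangent_map X Y h e =
    (h (fst e), \<lambda>f\<in>smooth_funs Y. snd e (\<lambda>x\<in>pts X. f (h x)))"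

definition vf_apply ::
  "('p, 'a::real_normed_vector) manifold \<Rightarrow> ('p \<Rightarrow> 'p \<times> 'p tangent_vector) \<Rightarrow> ('p \<Rightarrow> real) \<Rightarrow> 'p \<Rightarrow> real"
  where "vf_apply X Z f = (\<lambda>x\<in>pts X. snd (Z x) f)"

definition vf_bracket ::
  "('p, 'a::real_normed_vector) manifold \<Rightarrow> ('p \<Rightarrow> 'p \<times> 'p tangent_vector) \<Rightarrow>
   ('p \<Rightarrow> 'p \<times> 'p tangent_vector) \<Rightarrow> 'p \<Rightarrow> 'p \<times> 'p tangent_vector"
  where "vf_bracket X Y Z =
    (\<lambda>x\<in>pts X. (x, \<lambda>f\<in>smooth_funs X. snd (Y x) (vf_apply X Z f) - snd (Z x) (vf_apply X Y f)))"


section \<open>Generalized Lie algebroids\<close>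

text \<open>
  The bracket on the module of sections is bilinear over the real constants; bilinearity over all
  smooth functions is not required, being replaced by the Leibniz rule in \<open>gen_lie_algebroid\<close>.
\<close>

definition lie_bracket_on ::
  "('e, 't::real_normed_vector, 'p, 'a::real_normed_vector, 'k) vbundle \<Rightarrow>
   (('p \<Rightarrow> 'e) \<Rightarrow> ('p \<Rightarrow> 'e) \<Rightarrow> 'p \<Rightarrow> 'e) \<Rightarrow> bool"
  where "lie_bracket_on E br \<longleftrightarrow>
    (\<forall>u\<in>sections E. \<forall>v\<in>sections E. br u v \<in> sections E) \<and>
    (\<forall>u\<in>sections E. \<forall>v\<in>sections E. \<forall>w\<in>sections E.
       br (sec_add E u v) w = sec_add E (br u w) (br v w) \<and>
       br w (sec_add E u v) = sec_add E (br w u) (br w v)) \<and>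
    (\<forall>r. \<forall>u\<in>sections E. \<forall>v\<in>sections E.
       br (sec_mult E (\<lambda>_. r) u) v = sec_mult E (\<lambda>_. r) (br u v) \<and>
       br u (sec_mult E (\<lambda>_. r) v) = sec_mult E (\<lambda>_. r) (br u v)) \<and>
    (\<forall>u\<in>sections E. br u u = sec_zero E) \<and>
    (\<forall>u\<in>sections E. \<forall>v\<in>sections E. \<forall>w\<in>sections E.
       sec_add E (br u (br v w)) (sec_add E (br v (br w u)) (br w (br u v))) = sec_zero E)"

text \<open>
  Throughout, \<open>F\<close> is the bundle over \<open>N = vb_base F\<close>; \<open>gla_anchor\<close> is
  \<open>\<Gamma>(Th \<circ> \<rho>, h \<circ> \<eta>)\<close>, with values in vector fields on \<open>N\<close>, and \<open>gla_act\<close> is the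
  resulting action of sections of \<open>F\<close> on functions on \<open>N\<close>.
\<close>

definition gla_anchor ::
  "('f, 't, 'n, 'b::real_normed_vector, 'k) vbundle \<Rightarrow> ('m, 'a::real_normed_vector) manifold \<Rightarrow>
   ('m \<Rightarrow> 'n) \<Rightarrow> ('n \<Rightarrow> 'm) \<Rightarrow> ('f \<Rightarrow> 'm \<times> 'm tangent_vector) \<Rightarrow>
   ('n \<Rightarrow> 'f) \<Rightarrow> 'n \<Rightarrow> 'n \<times> 'n tangent_vector"
  where "gla_anchor F M h \<eta> \<rho> =
    sec_map F (tangent_bundle (vb_base F)) (tangent_map M (vb_base F) h \<circ> \<rho>) (h \<circ> \<eta>)"

definition gla_act ::
  "('f, 't, 'n, 'b::real_normed_vector, 'k) vbundle \<Rightarrow> ('m, 'a::real_normed_vector) manifold \<Rightarrow>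
   ('m \<Rightarrow> 'n) \<Rightarrow> ('n \<Rightarrow> 'm) \<Rightarrow> ('f \<Rightarrow> 'm \<times> 'm tangent_vector) \<Rightarrow>
   ('n \<Rightarrow> 'f) \<Rightarrow> ('n \<Rightarrow> real) \<Rightarrow> 'n \<Rightarrow> real"
  where "gla_act F M h \<eta> \<rho> u f = vf_apply (vb_base F) (gla_anchor F M h \<eta> \<rho> u) f"

definition gen_lie_algebroid ::
  "('f, 't::real_normed_vector, 'n, 'b::real_normed_vector, 'k::real_normed_vector) vbundle \<Rightarrow>
   ('m, 'a::real_normed_vector) manifold \<Rightarrow> ('m \<Rightarrow> 'n) \<Rightarrow> ('n \<Rightarrow> 'm) \<Rightarrow>
   (('n \<Rightarrow> 'f) \<Rightarrow> ('n \<Rightarrow> 'f) \<Rightarrow> 'n \<Rightarrow> 'f) \<Rightarrow>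
   ('f \<Rightarrow> 'm \<times> 'm tangent_vector) \<Rightarrow> bool"
  where "gen_lie_algebroid F M h \<eta> br \<rho> \<longleftrightarrow>
    smooth_manifold M \<and> vector_bundle F \<and>
    diffeomorphism M (vb_base F) h \<and> diffeomorphism (vb_base F) M \<eta> \<and>
    vb_morphism F (tangent_bundle M) \<rho> \<eta> \<and>
    (\<forall>u\<in>sections F. \<forall>v\<in>sections F. \<forall>f\<in>smooth_funs (vb_base F).
       br u (sec_mult F f v) =
         sec_add F (sec_mult F f (br u v)) (sec_mult F (gla_act F M h \<eta> \<rho> u f) v)) \<and>
    lie_bracket_on F br \<and>
    (\<forall>u\<in>sections F. \<forall>v\<in>sections F.
       gla_anchor F M h \<eta> \<rho> (br u v) =
         vf_bracket (vb_base F) (gla_anchor F M h \<eta> \<rho> u) (gla_anchor F M h \<eta> \<rho> v))"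


section \<open>Forms and the operators on them\<close>

text \<open>
  The arguments \<open>(z\<^sub>1, \<dots>, z\<^sub>q)\<close> of a \<open>q\<close>-form are a list of length \<open>q\<close>.  In particular a
  \<open>0\<close>-form is a map on \<open>{[]}\<close>, identified with the smooth function that is its value.
\<close>

type_synonym ('p, 'e) form = "('p \<Rightarrow> 'e) list \<Rightarrow> 'p \<Rightarrow> real"

definition tuples ::
  "('e, 't::real_normed_vector, 'p, 'a::real_normed_vector, 'k) vbundle \<Rightarrow> nat \<Rightarrow> ('p \<Rightarrow> 'e) list set"
  where "tuples E q = {zs. length zs = q \<and> set zs \<subseteq> sections E}"

definition forms ::
  "('e, 't::real_normed_vector, 'p, 'a::real_normed_vector, 'k) vbundle \<Rightarrow> nat \<Rightarrow> ('p, 'e) form set"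
  where "forms E q =
    {\<omega> \<in> tuples E q \<rightarrow>\<^sub>E smooth_funs (vb_base E).
      (\<forall>zs\<in>tuples E q. \<forall>i<q. \<forall>u\<in>sections E. \<forall>v\<in>sections E. \<forall>x\<in>pts (vb_base E).
         \<omega> (zs[i := sec_add E u v]) x = \<omega> (zs[i := u]) x + \<omega> (zs[i := v]) x) \<and>
      (\<forall>zs\<in>tuples E q. \<forall>i<q. \<forall>f\<in>smooth_funs (vb_base E). \<forall>u\<in>sections E. \<forall>x\<in>pts (vb_base E).
         \<omega> (zs[i := sec_mult E f u]) x = f x * \<omega> (zs[i := u]) x) \<and>
      (\<forall>zs\<in>tuples E q. \<forall>\<sigma>. \<sigma> permutes {..<q} \<longrightarrow> (\<forall>x\<in>pts (vb_base E).
         \<omega> (permute_list \<sigma> zs) x = of_int (sign \<sigma>) * \<omega> zs x))}"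

definition form_zero ::
  "('e, 't::real_normed_vector, 'p, 'a::real_normed_vector, 'k) vbundle \<Rightarrow> nat \<Rightarrow> ('p, 'e) form"
  where "form_zero E q = (\<lambda>zs\<in>tuples E q. \<lambda>x\<in>pts (vb_base E). 0)"

definition form_add ::
  "('e, 't::real_normed_vector, 'p, 'a::real_normed_vector, 'k) vbundle \<Rightarrow> nat \<Rightarrow>
   ('p, 'e) form \<Rightarrow> ('p, 'e) form \<Rightarrow> ('p, 'e) form"
  where "form_add E q \<omega> \<theta> = (\<lambda>zs\<in>tuples E q. \<lambda>x\<in>pts (vb_base E). \<omega> zs x + \<theta> zs x)"

definition form_scale ::
  "('e, 't::real_normed_vector, 'p, 'a::real_normed_vector, 'k) vbundle \<Rightarrow> nat \<Rightarrow>
   real \<Rightarrow> ('p, 'e) form \<Rightarrow> ('p, 'e) form"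
  where "form_scale E q r \<omega> = (\<lambda>zs\<in>tuples E q. \<lambda>x\<in>pts (vb_base E). r * \<omega> zs x)"

text \<open>
  In the next three definitions \<open>A\<close> is the action of sections on functions and \<open>br\<close> the bracket.
  The index \<open>q\<close> is the degree of the argument for \<open>lie_deriv\<close> and \<open>ext_d\<close>, and the degree of the
  result for \<open>int_prod\<close>.  For \<open>q = 0\<close> the first and third read \<open>A z f\<close> and
  \<open>d f (z) = A z f\<close>.
\<close>

definition lie_deriv ::
  "('e, 't::real_normed_vector, 'p, 'a::real_normed_vector, 'k) vbundle \<Rightarrow>
   (('p \<Rightarrow> 'e) \<Rightarrow> ('p \<Rightarrow> real) \<Rightarrow> 'p \<Rightarrow> real) \<Rightarrow> (('p \<Rightarrow> 'e) \<Rightarrow> ('p \<Rightarrow> 'e) \<Rightarrow> 'p \<Rightarrow> 'e) \<Rightarrow>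
   ('p \<Rightarrow> 'e) \<Rightarrow> nat \<Rightarrow> ('p, 'e) form \<Rightarrow> ('p, 'e) form"
  where "lie_deriv E A br z q \<omega> =
    (\<lambda>zs\<in>tuples E q. \<lambda>x\<in>pts (vb_base E).
       A z (\<omega> zs) x - (\<Sum>i<q. \<omega> (zs[i := br z (zs ! i)]) x))"

definition int_prod ::
  "('e, 't::real_normed_vector, 'p, 'a::real_normed_vector, 'k) vbundle \<Rightarrow>
   ('p \<Rightarrow> 'e) \<Rightarrow> nat \<Rightarrow> ('p, 'e) form \<Rightarrow> ('p, 'e) form"
  where "int_prod E z q \<omega> = (\<lambda>zs\<in>tuples E q. \<omega> (z # zs))"

definition omit :: "nat \<Rightarrow> 'z list \<Rightarrow> 'z list"
  where "omit i zs = take i zs @ drop (Suc i) zs"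

definition ext_d ::
  "('e, 't::real_normed_vector, 'p, 'a::real_normed_vector, 'k) vbundle \<Rightarrow>
   (('p \<Rightarrow> 'e) \<Rightarrow> ('p \<Rightarrow> real) \<Rightarrow> 'p \<Rightarrow> real) \<Rightarrow> (('p \<Rightarrow> 'e) \<Rightarrow> ('p \<Rightarrow> 'e) \<Rightarrow> 'p \<Rightarrow> 'e) \<Rightarrow>
   nat \<Rightarrow> ('p, 'e) form \<Rightarrow> ('p, 'e) form"
  where "ext_d E A br q \<omega> =
    (\<lambda>zs\<in>tuples E (Suc q). \<lambda>x\<in>pts (vb_base E).
       (\<Sum>i\<le>q. (-1) ^ i * A (zs ! i) (\<omega> (omit i zs)) x) +
       (\<Sum>j\<le>q. \<Sum>i<j. (-1) ^ (i + j) * \<omega> (br (zs ! i) (zs ! j) # omit i (omit j zs)) x))"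

text \<open>
  The direct sum \<open>\<Lambda>(E)\<close> consists of the finitely supported families of homogeneous components.
  The operators act componentwise; \<open>i\<^sub>z\<close> kills functions since it ignores the component of degree
  \<open>0\<close>.
\<close>

definition graded_forms ::
  "('e, 't::real_normed_vector, 'p, 'a::real_normed_vector, 'k) vbundle \<Rightarrow> (nat \<Rightarrow> ('p, 'e) form) set"
  where "graded_forms E = {\<omega>. (\<forall>q. \<omega> q \<in> forms E q) \<and> finite {q. \<omega> q \<noteq> form_zero E q}}"

definition graded_add ::
  "('e, 't::real_normed_vector, 'p, 'a::real_normed_vector, 'k) vbundle \<Rightarrow>
   (nat \<Rightarrow> ('p, 'e) form) \<Rightarrow> (nat \<Rightarrow> ('p, 'e) form) \<Rightarrow> nat \<Rightarrow> ('p, 'e) form"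
  where "graded_add E \<omega> \<theta> = (\<lambda>q. form_add E q (\<omega> q) (\<theta> q))"

definition graded_lie_deriv ::
  "('e, 't::real_normed_vector, 'p, 'a::real_normed_vector, 'k) vbundle \<Rightarrow>
   (('p \<Rightarrow> 'e) \<Rightarrow> ('p \<Rightarrow> real) \<Rightarrow> 'p \<Rightarrow> real) \<Rightarrow> (('p \<Rightarrow> 'e) \<Rightarrow> ('p \<Rightarrow> 'e) \<Rightarrow> 'p \<Rightarrow> 'e) \<Rightarrow>
   ('p \<Rightarrow> 'e) \<Rightarrow> (nat \<Rightarrow> ('p, 'e) form) \<Rightarrow> nat \<Rightarrow> ('p, 'e) form"
  where "graded_lie_deriv E A br z \<omega> = (\<lambda>q. lie_deriv E A br z q (\<omega> q))"

definition graded_int_prod ::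
  "('e, 't::real_normed_vector, 'p, 'a::real_normed_vector, 'k) vbundle \<Rightarrow>
   ('p \<Rightarrow> 'e) \<Rightarrow> (nat \<Rightarrow> ('p, 'e) form) \<Rightarrow> nat \<Rightarrow> ('p, 'e) form"
  where "graded_int_prod E z \<omega> = (\<lambda>q. int_prod E z q (\<omega> (Suc q)))"

definition graded_raise ::
  "('e, 't::real_normed_vector, 'p, 'a::real_normed_vector, 'k) vbundle \<Rightarrow>
   (nat \<Rightarrow> ('p, 'e) form \<Rightarrow> ('p, 'e) form) \<Rightarrow> (nat \<Rightarrow> ('p, 'e) form) \<Rightarrow> nat \<Rightarrow> ('p, 'e) form"
  where "graded_raise E D \<omega> = (\<lambda>q. case q of 0 \<Rightarrow> form_zero E 0 | Suc r \<Rightarrow> D r (\<omega> r))"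

definition degree_one_map ::
  "('e, 't::real_normed_vector, 'p, 'a::real_normed_vector, 'k) vbundle \<Rightarrow>
   (nat \<Rightarrow> ('p, 'e) form \<Rightarrow> ('p, 'e) form) \<Rightarrow> bool"
  where "degree_one_map E D \<longleftrightarrow> (\<forall>q. \<forall>\<omega>\<in>forms E q. D q \<omega> \<in> forms E (Suc q))"

text \<open>
  A first order operator such as \<open>ext_d\<close> is linear over the real constants only:
  \<open>d (f g) = f dg + g df\<close>.  Multilinearity over smooth functions is a property of each form
  \<open>D q \<omega>\<close>, contained in \<open>forms E (Suc q)\<close>.
\<close>

definition real_linear_map ::
  "('e, 't::real_normed_vector, 'p, 'a::real_normed_vector, 'k) vbundle \<Rightarrow>
   (nat \<Rightarrow> ('p, 'e) form \<Rightarrow> ('p, 'e) form) \<Rightarrow> bool"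
  where "real_linear_map E D \<longleftrightarrow>
    (\<forall>q. \<forall>\<omega>\<in>forms E q.
       (\<forall>\<theta>\<in>forms E q. D q (form_add E q \<omega> \<theta>) = form_add E (Suc q) (D q \<omega>) (D q \<theta>)) \<and>
       (\<forall>r. D q (form_scale E q r \<omega>) = form_scale E (Suc q) r (D q \<omega>)))"

definition cartan_formula ::
  "('e, 't::real_normed_vector, 'p, 'a::real_normed_vector, 'k) vbundle \<Rightarrow>
   (('p \<Rightarrow> 'e) \<Rightarrow> ('p \<Rightarrow> real) \<Rightarrow> 'p \<Rightarrow> real) \<Rightarrow> (('p \<Rightarrow> 'e) \<Rightarrow> ('p \<Rightarrow> 'e) \<Rightarrow> 'p \<Rightarrow> 'e) \<Rightarrow>
   (nat \<Rightarrow> ('p, 'e) form \<Rightarrow> ('p, 'e) form) \<Rightarrow> bool"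
  where "cartan_formula E A br D \<longleftrightarrow>
    (\<forall>z\<in>sections E. \<forall>\<omega>\<in>graded_forms E.
       graded_lie_deriv E A br z \<omega> =
         graded_add E (graded_raise E D (graded_int_prod E z \<omega>))
                      (graded_int_prod E z (graded_raise E D \<omega>)))"

end

theory Submission
  imports Defs
begin

text \<open>
  Cartan's formula \<open>i\<^sub>z d = L\<^sub>z - d i\<^sub>z\<close> is a direct computation with the defining sums.  It determines
  \<open>d\<close> on \<open>q\<close>-forms from \<open>d\<close> on forms of smaller degree, which gives uniqueness, and by the same
  induction \<open>d \<omega> (z\<^sub>0, -)\<close> is a form for every \<open>z\<^sub>0\<close>; applying the formula twice shows that \<open>d \<omega>\<close> changes
  sign when \<open>z\<^sub>0\<close> and \<open>z\<^sub>1\<close> are exchanged.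

  The analytic input is that a section acts on smooth functions by a derivation that is linear over
  functions in the section.  The anchor covers \<open>h \<circ> \<eta>\<close>, so a priori a factor \<open>g\<close> comes out as
  \<open>g \<circ> (h \<circ> \<eta>)\<^sup>-\<^sup>1\<close>.  Expanding \<open>[f u, g v]\<close> with the Leibniz rule in both orders shows, however, that
  the anchor vanishes at all points moved by \<open>h \<circ> \<eta>\<close>, provided some section is nonzero there;
  such sections exist by bump functions.
\<close>

section \<open>Calculus of smooth maps\<close>

text \<open>Multilinearity needs a separate argument in slot 0 only: the other slots of
  \<open>d \<omega>\<close> are slots of the form obtained by fixing the first entry, and once
  \<open>d \<omega>\<close> has degree at least 2 an exchange carries slot 0 to slot 1. A 1-form
  \<open>d f\<close> has no slot 1, so there linearity over functions has to come from the anchor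
  itself; this is what the study of the points moved by \<open>h \<circ> \<eta>\<close> is for.
  Fibres of dimension 0 admit no nonzero section and get their own argument. Alternation is tested
  on neighbouring entries throughout, since these exchanges fit the recursion on lists and generate
  all permutations. Two features of the definitions shape the analysis. \<open>C_k\<close> controls
  derivatives in each fixed direction, whereas the chain rule and vector fields differentiate in
  varying directions; a finite basis with continuous coordinates bridges this. And the model spaces
  carry an arbitrary norm and may have dimension 0, so continuity of coordinates and compact
  neighbourhoods are built by hand from a basis.\<close>

lemma C_k_subset: "C_k k S f \<Longrightarrow> T \<subseteq> S \<Longrightarrow> C_k k T f"
  by (induction k arbitrary: f) (auto intro: continuous_on_subset)

lemma C_k_Suc_imp: "C_k (Suc k) S f \<Longrightarrow> C_k k S f"
proof (induction k arbitrary: f)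
  case 0
  then show ?case
    by (auto intro!: continuous_at_imp_continuous_on differentiable_imp_continuous_within)
next
  case (Suc k)
  then show ?case
    by (metis C_k.simps(2))
qed

text \<open>\<open>C_k\<close> uses derivatives in the ambient space. Openness of \<open>S\<close>
  turns equality on \<open>S\<close> into equality near each of its points, which passes to every
  derivative.\<close>

lemma C_k_cong:
  assumes "open S" "\<And>x. x \<in> S \<Longrightarrow> f x = g x" "C_k k S f"
  shows "C_k k S g"
  using assms
proof (induction k arbitrary: f g)
  case 0
  then show ?case by (simp cong: continuous_on_cong)
next
  case (Suc k)
  have *: "frechet_derivative g (at x) = frechet_derivative f (at x)" if "x \<in> S" for x
  proof -
    have "(f has_derivative D) (at x) \<longleftrightarrow> (g has_derivative D) (at x)" for D
      using has_derivative_transform_within_open[OF _ Suc.prems(1) that, of f D UNIV g]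
        has_derivative_transform_within_open[OF _ Suc.prems(1) that, of g D UNIV f] Suc.prems(2)
      by auto
    then show ?thesis by (simp add: frechet_derivative_def)
  qed
  have d: "g differentiable (at x)" if "x \<in> S" for x
    using Suc.prems that has_derivative_transform_within_open[of f _ x UNIV S g]
    unfolding differentiable_def C_k.simps by blast
  show ?case
    unfolding C_k.simps
  proof (intro conjI ballI allI d)
    fix v
    show "C_k k S (\<lambda>x. frechet_derivative g (at x) v)"
      by (rule Suc.IH[of "\<lambda>x. frechet_derivative f (at x) v"])
        (use Suc.prems * in auto)
  qed
qed

lemma C_k_local:
  assumes "\<And>x. x \<in> S \<Longrightarrow> \<exists>U. open U \<and> x \<in> U \<and> C_k k U f"
  shows "C_k k S f"
  using assms
proof (induction k arbitrary: f)
  case 0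
  show ?case
    unfolding C_k.simps
  proof (intro continuous_at_imp_continuous_on ballI)
    fix x assume "x \<in> S"
    then obtain U where "open U" "x \<in> U" "continuous_on U f"
      using 0 by auto
    then show "isCont f x" by (simp add: continuous_on_eq_continuous_at)
  qed
next
  case (Suc k)
  show ?case
    unfolding C_k.simps
  proof (intro conjI ballI allI)
    show "f differentiable at x" if "x \<in> S" for x
      using Suc.prems[OF that] by auto
    show "C_k k S (\<lambda>x. frechet_derivative f (at x) v)" for v
      by (rule Suc.IH) (use Suc.prems in fastforce)
  qed
qed

text \<open>The induction step of the closure properties below: any explicit derivative
  \<open>f'\<close> may stand for \<open>frechet_derivative\<close>, so the recursion runs on a
  formula.\<close>

lemma C_k_SucI:
  assumes "open S" "\<And>x. x \<in> S \<Longrightarrow> (f has_derivative f' x) (at x)"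
    "\<And>v. C_k k S (\<lambda>x. f' x v)"
  shows "C_k (Suc k) S f"
  unfolding C_k.simps
proof (intro conjI ballI allI)
  show "f differentiable at x" if "x \<in> S" for x
    using assms(2)[OF that] by (rule differentiableI)
  show "C_k k S (\<lambda>x. frechet_derivative f (at x) v)" for v
    by (rule C_k_cong[OF assms(1) _ assms(3)[of v]]) (metis assms(2) frechet_derivative_at)
qed

lemma C_k_SucD:
  assumes "C_k (Suc k) S f" "x \<in> S"
  shows "(f has_derivative frechet_derivative f (at x)) (at x)"
  using assms frechet_derivative_works by auto

lemma C_k_const: "open S \<Longrightarrow> C_k k S (\<lambda>x. c)"
proof (induction k arbitrary: c)
  case (Suc k)
  show ?case by (rule C_k_SucI[where f' = "\<lambda>x v. 0"]) (auto simp: Suc)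
qed simp

lemma C_k_bounded_linear:
  assumes "bounded_linear L" "open S" "C_k k S f"
  shows "C_k k S (\<lambda>x. L (f x))"
  using assms(3)
proof (induction k arbitrary: f)
  case 0
  then show ?case using assms(1) bounded_linear.continuous_on by auto
next
  case (Suc k)
  show ?case
  proof (rule C_k_SucI[OF assms(2)])
    show "((\<lambda>x. L (f x)) has_derivative (\<lambda>v. L (frechet_derivative f (at x) v))) (at x)"
      if "x \<in> S" for x
      using bounded_linear.has_derivative[OF assms(1) C_k_SucD[OF Suc.prems that]] .
    show "C_k k S (\<lambda>x. L (frechet_derivative f (at x) v))" for v
      using Suc by simp
  qed
qed

lemma C_k_id: "open S \<Longrightarrow> C_k k S (\<lambda>x. x)"
proof (cases k)
  case (Suc j)
  then show "open S \<Longrightarrow> ?thesis"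
    using C_k_SucI[of S "\<lambda>x. x" "\<lambda>x v. v" j] C_k_const by (auto simp: has_derivative_ident)
qed simp

lemma C_k_add:
  assumes "open S" "C_k k S f" "C_k k S g"
  shows "C_k k S (\<lambda>x. f x + g x)"
  using assms(2,3)
proof (induction k arbitrary: f g)
  case 0
  then show ?case by (simp add: continuous_on_add)
next
  case (Suc k)
  show ?case
    by (rule C_k_SucI[OF assms(1) has_derivative_add[OF C_k_SucD[OF Suc.prems(1)] C_k_SucD[OF Suc.prems(2)]]])
      (use Suc in auto)
qed

lemma C_k_sum:
  assumes "open S" "\<And>b. b \<in> B \<Longrightarrow> C_k k S (f b)"
  shows "C_k k S (\<lambda>x. \<Sum>b\<in>B. f b x)"
  using assms(2) by (induction B rule: infinite_finite_induct) (auto simp: C_k_const C_k_add assms(1))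

lemma C_k_scaleR:
  fixes r :: "'a::real_normed_vector \<Rightarrow> real"
  assumes "open S" "C_k k S r" "C_k k S g"
  shows "C_k k S (\<lambda>x. r x *\<^sub>R g x)"
  using assms(2,3)
proof (induction k arbitrary: r g)
  case 0
  then show ?case by (simp add: continuous_on_scaleR)
next
  case (Suc k)
  show ?case
  proof (rule C_k_SucI[OF assms(1) has_derivative_scaleR[OF C_k_SucD[OF Suc.prems(1)] C_k_SucD[OF Suc.prems(2)]]])
    fix v
    \<comment> \<open>The product rule keeps one factor undifferentiated in each term; that factor
      is lowered from order \<open>Suc k\<close> to \<open>k\<close>.\<close>
    show "C_k k S (\<lambda>x. r x *\<^sub>R frechet_derivative g (at x) v + frechet_derivative r (at x) v *\<^sub>R g x)"
      using Suc.prems C_k_Suc_imp[OF Suc.prems(1)] C_k_Suc_imp[OF Suc.prems(2)]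
      by (intro C_k_add[OF assms(1)] Suc.IH) auto
  qed
qed

lemma C_k_Pair:
  assumes "open S" "C_k k S f" "C_k k S g"
  shows "C_k k S (\<lambda>x. (f x, g x))"
proof -
  have "C_k k S (\<lambda>x. (f x, 0) + (0, g x))"
    by (intro C_k_add C_k_bounded_linear[where L = "\<lambda>x. (x, 0)"]
        C_k_bounded_linear[where L = "\<lambda>x. (0, x)"] assms bounded_linear_Pair
        bounded_linear_ident bounded_linear_zero)
  then show ?thesis by simp
qed

section \<open>Continuous coordinates in finite-dimensional normed spaces\<close>

text \<open>Continuity of the coordinates of an independent family, for any norm. In the induction
  the new vector \<open>a\<close> keeps a positive distance from the span of \<open>B\<close>: a
  sequence in the span tending to \<open>a\<close> has Cauchy coefficients by the induction
  hypothesis, so its limit would lie in the span.\<close>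

lemma independent_coeff_bound:
  fixes B :: "'a::real_normed_vector set"
  assumes "finite B" "independent B"
  shows "\<exists>C\<ge>0. \<forall>c. \<forall>b\<in>B. \<bar>c b\<bar> \<le> C * norm (\<Sum>b\<in>B. c b *\<^sub>R b)"
  using assms
proof (induction B rule: finite_induct)
  case empty
  then show ?case by auto
next
  case (insert a B)
  then have aB: "a \<notin> span B" and indB: "independent B"
    by (auto simp: independent_insert)
  obtain C where C: "C \<ge> 0" "\<And>c b. b \<in> B \<Longrightarrow> \<bar>c b\<bar> \<le> C * norm (\<Sum>b\<in>B. c b *\<^sub>R b)"
    using insert.IH indB by meson
  have "\<exists>\<delta>>0. \<forall>c. norm (a - (\<Sum>b\<in>B. c b *\<^sub>R b)) \<ge> \<delta>"
  proof (rule ccontr)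
    assume neg: "\<not> ?thesis"
    have "\<exists>c. norm (a - (\<Sum>b\<in>B. c b *\<^sub>R b)) < inverse (real (Suc n))" for n
    proof -
      have "inverse (real (Suc n)) > 0" by simp
      with neg show ?thesis by (meson not_le)
    qed
    then obtain c where c: "\<And>n. norm (a - (\<Sum>b\<in>B. c n b *\<^sub>R b)) < inverse (real (Suc n))"
      by metis
    have lim: "(\<lambda>n. \<Sum>b\<in>B. c n b *\<^sub>R b) \<longlonglongrightarrow> a"
    proof (rule LIM_zero_cancel, rule Lim_null_comparison)
      show "\<forall>\<^sub>F n in sequentially. norm ((\<Sum>b\<in>B. c n b *\<^sub>R b) - a) \<le> inverse (real (Suc n))"
        using c by (simp add: norm_minus_commute less_imp_le)
    qed (rule LIMSEQ_inverse_real_of_nat)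
    then have Cau: "Cauchy (\<lambda>n. \<Sum>b\<in>B. c n b *\<^sub>R b)"
      using LIMSEQ_imp_Cauchy by blast
    have "convergent (\<lambda>n. c n b)" if b: "b \<in> B" for b
    proof -
      have "\<exists>M. \<forall>m\<ge>M. \<forall>n\<ge>M. norm (c m b - c n b) < e" if "e > 0" for e
      proof -
        \<comment> \<open>\<open>C\<close> is only known to be nonnegative, hence the denominator
          \<open>C + 1\<close>.\<close>
        have "e / (C + 1) > 0" using \<open>e > 0\<close> C(1) by simp
        then obtain M where M: "\<And>m n. m \<ge> M \<Longrightarrow> n \<ge> M \<Longrightarrow>
            norm ((\<Sum>b\<in>B. c m b *\<^sub>R b) - (\<Sum>b\<in>B. c n b *\<^sub>R b)) < e / (C + 1)"
          using Cau unfolding Cauchy_iff by meson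
        have "norm (c m b - c n b) < e" if "m \<ge> M" "n \<ge> M" for m n
        proof -
          have "\<bar>c m b - c n b\<bar> \<le> C * norm (\<Sum>b\<in>B. (c m b - c n b) *\<^sub>R b)"
            using C(2)[OF b, of "\<lambda>b. c m b - c n b"] .
          also have "(\<Sum>b\<in>B. (c m b - c n b) *\<^sub>R b) = (\<Sum>b\<in>B. c m b *\<^sub>R b) - (\<Sum>b\<in>B. c n b *\<^sub>R b)"
            by (simp add: scaleR_left_diff_distrib sum_subtractf)
          also have "C * norm \<dots> \<le> C * (e / (C + 1))"
            using M[OF that] C(1) by (intro mult_left_mono) auto
          also have "\<dots> < e" using C(1) \<open>e > 0\<close> by (simp add: field_simps)
          finally show ?thesis by simp
        qed
        then show ?thesis by blast
      qed
      then have "Cauchy (\<lambda>n. c n b)" unfolding Cauchy_iff by blast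
      then show ?thesis by (simp add: Cauchy_convergent_iff)
    qed
    then have "(\<lambda>n. c n b) \<longlonglongrightarrow> lim (\<lambda>n. c n b)" if "b \<in> B" for b
      using that convergent_LIMSEQ_iff by blast
    then have "(\<lambda>n. \<Sum>b\<in>B. c n b *\<^sub>R b) \<longlonglongrightarrow> (\<Sum>b\<in>B. lim (\<lambda>n. c n b) *\<^sub>R b)"
      by (intro tendsto_sum tendsto_scaleR tendsto_const)
    with lim have "a = (\<Sum>b\<in>B. lim (\<lambda>n. c n b) *\<^sub>R b)"
      using LIMSEQ_unique by blast
    also have "\<dots> \<in> span B" by (intro span_sum span_scale span_base)
    finally show False using aB by simp
  qed
  then obtain \<delta> where \<delta>: "\<delta> > 0" "\<And>c. norm (a - (\<Sum>b\<in>B. c b *\<^sub>R b)) \<ge> \<delta>"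
    by blast
  \<comment> \<open>\<open>1 / \<delta>\<close> bounds the coefficient of \<open>a\<close>. The
    other coefficients are those of \<open>x - c a *\<^sub>R a\<close>, whose norm is at most
    \<open>(1 + norm a / \<delta>) * norm x\<close>. The sum dominates both bounds.\<close>
  define K where "K = 1 / \<delta> + C * (1 + norm a / \<delta>)"
  have K: "1 / \<delta> \<le> K" "C * (1 + norm a / \<delta>) \<le> K" "K \<ge> 0"
    using C(1) \<delta>(1) by (auto simp: K_def)
  have "\<bar>c b\<bar> \<le> K * norm (\<Sum>b\<in>insert a B. c b *\<^sub>R b)" if b: "b \<in> insert a B" for c b
  proof -
    define x where "x = (\<Sum>b\<in>insert a B. c b *\<^sub>R b)"
    have x: "x = c a *\<^sub>R a + (\<Sum>b\<in>B. c b *\<^sub>R b)"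
      using insert.hyps by (simp add: x_def)
    have ca: "\<bar>c a\<bar> \<le> norm x / \<delta>"
    proof (cases "c a = 0")
      case False
      \<comment> \<open>Factoring out \<open>c a\<close> leaves \<open>a\<close> minus an element of
        the span of \<open>B\<close>, to which \<open>\<delta>\<close> applies.\<close>
      have "x = c a *\<^sub>R (a - (\<Sum>b\<in>B. (- c b / c a) *\<^sub>R b))"
        using False by (simp add: x scaleR_right_diff_distrib scaleR_right_distrib scaleR_sum_right sum_negf)
      then have "norm x = \<bar>c a\<bar> * norm (a - (\<Sum>b\<in>B. (- c b / c a) *\<^sub>R b))"
        by (metis norm_scaleR)
      also have "\<dots> \<ge> \<bar>c a\<bar> * \<delta>" by (intro mult_left_mono \<delta>(2) abs_ge_zero)
      finally show ?thesis using \<delta>(1) by (simp add: field_simps)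
    qed (use \<delta>(1) in simp)
    show ?thesis
    proof (cases "b = a")
      case True
      have "norm x / \<delta> \<le> K * norm x"
        using K(1) mult_right_mono[of "1 / \<delta>" K "norm x"] by simp
      then show ?thesis using ca True by (simp add: x_def)
    next
      case False
      then have "\<bar>c b\<bar> \<le> C * norm (x - c a *\<^sub>R a)"
        using C(2)[of b c] b by (simp add: x)
      also have "\<dots> \<le> C * (norm x + norm x / \<delta> * norm a)"
      proof (rule mult_left_mono[OF _ C(1)])
        have "norm (x - c a *\<^sub>R a) \<le> norm x + \<bar>c a\<bar> * norm a"
          using norm_triangle_ineq4[of x "c a *\<^sub>R a"] by simp
        also have "\<dots> \<le> norm x + norm x / \<delta> * norm a"
          using ca by (intro add_left_mono mult_right_mono) auto
        finally show "norm (x - c a *\<^sub>R a) \<le> norm x + norm x / \<delta> * norm a" .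
      qed
      also have "\<dots> = C * (1 + norm a / \<delta>) * norm x" by (simp add: algebra_simps)
      also have "\<dots> \<le> K * norm x" using K(2) by (intro mult_right_mono) auto
      finally show ?thesis by (simp add: x_def)
    qed
  qed
  then show ?case using K(3) by blast
qed

text \<open>A finite spanning set is thinned out to a basis, whose coordinate functionals are
  bounded by the preceding estimate.\<close>

lemma fin_dim_coordinates:
  assumes "fin_dim TYPE('a::real_normed_vector)"
  obtains B :: "'a::real_normed_vector set" and \<phi> :: "'a \<Rightarrow> 'a \<Rightarrow> real"
  where "finite B" "\<And>b. b \<in> B \<Longrightarrow> bounded_linear (\<phi> b)" "\<And>x. (\<Sum>b\<in>B. \<phi> b x *\<^sub>R b) = x"
proof -
  obtain B0 :: "'a set" where "finite B0" "span B0 = UNIV"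
    using assms by (auto simp: fin_dim_def)
  moreover obtain B where "B \<subseteq> B0" "independent B" "B0 \<subseteq> span B"
    using maximal_independent_subset[of B0] by metis
  ultimately have B: "finite B" "independent B" "span B = UNIV"
    using finite_subset span_mono[of B0 "span B"] by (auto simp: span_span)
  define \<phi> where "\<phi> b x = representation B x b" for b x
  have sum: "(\<Sum>b\<in>B. \<phi> b x *\<^sub>R b) = x" for x
    using B by (simp add: \<phi>_def sum_representation_eq)
  obtain C where C: "C \<ge> 0" "\<And>c b. b \<in> B \<Longrightarrow> \<bar>c b\<bar> \<le> C * norm (\<Sum>b\<in>B. c b *\<^sub>R b)"
    using independent_coeff_bound[OF B(1,2)] by meson
  have "bounded_linear (\<phi> b)" if "b \<in> B" for b
  proof (rule bounded_linear_intro)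
    show "\<phi> b (x + y) = \<phi> b x + \<phi> b y" for x y
      using B by (simp add: \<phi>_def representation_add)
    show "\<phi> b (r *\<^sub>R x) = r *\<^sub>R \<phi> b x" for r x
      using B by (simp add: \<phi>_def representation_scale)
    show "norm (\<phi> b x) \<le> norm x * C" for x
      using C(2)[OF that, of "\<lambda>b. \<phi> b x"] by (simp add: sum mult.commute)
  qed
  then show ?thesis using B(1) sum that by blast
qed

section \<open>The chain rule\<close>

text \<open>Passes from fixed directions, which are all that \<open>C_k\<close> speaks of, to the
  moving direction \<open>w x\<close>: expanding \<open>w x\<close> in a finite basis gives a finite
  sum of fixed directional derivatives with coefficients that are as smooth as
  \<open>w\<close>.\<close>

lemma C_k_frechet_apply:
  fixes f :: "'a::real_normed_vector \<Rightarrow> 'b::real_normed_vector" and w :: "'c::real_normed_vector \<Rightarrow> 'a"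
  assumes fd: "fin_dim TYPE('a)" and T: "open T"
    and df: "\<And>x. x \<in> T \<Longrightarrow> f differentiable (at (g x))"
    and Df: "\<And>v. C_k k T (\<lambda>x. frechet_derivative f (at (g x)) v)"
    and w: "C_k k T w"
  shows "C_k k T (\<lambda>x. frechet_derivative f (at (g x)) (w x))"
proof -
  obtain B :: "'a set" and \<phi> where B: "finite B" "\<And>b. b \<in> B \<Longrightarrow> bounded_linear (\<phi> b)"
    "\<And>x. (\<Sum>b\<in>B. \<phi> b x *\<^sub>R b) = x"
    using fin_dim_coordinates[OF fd] by metis
  have "C_k k T (\<lambda>x. \<Sum>b\<in>B. \<phi> b (w x) *\<^sub>R frechet_derivative f (at (g x)) b)"
    by (intro C_k_sum C_k_scaleR C_k_bounded_linear[OF B(2)] T w Df)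
  then show ?thesis
  proof (rule C_k_cong[OF T, rotated])
    fix x assume "x \<in> T"
    then have "linear (frechet_derivative f (at (g x)))"
      using df linear_frechet_derivative by blast
    then have "(\<Sum>b\<in>B. \<phi> b (w x) *\<^sub>R frechet_derivative f (at (g x)) b) =
        frechet_derivative f (at (g x)) (\<Sum>b\<in>B. \<phi> b (w x) *\<^sub>R b)"
      by (simp add: linear_sum linear_scale)
    then show "(\<Sum>b\<in>B. \<phi> b (w x) *\<^sub>R frechet_derivative f (at (g x)) b) =
        frechet_derivative f (at (g x)) (w x)"
      by (simp add: B(3))
  qed
qed

text \<open>The derivative of the composite is that of \<open>f\<close> at \<open>g x\<close> in the
  moving direction given by the derivative of \<open>g\<close>. The induction varies
  \<open>f\<close> because its directional derivatives take its place.\<close>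

lemma C_k_compose:
  fixes f :: "'a::real_normed_vector \<Rightarrow> 'b::real_normed_vector" and g :: "'c::real_normed_vector \<Rightarrow> 'a"
  assumes fd: "fin_dim TYPE('a)" and T: "open T" and "g ` T \<subseteq> S" "C_k k T g" "C_k k S f"
  shows "C_k k T (\<lambda>x. f (g x))"
  using assms(3-)
proof (induction k arbitrary: f)
  case 0
  then show ?case by (auto intro: continuous_on_compose2)
next
  case (Suc k)
  show ?case
  proof (rule C_k_SucI[OF T])
    show "((\<lambda>x. f (g x)) has_derivative
        (\<lambda>v. frechet_derivative f (at (g x)) (frechet_derivative g (at x) v))) (at x)" if "x \<in> T" for x
      using has_derivative_compose[OF C_k_SucD[OF Suc.prems(2) that] C_k_SucD[OF Suc.prems(3)]]
        Suc.prems(1) that by blast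
    show "C_k k T (\<lambda>x. frechet_derivative f (at (g x)) (frechet_derivative g (at x) v))" for v
    proof (rule C_k_frechet_apply[OF fd T])
      show "f differentiable at (g x)" if "x \<in> T" for x
        using Suc.prems that by auto
      show "C_k k T (\<lambda>x. frechet_derivative f (at (g x)) v)" for v
        using Suc.IH[of "\<lambda>x. frechet_derivative f (at x) v"] C_k_Suc_imp[OF Suc.prems(2)] Suc.prems
        by auto
      show "C_k k T (\<lambda>x. frechet_derivative g (at x) v)"
        using Suc.prems by simp
    qed
  qed
qed

lemma smooth_on_subset: "smooth_on S f \<Longrightarrow> T \<subseteq> S \<Longrightarrow> smooth_on T f"
  unfolding smooth_on_def using C_k_subset by blast

lemma smooth_on_cong:
  "open S \<Longrightarrow> (\<And>x. x \<in> S \<Longrightarrow> f x = g x) \<Longrightarrow> smooth_on S f \<Longrightarrow> smooth_on S g"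
  unfolding smooth_on_def using C_k_cong[of S f g] by blast

lemma smooth_on_local:
  "(\<And>x. x \<in> S \<Longrightarrow> \<exists>U. open U \<and> x \<in> U \<and> smooth_on U f) \<Longrightarrow> smooth_on S f"
  unfolding smooth_on_def by (intro allI C_k_local) blast

lemma smooth_on_imp_continuous_on: "smooth_on S f \<Longrightarrow> continuous_on S f"
  unfolding smooth_on_def using C_k.simps(1)[of S f] by blast

lemma smooth_on_imp_differentiable: "smooth_on S f \<Longrightarrow> x \<in> S \<Longrightarrow> f differentiable (at x)"
  unfolding smooth_on_def using C_k.simps(2)[of 0 S f] by blast

lemma smooth_on_const: "open S \<Longrightarrow> smooth_on S (\<lambda>x. c)"
  by (simp add: smooth_on_def C_k_const)

lemma smooth_on_id: "open S \<Longrightarrow> smooth_on S (\<lambda>x. x)"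
  by (simp add: smooth_on_def C_k_id)

lemma smooth_on_bounded_linear:
  "bounded_linear L \<Longrightarrow> open S \<Longrightarrow> smooth_on S f \<Longrightarrow> smooth_on S (\<lambda>x. L (f x))"
  by (simp add: smooth_on_def C_k_bounded_linear)

lemma smooth_on_add:
  "open S \<Longrightarrow> smooth_on S f \<Longrightarrow> smooth_on S g \<Longrightarrow> smooth_on S (\<lambda>x. f x + g x)"
  by (simp add: smooth_on_def C_k_add)

lemma smooth_on_sum:
  "open S \<Longrightarrow> (\<And>b. b \<in> B \<Longrightarrow> smooth_on S (f b)) \<Longrightarrow> smooth_on S (\<lambda>x. \<Sum>b\<in>B. f b x)"
  by (simp add: smooth_on_def C_k_sum)

lemma smooth_on_scaleR:
  fixes r :: "'a::real_normed_vector \<Rightarrow> real"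
  shows "open S \<Longrightarrow> smooth_on S r \<Longrightarrow> smooth_on S g \<Longrightarrow> smooth_on S (\<lambda>x. r x *\<^sub>R g x)"
  by (simp add: smooth_on_def C_k_scaleR)

lemma smooth_on_Pair:
  "open S \<Longrightarrow> smooth_on S f \<Longrightarrow> smooth_on S g \<Longrightarrow> smooth_on S (\<lambda>x. (f x, g x))"
  by (simp add: smooth_on_def C_k_Pair)

lemma smooth_on_compose:
  fixes g :: "'c::real_normed_vector \<Rightarrow> 'a::real_normed_vector"
  shows "fin_dim TYPE('a) \<Longrightarrow> open T \<Longrightarrow> g ` T \<subseteq> S \<Longrightarrow> smooth_on T g \<Longrightarrow> smooth_on S f \<Longrightarrow>
    smooth_on T (\<lambda>x. f (g x))"
  unfolding smooth_on_def using C_k_compose[of T g S _ f] by blast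

lemma smooth_on_frechet:
  "smooth_on S f \<Longrightarrow> smooth_on S (\<lambda>x. frechet_derivative f (at x) v)"
  unfolding smooth_on_def using C_k.simps(2)[of _ S f] by blast

text \<open>Evaluates a smooth field of vectors \<open>w x\<close>, attached at \<open>g x\<close>,
  on a smooth function; tangent vectors act in this way in coordinates.\<close>

lemma smooth_on_frechet_apply:
  fixes f :: "'a::real_normed_vector \<Rightarrow> 'b::real_normed_vector" and w :: "'c::real_normed_vector \<Rightarrow> 'a"
  assumes fd: "fin_dim TYPE('a)" and T: "open T" and gT: "g ` T \<subseteq> S"
    and g: "smooth_on T g" and w: "smooth_on T w" and f: "smooth_on S f"
  shows "smooth_on T (\<lambda>x. frechet_derivative f (at (g x)) (w x))"
  unfolding smooth_on_def
proof
  fix k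
  show "C_k k T (\<lambda>x. frechet_derivative f (at (g x)) (w x))"
  proof (rule C_k_frechet_apply[OF fd T])
    show "f differentiable at (g x)" if "x \<in> T" for x
      by (rule smooth_on_imp_differentiable[OF f]) (use gT that in blast)
    show "C_k k T (\<lambda>x. frechet_derivative f (at (g x)) v)" for v
      using smooth_on_compose[OF fd T gT g smooth_on_frechet[OF f]] unfolding smooth_on_def by (rule spec)
    show "C_k k T w" using w unfolding smooth_on_def by (rule spec)
  qed
qed


section \<open>Local smoothness in charts\<close>

text \<open>
  Working with a smooth coordinate expression \<open>\<phi>\<close> that is only related to \<open>f\<close>, instead of
  \<open>snd d \<circ> f \<circ> chart_inv c\<close>, makes composition and restriction immediate.
\<close>

definition loc_smooth ::
  "('p, 'a::real_normed_vector) chart \<Rightarrow> ('q, 'b::real_normed_vector) chart \<Rightarrow> ('p \<Rightarrow> 'q) \<Rightarrow> 'p \<Rightarrow> bool"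
  where "loc_smooth c d f p \<longleftrightarrow> p \<in> fst c \<and>
    (\<exists>V \<phi>. open V \<and> snd c p \<in> V \<and> smooth_on V \<phi> \<and>
       (\<forall>q\<in>fst c. snd c q \<in> V \<longrightarrow> f q \<in> fst d \<and> \<phi> (snd c q) = snd d (f q)))"

text \<open>The single chart of \<open>model_manifold\<close>. Taking it as target lets
  vector-valued maps share the notion \<open>loc_smooth\<close>.\<close>

definition vec_chart :: "('a, 'a) chart"
  where "vec_chart = (UNIV, id)"

lemma loc_smoothI:
  assumes "p \<in> fst c" "open V" "snd c p \<in> V" "smooth_on V \<phi>"
    "\<And>q. q \<in> fst c \<Longrightarrow> snd c q \<in> V \<Longrightarrow> f q \<in> fst d \<and> \<phi> (snd c q) = snd d (f q)"
  shows "loc_smooth c d f p"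
  using assms unfolding loc_smooth_def by blast

lemma loc_smoothE:
  assumes "loc_smooth c d f p"
  obtains V \<phi> where "p \<in> fst c" "open V" "snd c p \<in> V" "smooth_on V \<phi>"
    "\<And>q. q \<in> fst c \<Longrightarrow> snd c q \<in> V \<Longrightarrow> f q \<in> fst d \<and> \<phi> (snd c q) = snd d (f q)"
  using assms unfolding loc_smooth_def by blast

lemma loc_smooth_compose:
  fixes d :: "('q, 'b::real_normed_vector) chart"
  assumes "fin_dim TYPE('b)" and f: "loc_smooth c d f p" and g: "loc_smooth d e g (f p)"
  shows "loc_smooth c e (\<lambda>x. g (f x)) p"
proof -
  obtain V \<phi> where V: "p \<in> fst c" "open V" "snd c p \<in> V" "smooth_on V \<phi>"
    "\<And>q. q \<in> fst c \<Longrightarrow> snd c q \<in> V \<Longrightarrow> f q \<in> fst d \<and> \<phi> (snd c q) = snd d (f q)"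
    using f by (rule loc_smoothE) blast
  obtain U \<psi> where U: "open U" "snd d (f p) \<in> U" "smooth_on U \<psi>"
    "\<And>q. q \<in> fst d \<Longrightarrow> snd d q \<in> U \<Longrightarrow> g q \<in> fst e \<and> \<psi> (snd d q) = snd e (g q)"
    using g by (rule loc_smoothE) blast
  let ?T = "V \<inter> \<phi> -` U"
  have T: "open ?T"
    using continuous_open_preimage[OF smooth_on_imp_continuous_on[OF V(4)] V(2) U(1)] .
  show ?thesis
  proof (rule loc_smoothI[OF V(1) T, where \<phi> = "\<lambda>x. \<psi> (\<phi> x)"])
    show "snd c p \<in> ?T" using V U by auto
    show "smooth_on ?T (\<lambda>x. \<psi> (\<phi> x))"
      by (rule smooth_on_compose[OF assms(1) T, where S = U])
        (use V U in \<open>auto intro: smooth_on_subset\<close>)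
    show "g (f q) \<in> fst e \<and> \<psi> (\<phi> (snd c q)) = snd e (g (f q))"
      if "q \<in> fst c" "snd c q \<in> ?T" for q
      using that V(5)[of q] U(4)[of "f q"] by auto
  qed
qed

lemma loc_smooth_cong:
  assumes f: "loc_smooth c d f p" and "open U" "snd c p \<in> U"
    and eq: "\<And>q. q \<in> fst c \<Longrightarrow> snd c q \<in> U \<Longrightarrow> f q = g q"
  shows "loc_smooth c d g p"
proof -
  obtain V \<phi> where V: "p \<in> fst c" "open V" "snd c p \<in> V" "smooth_on V \<phi>"
    "\<And>q. q \<in> fst c \<Longrightarrow> snd c q \<in> V \<Longrightarrow> f q \<in> fst d \<and> \<phi> (snd c q) = snd d (f q)"
    using f by (rule loc_smoothE) blast
  show ?thesis
  proof (rule loc_smoothI[where V = "V \<inter> U" and \<phi> = \<phi>])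
    show "g q \<in> fst d \<and> \<phi> (snd c q) = snd d (g q)" if "q \<in> fst c" "snd c q \<in> V \<inter> U" for q
      using V(5)[of q] eq[of q] that by auto
  qed (use V assms(2,3) in \<open>auto intro: smooth_on_subset\<close>)
qed

lemma loc_smooth_target_mono:
  "loc_smooth c (D, k) f p \<Longrightarrow> D \<subseteq> D' \<Longrightarrow> loc_smooth c (D', k) f p"
  unfolding loc_smooth_def fst_conv snd_conv by blast

text \<open>Charts of an open submanifold are charts cut down to \<open>W\<close>. Shrinking the
  coordinate neighbourhood to the image of \<open>U\<close> keeps the values of \<open>f\<close> in
  \<open>W\<close>.\<close>

lemma loc_smooth_restrict_target:
  assumes f: "loc_smooth c d f p" and "open (snd c ` (fst c \<inter> U))" "inj_on (snd c) (fst c)" "p \<in> U"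
    and "\<And>q. q \<in> fst c \<inter> U \<Longrightarrow> f q \<in> W"
  shows "loc_smooth c (fst d \<inter> W, snd d) f p"
proof -
  obtain V \<phi> where V: "p \<in> fst c" "open V" "snd c p \<in> V" "smooth_on V \<phi>"
    "\<And>q. q \<in> fst c \<Longrightarrow> snd c q \<in> V \<Longrightarrow> f q \<in> fst d \<and> \<phi> (snd c q) = snd d (f q)"
    using f by (rule loc_smoothE) blast
  show ?thesis
  proof (rule loc_smoothI[where V = "V \<inter> snd c ` (fst c \<inter> U)" and \<phi> = \<phi>])
    fix q assume q: "q \<in> fst c" "snd c q \<in> V \<inter> snd c ` (fst c \<inter> U)"
    then have "q \<in> U" using assms(3) by (auto dest: inj_onD)
    then show "f q \<in> fst (fst d \<inter> W, snd d) \<and> \<phi> (snd c q) = snd (fst d \<inter> W, snd d) (f q)"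
      using V(5)[of q] q assms(5)[of q] by auto
  qed (use V assms in \<open>auto intro: smooth_on_subset\<close>)
qed

lemma loc_smooth_const:
  "p \<in> fst c \<Longrightarrow> a \<in> fst d \<Longrightarrow> loc_smooth c d (\<lambda>_. a) p"
  by (rule loc_smoothI[where V = UNIV and \<phi> = "\<lambda>_. snd d a"]) (auto intro: smooth_on_const)

lemma loc_smooth_chart: "p \<in> fst c \<Longrightarrow> loc_smooth c vec_chart (snd c) p"
  by (rule loc_smoothI[where V = UNIV and \<phi> = "\<lambda>x. x"])
    (auto intro: smooth_on_id simp: vec_chart_def)

lemma loc_smooth_vecE:
  assumes "loc_smooth c vec_chart f p"
  obtains V \<phi> where "p \<in> fst c" "open V" "snd c p \<in> V" "smooth_on V \<phi>"
    "\<And>q. q \<in> fst c \<Longrightarrow> snd c q \<in> V \<Longrightarrow> \<phi> (snd c q) = f q"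
  using assms by (auto simp: vec_chart_def elim: loc_smoothE)

lemma loc_smooth_vecI:
  assumes "p \<in> fst c" "open V" "snd c p \<in> V" "smooth_on V \<phi>"
    "\<And>q. q \<in> fst c \<Longrightarrow> snd c q \<in> V \<Longrightarrow> \<phi> (snd c q) = f q"
  shows "loc_smooth c vec_chart f p"
  by (rule loc_smoothI[OF assms(1-4)]) (use assms(5) in \<open>auto simp: vec_chart_def\<close>)

lemma loc_smooth_smooth_on:
  fixes f :: "'p \<Rightarrow> 'b::real_normed_vector"
  assumes "fin_dim TYPE('b)" "loc_smooth c vec_chart f p" "smooth_on S g" "open S" "f p \<in> S"
  shows "loc_smooth c vec_chart (\<lambda>x. g (f x)) p"
  by (rule loc_smooth_compose[OF assms(1,2)])
    (rule loc_smooth_vecI[where V = S and \<phi> = g], use assms(3-) in \<open>auto simp: vec_chart_def\<close>)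

lemma loc_smooth_add:
  assumes "loc_smooth c vec_chart f p" "loc_smooth c vec_chart g p"
  shows "loc_smooth c vec_chart (\<lambda>x. f x + g x) p"
proof -
  obtain V \<phi> where V: "p \<in> fst c" "open V" "snd c p \<in> V" "smooth_on V \<phi>"
    "\<And>q. q \<in> fst c \<Longrightarrow> snd c q \<in> V \<Longrightarrow> \<phi> (snd c q) = f q"
    using assms(1) by (rule loc_smooth_vecE) blast
  obtain U \<psi> where U: "open U" "snd c p \<in> U" "smooth_on U \<psi>"
    "\<And>q. q \<in> fst c \<Longrightarrow> snd c q \<in> U \<Longrightarrow> \<psi> (snd c q) = g q"
    using assms(2) by (rule loc_smooth_vecE) blast
  show ?thesis
    by (rule loc_smooth_vecI[where V = "V \<inter> U" and \<phi> = "\<lambda>x. \<phi> x + \<psi> x"])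
      (use V U in \<open>auto intro!: smooth_on_add intro: smooth_on_subset\<close>)
qed

lemma loc_smooth_scaleR:
  fixes r :: "'p \<Rightarrow> real"
  assumes "loc_smooth c vec_chart r p" "loc_smooth c vec_chart g p"
  shows "loc_smooth c vec_chart (\<lambda>x. r x *\<^sub>R g x) p"
proof -
  obtain V \<phi> where V: "p \<in> fst c" "open V" "snd c p \<in> V" "smooth_on V \<phi>"
    "\<And>q. q \<in> fst c \<Longrightarrow> snd c q \<in> V \<Longrightarrow> \<phi> (snd c q) = r q"
    using assms(1) by (rule loc_smooth_vecE) blast
  obtain U \<psi> where U: "open U" "snd c p \<in> U" "smooth_on U \<psi>"
    "\<And>q. q \<in> fst c \<Longrightarrow> snd c q \<in> U \<Longrightarrow> \<psi> (snd c q) = g q"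
    using assms(2) by (rule loc_smooth_vecE) blast
  show ?thesis
    by (rule loc_smooth_vecI[where V = "V \<inter> U" and \<phi> = "\<lambda>x. \<phi> x *\<^sub>R \<psi> x"])
      (use V U in \<open>auto intro!: smooth_on_scaleR intro: smooth_on_subset\<close>)
qed


section \<open>Smooth maps and charts\<close>

lemma smooth_atlas_chart:
  assumes "smooth_atlas X" "c \<in> charts X"
  shows "fst c \<subseteq> pts X" "inj_on (snd c) (fst c)" "open (snd c ` fst c)"
  using assms by (auto simp: smooth_atlas_def)

lemma smooth_atlas_cover:
  assumes "smooth_atlas X" "p \<in> pts X"
  obtains c where "c \<in> charts X" "p \<in> fst c"
  using assms unfolding smooth_atlas_def by blast

lemma loc_smooth_coord_map:
  assumes "inj_on (snd c) (fst c)" "open (snd c ` (fst c \<inter> f -` fst d))"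
    "smooth_on (snd c ` (fst c \<inter> f -` fst d)) (snd d \<circ> f \<circ> chart_inv c)" "p \<in> fst c" "f p \<in> fst d"
  shows "loc_smooth c d f p"
proof (rule loc_smoothI[OF assms(4,2) _ assms(3)])
  show "snd c p \<in> snd c ` (fst c \<inter> f -` fst d)" using assms by auto
  fix q assume q: "q \<in> fst c" "snd c q \<in> snd c ` (fst c \<inter> f -` fst d)"
  then have "q \<in> f -` fst d" using assms(1) by (auto dest: inj_onD)
  then show "f q \<in> fst d \<and> (snd d \<circ> f \<circ> chart_inv c) (snd c q) = snd d (f q)"
    using q assms(1) by (simp add: chart_inv_def)
qed

lemma smooth_map_imp_loc_smooth:
  assumes "smooth_map X Y f" "c \<in> charts X" "d \<in> charts Y" "inj_on (snd c) (fst c)"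
    "p \<in> fst c" "f p \<in> fst d"
  shows "loc_smooth c d f p"
  using assms by (intro loc_smooth_coord_map) (auto simp: smooth_map_def)

text \<open>The openness clause of \<open>smooth_map\<close> comes with local smoothness, because
  \<open>loc_smooth\<close> demands that all points in a coordinate neighbourhood are mapped into
  \<open>fst d\<close>.\<close>

lemma smooth_mapI:
  assumes "f ` pts X \<subseteq> pts Y" "\<And>c. c \<in> charts X \<Longrightarrow> open (snd c ` fst c)"
    "\<And>c d p. c \<in> charts X \<Longrightarrow> d \<in> charts Y \<Longrightarrow> p \<in> fst c \<Longrightarrow> f p \<in> fst d \<Longrightarrow> loc_smooth c d f p"
  shows "smooth_map X Y f"
  unfolding smooth_map_def
proof (intro conjI ballI assms(1))
  fix c d assume c: "c \<in> charts X" and d: "d \<in> charts Y"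
  let ?T = "snd c ` (fst c \<inter> f -` fst d)"
  have "\<exists>U. open U \<and> x \<in> U \<and> U \<subseteq> ?T \<and> smooth_on U (snd d \<circ> f \<circ> chart_inv c)" if x: "x \<in> ?T" for x
  proof -
    obtain p where p: "p \<in> fst c" "f p \<in> fst d" "x = snd c p" using x by auto
    obtain V \<phi> where V: "open V" "snd c p \<in> V" "smooth_on V \<phi>"
      "\<And>q. q \<in> fst c \<Longrightarrow> snd c q \<in> V \<Longrightarrow> f q \<in> fst d \<and> \<phi> (snd c q) = snd d (f q)"
      using assms(3)[OF c d p(1,2)] by (rule loc_smoothE) blast
    let ?U = "V \<inter> snd c ` fst c"
    have U: "open ?U" using V(1) assms(2)[OF c] by auto
    have "smooth_on ?U (snd d \<circ> f \<circ> chart_inv c)"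
    proof (rule smooth_on_cong[OF U])
      fix a assume a: "a \<in> ?U"
      have "chart_inv c a \<in> fst c" "snd c (chart_inv c a) = a"
        using a by (auto simp: chart_inv_def intro: inv_into_into f_inv_into_f)
      then show "\<phi> a = (snd d \<circ> f \<circ> chart_inv c) a"
        using V(4)[of "chart_inv c a"] a by simp
    qed (use V(3) in \<open>auto intro: smooth_on_subset\<close>)
    moreover have "?U \<subseteq> ?T" using V(4) by auto
    ultimately show ?thesis using U p V(2) by blast
  qed
  then show "open ?T" "smooth_on ?T (snd d \<circ> f \<circ> chart_inv c)"
    by (auto intro!: smooth_on_local simp: open_subopen[of ?T])
qed

lemma loc_smooth_transition:
  assumes "smooth_atlas X" "c \<in> charts X" "d \<in> charts X" "p \<in> fst c" "p \<in> fst d"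
  shows "loc_smooth c d (\<lambda>x. x) p"
proof -
  have eq: "snd d \<circ> (\<lambda>x. x) \<circ> chart_inv c = snd d \<circ> chart_inv c"
    "(\<lambda>x. x) -` fst d = fst d" by auto
  show ?thesis
    by (rule loc_smooth_coord_map) (use assms in \<open>simp_all only: eq smooth_atlas_def\<close>)
qed

text \<open>Composition with the transition maps on both sides moves local smoothness to any other
  pair of charts around the point and its image.\<close>

lemma loc_smooth_change:
  fixes X :: "('p, 'a::real_normed_vector) manifold" and Y :: "('q, 'b::real_normed_vector) manifold"
  assumes X: "fin_dim TYPE('a)" "smooth_atlas X" "c \<in> charts X" "c' \<in> charts X" "p \<in> fst c'"
    and Y: "fin_dim TYPE('b)" "smooth_atlas Y" "d \<in> charts Y" "d' \<in> charts Y" "f p \<in> fst d'"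
    and f: "loc_smooth c d f p"
  shows "loc_smooth c' d' f p"
proof -
  have "p \<in> fst c" "f p \<in> fst d" using f by (auto elim: loc_smoothE)
  then have "loc_smooth c' c (\<lambda>x. x) p" "loc_smooth d d' (\<lambda>x. x) (f p)"
    using assms by (auto intro: loc_smooth_transition)
  then show ?thesis
    using loc_smooth_compose[where f = "\<lambda>x. x" and c = c' and d = c and e = d' and g = f and p = p, OF X(1)]
      loc_smooth_compose[where f = f and c = c and d = d and e = d' and g = "\<lambda>x. x" and p = p, OF Y(1) f]
    by simp
qed

lemma smooth_mapI_ex:
  fixes X :: "('p, 'a::real_normed_vector) manifold" and Y :: "('q, 'b::real_normed_vector) manifold"
  assumes X: "fin_dim TYPE('a)" "smooth_atlas X" and Y: "fin_dim TYPE('b)" "smooth_atlas Y"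
    and "f ` pts X \<subseteq> pts Y"
    "\<And>p. p \<in> pts X \<Longrightarrow> \<exists>c\<in>charts X. \<exists>d\<in>charts Y. loc_smooth c d f p"
  shows "smooth_map X Y f"
proof (rule smooth_mapI[OF assms(5)])
  fix c d p assume *: "c \<in> charts X" "d \<in> charts Y" "p \<in> fst c" "f p \<in> fst d"
  then have "p \<in> pts X" using smooth_atlas_chart(1)[OF X(2)] by blast
  then obtain c' d' where "c' \<in> charts X" "d' \<in> charts Y" "loc_smooth c' d' f p"
    using assms(6) by blast
  then show "loc_smooth c d f p"
    using loc_smooth_change[where X = X and Y = Y] X Y * by blast
qed (rule smooth_atlas_chart[OF X(2)])

lemma charts_model: "charts model_manifold = {vec_chart}"
  by (simp add: model_manifold_def vec_chart_def)

lemma smooth_manifoldD: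
  assumes "smooth_manifold (X :: ('p, 'a::real_normed_vector) manifold)"
  shows "fin_dim TYPE('a)" "smooth_atlas X" "Hausdorff_space (manifold_topology X)"
  using assms by (auto simp: smooth_manifold_def)

lemma smooth_funs_iff:
  assumes "smooth_atlas X"
  shows "f \<in> smooth_funs X \<longleftrightarrow> f \<in> extensional (pts X) \<and>
    (\<forall>c\<in>charts X. \<forall>p\<in>fst c. loc_smooth c vec_chart f p)" (is "?L \<longleftrightarrow> ?R")
proof
  assume f: ?L
  show ?R
  proof (intro conjI ballI)
    fix c p assume *: "c \<in> charts X" "p \<in> fst c"
    show "loc_smooth c vec_chart f p"
      by (rule smooth_map_imp_loc_smooth[where X = X and Y = model_manifold])
        (use f * smooth_atlas_chart[OF assms *(1)] in
          \<open>auto simp: smooth_funs_def charts_model vec_chart_def\<close>)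
  qed (use f in \<open>auto simp: smooth_funs_def\<close>)
next
  assume ?R
  then show ?L
    using smooth_atlas_chart[OF assms]
    by (auto simp: smooth_funs_def charts_model model_manifold_def intro!: smooth_mapI)
      (auto simp: vec_chart_def)
qed

text \<open>\<open>loc_smooth\<close> looks at points of the chart domain only, and these lie in
  \<open>pts X\<close>; so the extensional convention does not interfere with smoothness.\<close>

lemma loc_smooth_restrict:
  assumes "smooth_atlas X" "c \<in> charts X"
  shows "loc_smooth c d (restrict f (pts X)) p \<longleftrightarrow> loc_smooth c d f p"
proof -
  have "q \<in> pts X" if "q \<in> fst c" for q using that smooth_atlas_chart(1)[OF assms] by auto
  then show ?thesis unfolding loc_smooth_def by auto
qed

lemma smooth_funs_add:
  assumes "smooth_atlas X" "f \<in> smooth_funs X" "g \<in> smooth_funs X"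
  shows "(\<lambda>x\<in>pts X. f x + g x) \<in> smooth_funs X"
  using assms by (auto simp: smooth_funs_iff loc_smooth_restrict intro: loc_smooth_add)

lemma smooth_funs_mult:
  assumes "smooth_atlas X" "f \<in> smooth_funs X" "g \<in> smooth_funs X"
  shows "(\<lambda>x\<in>pts X. f x * g x) \<in> smooth_funs X"
  unfolding smooth_funs_iff[OF assms(1)]
proof (intro conjI ballI)
  fix c p assume c: "c \<in> charts X" "p \<in> fst c"
  then have "loc_smooth c vec_chart (\<lambda>x. f x *\<^sub>R g x) p"
    using assms by (intro loc_smooth_scaleR) (simp_all add: smooth_funs_iff)
  then show "loc_smooth c vec_chart (\<lambda>x\<in>pts X. f x * g x) p"
    by (simp add: loc_smooth_restrict[OF assms(1) c(1)])
qed simp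

lemma smooth_funs_const:
  assumes "smooth_atlas X"
  shows "(\<lambda>x\<in>pts X. r) \<in> smooth_funs X"
  using assms by (auto simp: smooth_funs_iff loc_smooth_restrict intro!: loc_smooth_const)
    (auto simp: vec_chart_def)

lemma smooth_map_loc_compose:
  fixes Y :: "('q, 'b::real_normed_vector) manifold"
  assumes Y: "fin_dim TYPE('b)" "smooth_atlas Y" and g: "smooth_map Y Z g"
    and f: "loc_smooth c d f p" and d: "d \<in> charts Y" and e: "e \<in> charts Z" "g (f p) \<in> fst e"
  shows "loc_smooth c e (\<lambda>x. g (f x)) p"
proof (rule loc_smooth_compose[OF Y(1) f], rule smooth_map_imp_loc_smooth[OF g d e(1)])
  show "f p \<in> fst d" using f by (auto elim: loc_smoothE)
qed (use smooth_atlas_chart[OF Y(2) d] e in auto)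

lemma smooth_funs_compose:
  fixes X :: "('p, 'a::real_normed_vector) manifold" and Y :: "('q, 'b::real_normed_vector) manifold"
  assumes X: "smooth_atlas X" and Y: "fin_dim TYPE('b)" "smooth_atlas Y"
    and h: "smooth_map X Y h" and f: "f \<in> smooth_funs Y"
  shows "(\<lambda>x\<in>pts X. f (h x)) \<in> smooth_funs X"
  unfolding smooth_funs_iff[OF X]
proof (intro conjI ballI)
  fix c p assume c: "c \<in> charts X" and p: "p \<in> fst c"
  then have "h p \<in> pts Y" using h smooth_atlas_chart(1)[OF X c] by (auto simp: smooth_map_def)
  then obtain d where d: "d \<in> charts Y" "h p \<in> fst d" using smooth_atlas_cover[OF Y(2)] by blast
  have "loc_smooth c d h p"
    using smooth_map_imp_loc_smooth[OF h c d(1) smooth_atlas_chart(2)[OF X c] p d(2)] .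
  moreover have "loc_smooth d vec_chart f (h p)"
    using f d by (auto simp: smooth_funs_iff[OF Y(2)])
  ultimately show "loc_smooth c vec_chart (\<lambda>x\<in>pts X. f (h x)) p"
    unfolding loc_smooth_restrict[OF X c] by (rule loc_smooth_compose[OF Y(1)])
qed auto


section \<open>Sections in local trivialisations\<close>

lemma vector_bundleD:
  assumes "vector_bundle (E :: ('e, 't::real_normed_vector, 'p, 'a::real_normed_vector, 'k::real_normed_vector) vbundle)"
  shows "fin_dim TYPE('t)" "smooth_atlas (vb_total E)" "fin_dim TYPE('a)" "smooth_atlas (vb_base E)"
    "fin_dim TYPE('k)"
    "x \<in> pts (vb_base E) \<Longrightarrow> vb_zero E x \<in> fibre E x"
    "x \<in> pts (vb_base E) \<Longrightarrow> a \<in> fibre E x \<Longrightarrow> b \<in> fibre E x \<Longrightarrow> vb_add E a b \<in> fibre E x"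
    "x \<in> pts (vb_base E) \<Longrightarrow> a \<in> fibre E x \<Longrightarrow> vb_scale E r a \<in> fibre E x"
    "(W, \<Phi>) \<in> vb_trivs E \<Longrightarrow> local_trivialisation E W \<Phi>"
  using assms by (auto simp: vector_bundle_def smooth_manifold_def)

lemma vector_bundle_triv:
  assumes "vector_bundle E" "x \<in> pts (vb_base E)"
  obtains W \<Phi> where "(W, \<Phi>) \<in> vb_trivs E" "x \<in> W"
  using assms unfolding vector_bundle_def by blast

lemma local_trivialisation_open:
  assumes "smooth_atlas (vb_base E)" "local_trivialisation E W \<Phi>"
  shows "W \<subseteq> pts (vb_base E)" "c \<in> charts (vb_base E) \<Longrightarrow> open (snd c ` (fst c \<inter> W))"
  using assms openin_manifold_topology[OF assms(1), of W]
  by (auto simp: local_trivialisation_def)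

lemma local_trivialisation_linear:
  assumes "local_trivialisation E W \<Phi>" "x \<in> W"
  shows "\<Phi> (vb_zero E x) = 0"
    "a \<in> fibre E x \<Longrightarrow> b \<in> fibre E x \<Longrightarrow> \<Phi> (vb_add E a b) = \<Phi> a + \<Phi> b"
    "a \<in> fibre E x \<Longrightarrow> \<Phi> (vb_scale E r a) = r *\<^sub>R \<Phi> a"
  using assms by (auto simp: local_trivialisation_def)

text \<open>The diffeomorphism has \<open>vb_proj E\<close> as first component, hence it matches the
  points over \<open>x\<close> with the pairs over \<open>x\<close>.\<close>

lemma local_trivialisation_bij:
  assumes "smooth_atlas (vb_base E)" "local_trivialisation E W \<Phi>" "x \<in> W"
  shows "bij_betw \<Phi> (fibre E x) UNIV"
proof -
  have bij: "bij_betw (\<lambda>e. (vb_proj E e, \<Phi> e)) (pts (vb_total E) \<inter> vb_proj E -` W) (W \<times> UNIV)"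
    using assms(2) local_trivialisation_open(1)[OF assms(1,2)]
    by (simp add: local_trivialisation_def diffeomorphism_def open_submanifold_def
        product_manifold_def model_manifold_def Int_absorb1)
  have "inj_on \<Phi> (fibre E x)"
    using bij assms(3) by (auto simp: bij_betw_def inj_on_def fibre_def)
  moreover have "k \<in> \<Phi> ` fibre E x" for k
  proof -
    have "(x, k) \<in> (\<lambda>e. (vb_proj E e, \<Phi> e)) ` (pts (vb_total E) \<inter> vb_proj E -` W)"
      using bij assms(3) by (simp add: bij_betw_def)
    then show ?thesis by (auto simp: fibre_def)
  qed
  ultimately show ?thesis by (auto simp: bij_betw_def)
qed

lemma section_fibre:
  assumes "u \<in> sections E" "x \<in> pts (vb_base E)"
  shows "u x \<in> fibre E x"
  using assms by (auto simp: sections_def smooth_map_def fibre_def)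

lemma fin_dim_prod:
  assumes "fin_dim TYPE('a::real_normed_vector)" "fin_dim TYPE('b::real_normed_vector)"
  shows "fin_dim TYPE('a \<times> 'b)"
proof -
  obtain B :: "'a set" and C :: "'b set" where BC: "finite B" "span B = UNIV" "finite C" "span C = UNIV"
    using assms by (auto simp: fin_dim_def)
  let ?D = "(\<lambda>x. (x, 0)) ` B \<union> (\<lambda>y. (0, y)) ` C"
  have "(x, 0) \<in> span ?D" for x :: 'a
  proof -
    have "span B \<subseteq> (\<lambda>x. (x, 0)) -` span ?D"
      by (rule span_minimal) (auto intro: span_base linear_subspace_vimage simp: linear_iff)
    then show ?thesis using BC by auto
  qed
  moreover have "(0, y) \<in> span ?D" for y :: 'b
  proof -
    have "span C \<subseteq> (\<lambda>y. (0, y)) -` span ?D"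
      by (rule span_minimal) (auto intro: span_base linear_subspace_vimage simp: linear_iff)
    then show ?thesis using BC by auto
  qed
  ultimately have "(x, 0) + (0, y) \<in> span ?D" for x y
    by (intro span_add)
  then have "span ?D = UNIV" by auto
  then show ?thesis using BC by (auto simp: fin_dim_def intro!: exI[of _ ?D])
qed

lemma product_chart:
  assumes "c \<in> charts X"
  shows "((fst c \<inter> W) \<times> UNIV, map_prod (snd c) id) \<in>
    charts (product_manifold (open_submanifold X W) model_manifold)"
proof -
  have "(fst c \<inter> W, snd c) \<in> charts (open_submanifold X W)" "(UNIV, id) \<in> charts model_manifold"
    using assms by (simp_all add: open_submanifold_def model_manifold_def)
  then show ?thesis
    unfolding product_manifold_def manifold.simps mem_Collect_eq
    by (intro exI[of _ "(fst c \<inter> W, snd c)"] exI[of _ "(UNIV, id)"]) simp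
qed

text \<open>\<open>\<Phi> \<circ> u\<close> factors through the total space and
  \<open>W \<times> 'k\<close>: section, trivialisation, second projection. The charts are cut down
  to \<open>W\<close> to match those of the open submanifolds.\<close>

lemma section_loc_smooth:
  fixes E :: "('e, 't::real_normed_vector, 'p, 'a::real_normed_vector, 'k::real_normed_vector) vbundle"
  assumes E: "vector_bundle E" and u: "u \<in> sections E" and W: "(W, \<Phi>) \<in> vb_trivs E" "p \<in> W"
    and d: "d \<in> charts (vb_base E)" "p \<in> fst d"
  shows "loc_smooth d vec_chart (\<lambda>x. \<Phi> (u x)) p"
proof -
  note E' = vector_bundleD[OF E]
  have triv: "local_trivialisation E W \<Phi>" using E'(9)[OF W(1)] .
  note Wop = local_trivialisation_open[OF E'(4) triv]
  note dc = smooth_atlas_chart[OF E'(4) d(1)]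
  have up: "u p \<in> fibre E p" using section_fibre[OF u] W(2) Wop by auto
  then obtain c where c: "c \<in> charts (vb_total E)" "u p \<in> fst c"
    using smooth_atlas_cover[OF E'(2)] by (auto simp: fibre_def)
  note cc = smooth_atlas_chart[OF E'(2) c(1)]
  let ?cW = "(fst c \<inter> vb_proj E -` W, snd c)" and ?dW = "(fst d \<inter> W) \<times> (UNIV :: 'k set)"
  let ?dk = "(?dW, map_prod (snd d) id)"
  let ?\<tau> = "\<lambda>e. (vb_proj E e, \<Phi> e)"
  have "loc_smooth d c u p"
    by (rule smooth_map_imp_loc_smooth[where X = "vb_base E" and Y = "vb_total E"])
      (use u d dc c in \<open>auto simp: sections_def\<close>)
  then have 1: "loc_smooth d ?cW u p"
  proof (rule loc_smooth_restrict_target[where U = W])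
    show "u q \<in> vb_proj E -` W" if "q \<in> fst d \<inter> W" for q
      using section_fibre[OF u, of q] that dc by (auto simp: fibre_def)
  qed (use Wop(2)[OF d(1)] dc W in auto)
  have 2: "loc_smooth ?cW ?dk ?\<tau> (u p)"
  proof (rule smooth_map_imp_loc_smooth)
    show "smooth_map (open_submanifold (vb_total E) (vb_proj E -` W))
      (product_manifold (open_submanifold (vb_base E) W) model_manifold) ?\<tau>"
      using triv by (simp add: local_trivialisation_def diffeomorphism_def)
    show "?cW \<in> charts (open_submanifold (vb_total E) (vb_proj E -` W))"
      using c by (simp add: open_submanifold_def)
    show "?dk \<in> charts (product_manifold (open_submanifold (vb_base E) W) model_manifold)"
      by (rule product_chart[OF d(1)])
    show "inj_on (snd ?cW) (fst ?cW)" using inj_on_subset[OF cc(2)] by simp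
  qed (use c up d W in \<open>simp_all add: fibre_def\<close>)
  have 3: "loc_smooth ?dk vec_chart snd (?\<tau> (u p))"
  proof (rule loc_smooth_vecI[where V = UNIV and \<phi> = snd])
    show "smooth_on UNIV snd"
      using smooth_on_bounded_linear[OF bounded_linear_snd open_UNIV smooth_on_id[OF open_UNIV]] .
  qed (use up d W in \<open>auto simp: fibre_def\<close>)
  show ?thesis
    using loc_smooth_compose[OF fin_dim_prod[OF E'(3,5)] loc_smooth_compose[OF E'(1) 1 2] 3] by simp
qed

text \<open>The same factorisation read backwards: \<open>u x\<close> is the image of
  \<open>(x, \<Phi> (u x))\<close> under the inverse trivialisation, which is smooth.\<close>

lemma sectionI:
  fixes E :: "('e, 't::real_normed_vector, 'p, 'a::real_normed_vector, 'k::real_normed_vector) vbundle"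
  assumes E: "vector_bundle E" and u: "u \<in> extensional (pts (vb_base E))"
    "\<And>x. x \<in> pts (vb_base E) \<Longrightarrow> u x \<in> fibre E x"
    and loc: "\<And>p. p \<in> pts (vb_base E) \<Longrightarrow> \<exists>W \<Phi> d. (W, \<Phi>) \<in> vb_trivs E \<and> d \<in> charts (vb_base E) \<and>
      p \<in> W \<and> loc_smooth d vec_chart (\<lambda>x. \<Phi> (u x)) p"
  shows "u \<in> sections E"
proof -
  note E' = vector_bundleD[OF E]
  have "smooth_map (vb_base E) (vb_total E) u"
  proof (rule smooth_mapI_ex[OF E'(3,4,1,2)])
    show "u ` pts (vb_base E) \<subseteq> pts (vb_total E)"
      using u(2) by (auto simp: fibre_def)
    fix p assume p: "p \<in> pts (vb_base E)"
    then obtain W \<Phi> d where W: "(W, \<Phi>) \<in> vb_trivs E" "p \<in> W" and d: "d \<in> charts (vb_base E)"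
      and l: "loc_smooth d vec_chart (\<lambda>x. \<Phi> (u x)) p"
      using loc[OF p] by metis
    have pd: "p \<in> fst d" using l by (auto elim: loc_smoothE)
    have triv: "local_trivialisation E W \<Phi>" using E'(9)[OF W(1)] .
    note Wop = local_trivialisation_open[OF E'(4) triv]
    note dc = smooth_atlas_chart[OF E'(4) d(1)]
    have up: "u p \<in> fibre E p" using u(2)[OF p] .
    then obtain c where c: "c \<in> charts (vb_total E)" "u p \<in> fst c"
      using smooth_atlas_cover[OF E'(2)] by (auto simp: fibre_def)
    note cc = smooth_atlas_chart[OF E'(2) c(1)]
    let ?cW = "(fst c \<inter> vb_proj E -` W, snd c)" and ?dW = "(fst d \<inter> W) \<times> (UNIV :: 'k set)"
    let ?dk = "(?dW, map_prod (snd d) id)"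
    let ?\<tau> = "\<lambda>e. (vb_proj E e, \<Phi> e)" and ?EW = "open_submanifold (vb_total E) (vb_proj E -` W)"
    have bij: "inj_on ?\<tau> (pts ?EW)"
      using triv by (simp add: local_trivialisation_def diffeomorphism_def bij_betw_def)
    have inv: "inv_into (pts ?EW) ?\<tau> (q, \<Phi> (u q)) = u q" if "q \<in> W" for q
    proof -
      have "u q \<in> fibre E q" using u(2) that Wop(1) by blast
      then have "u q \<in> pts ?EW" "?\<tau> (u q) = (q, \<Phi> (u q))"
        using that by (simp_all add: fibre_def open_submanifold_def)
      then show ?thesis using inv_into_f_f[OF bij, of "u q"] by simp
    qed
    obtain V \<phi> where V: "p \<in> fst d" "open V" "snd d p \<in> V" "smooth_on V \<phi>"
      "\<And>q. q \<in> fst d \<Longrightarrow> snd d q \<in> V \<Longrightarrow> \<phi> (snd d q) = \<Phi> (u q)"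
      using l by (rule loc_smooth_vecE) blast
    \<comment> \<open>The inverse trivialisation is known to recover \<open>u\<close> over
      \<open>W\<close>, so the neighbourhood is shrunk accordingly.\<close>
    let ?V = "V \<inter> snd d ` (fst d \<inter> W)"
    have inW: "q \<in> W" if "q \<in> fst d" "snd d q \<in> ?V" for q
      using that dc(2) by (auto dest: inj_onD)
    have 1: "loc_smooth d ?dk (\<lambda>x. (x, \<Phi> (u x))) p"
    proof (rule loc_smoothI[where V = ?V and \<phi> = "\<lambda>x. (x, \<phi> x)"])
      show op: "open ?V" using V(2) Wop(2)[OF d] by blast
      show "smooth_on ?V (\<lambda>x. (x, \<phi> x))"
        by (intro smooth_on_Pair smooth_on_id op smooth_on_subset[OF V(4)]) blast
      show "snd d p \<in> ?V" using V(3) pd W(2) by blast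
      show "(q, \<Phi> (u q)) \<in> fst ?dk \<and> (snd d q, \<phi> (snd d q)) = snd ?dk (q, \<Phi> (u q))"
        if "q \<in> fst d" "snd d q \<in> ?V" for q
        using that inW[OF that] V(5)[of q] by simp
    qed (rule pd)
    have 2: "loc_smooth ?dk ?cW (inv_into (pts ?EW) ?\<tau>) (p, \<Phi> (u p))"
    proof (rule smooth_map_imp_loc_smooth)
      show "smooth_map (product_manifold (open_submanifold (vb_base E) W) model_manifold) ?EW
          (inv_into (pts ?EW) ?\<tau>)"
        using triv by (simp add: local_trivialisation_def diffeomorphism_def)
      show "?cW \<in> charts ?EW"
        using c by (simp add: open_submanifold_def)
      show "?dk \<in> charts (product_manifold (open_submanifold (vb_base E) W) model_manifold)"
        by (rule product_chart[OF d])
      show "inj_on (snd ?dk) (fst ?dk)"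
        using dc(2) by (auto simp: inj_on_def)
    qed (use c up pd W inv in \<open>auto simp: fibre_def\<close>)
    have "loc_smooth d ?cW (\<lambda>x. inv_into (pts ?EW) ?\<tau> (x, \<Phi> (u x))) p"
      using loc_smooth_compose[OF fin_dim_prod[OF E'(3,5)] 1 2] .
    then have "loc_smooth d ?cW u p"
    proof (rule loc_smooth_cong[where U = ?V])
      show "open ?V" using V(2) Wop(2)[OF d] by blast
      show "snd d p \<in> ?V" using V(3) pd W(2) by blast
    qed (use inW inv in blast)
    then have "loc_smooth d c u p"
      using loc_smooth_target_mono[of d "fst c \<inter> vb_proj E -` W" "snd c" u p "fst c"] by simp
    then show "\<exists>c\<in>charts (vb_base E). \<exists>d\<in>charts (vb_total E). loc_smooth c d u p"
      using c d by blast
  qed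
  then show ?thesis
    using u by (auto simp: sections_def fibre_def)
qed

text \<open>Lets fibrewise operations be checked on a formula \<open>g \<Phi>\<close>, such as the
  sum of the coordinates of two sections.\<close>

lemma sectionI_coordinates:
  fixes E :: "('e, 't::real_normed_vector, 'p, 'a::real_normed_vector, 'k::real_normed_vector) vbundle"
  assumes E: "vector_bundle E" and u: "u \<in> extensional (pts (vb_base E))"
    "\<And>x. x \<in> pts (vb_base E) \<Longrightarrow> u x \<in> fibre E x"
    and loc: "\<And>W \<Phi> d p. (W, \<Phi>) \<in> vb_trivs E \<Longrightarrow> p \<in> W \<Longrightarrow> d \<in> charts (vb_base E) \<Longrightarrow> p \<in> fst d \<Longrightarrow>
      loc_smooth d vec_chart (g \<Phi>) p"
    and g: "\<And>W \<Phi> q. (W, \<Phi>) \<in> vb_trivs E \<Longrightarrow> q \<in> W \<Longrightarrow> g \<Phi> q = \<Phi> (u q)"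
  shows "u \<in> sections E"
proof (rule sectionI[OF E u])
  note E' = vector_bundleD[OF E]
  fix p assume p: "p \<in> pts (vb_base E)"
  then obtain W \<Phi> where W: "(W, \<Phi>) \<in> vb_trivs E" "p \<in> W"
    using vector_bundle_triv[OF E] by metis
  obtain d where d: "d \<in> charts (vb_base E)" "p \<in> fst d"
    using smooth_atlas_cover[OF E'(4) p] by metis
  note Wop = local_trivialisation_open[OF E'(4) E'(9)[OF W(1)]]
  note dc = smooth_atlas_chart[OF E'(4) d(1)]
  have "loc_smooth d vec_chart (\<lambda>x. \<Phi> (u x)) p"
  proof (rule loc_smooth_cong[where U = "snd d ` (fst d \<inter> W)"])
    show "loc_smooth d vec_chart (g \<Phi>) p" using loc[OF W d] .
    fix q assume "q \<in> fst d" "snd d q \<in> snd d ` (fst d \<inter> W)"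
    then have "q \<in> W" using dc(2) by (auto dest: inj_onD)
    then show "g \<Phi> q = \<Phi> (u q)" using g[OF W(1)] by simp
  qed (use Wop(2)[OF d(1)] d W in auto)
  then show "\<exists>W \<Phi> d. (W, \<Phi>) \<in> vb_trivs E \<and> d \<in> charts (vb_base E) \<and>
      p \<in> W \<and> loc_smooth d vec_chart (\<lambda>x. \<Phi> (u x)) p"
    using W d by blast
qed

section \<open>The module operations on sections\<close>

context
  fixes E :: "('e, 't::real_normed_vector, 'p, 'a::real_normed_vector, 'k::real_normed_vector) vbundle"
  assumes E: "vector_bundle E"
begin

private lemma triv_subset:
  assumes "(W, \<Phi>) \<in> vb_trivs E" "q \<in> W"
  shows "q \<in> pts (vb_base E)"
  using local_trivialisation_open(1)[OF vector_bundleD(4,9)[OF E]] assms by blast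

lemma sec_zero_section: "sec_zero E \<in> sections E"
proof (rule sectionI_coordinates[OF E, where g = "\<lambda>\<Phi> q. 0"])
  show "0 = \<Phi> (sec_zero E q)" if "(W, \<Phi>) \<in> vb_trivs E" "q \<in> W" for W \<Phi> q
    using local_trivialisation_linear(1)[OF vector_bundleD(9)[OF E that(1)] that(2)] triv_subset[OF that]
    by (simp add: sec_zero_def)
qed (auto simp: sec_zero_def vec_chart_def vector_bundleD(6)[OF E] intro!: loc_smooth_const)

lemma sec_add_section:
  assumes u: "u \<in> sections E" and v: "v \<in> sections E"
  shows "sec_add E u v \<in> sections E"
proof (rule sectionI_coordinates[OF E, where g = "\<lambda>\<Phi> q. \<Phi> (u q) + \<Phi> (v q)"])
  show "\<Phi> (u q) + \<Phi> (v q) = \<Phi> (sec_add E u v q)" if "(W, \<Phi>) \<in> vb_trivs E" "q \<in> W" for W \<Phi> q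
    using local_trivialisation_linear(2)[OF vector_bundleD(9)[OF E that(1)] that(2)] triv_subset[OF that]
      section_fibre[OF u] section_fibre[OF v]
    by (simp add: sec_add_def)
  show "loc_smooth d vec_chart (\<lambda>q. \<Phi> (u q) + \<Phi> (v q)) p"
    if "(W, \<Phi>) \<in> vb_trivs E" "p \<in> W" "d \<in> charts (vb_base E)" "p \<in> fst d" for W \<Phi> d p
    by (rule loc_smooth_add[OF section_loc_smooth[OF E u that] section_loc_smooth[OF E v that]])
qed (auto simp: sec_add_def vector_bundleD(7)[OF E] section_fibre[OF u] section_fibre[OF v])

lemma sec_mult_section:
  assumes f: "f \<in> smooth_funs (vb_base E)" and u: "u \<in> sections E"
  shows "sec_mult E f u \<in> sections E"
proof (rule sectionI_coordinates[OF E, where g = "\<lambda>\<Phi> q. f q *\<^sub>R \<Phi> (u q)"])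
  show "f q *\<^sub>R \<Phi> (u q) = \<Phi> (sec_mult E f u q)" if "(W, \<Phi>) \<in> vb_trivs E" "q \<in> W" for W \<Phi> q
    using local_trivialisation_linear(3)[OF vector_bundleD(9)[OF E that(1)] that(2)] triv_subset[OF that]
      section_fibre[OF u]
    by (simp add: sec_mult_def)
  show "loc_smooth d vec_chart (\<lambda>q. f q *\<^sub>R \<Phi> (u q)) p"
    if "(W, \<Phi>) \<in> vb_trivs E" "p \<in> W" "d \<in> charts (vb_base E)" "p \<in> fst d" for W \<Phi> d p
    using f that(3,4)
    by (intro loc_smooth_scaleR section_loc_smooth[OF E u that])
      (auto simp: smooth_funs_iff[OF vector_bundleD(4)[OF E]])
qed (auto simp: sec_mult_def vector_bundleD(8)[OF E] section_fibre[OF u])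

end


section \<open>Tangent vectors as derivations\<close>

lemma smooth_funs_coord:
  assumes "c \<in> charts X" "g \<in> smooth_funs X"
  shows "smooth_on (snd c ` fst c) (g \<circ> chart_inv c)"
  using assms by (auto simp: smooth_funs_def smooth_map_def model_manifold_def)

lemma chart_inv_coord:
  assumes "inj_on (snd c) (fst c)" "q \<in> fst c"
  shows "chart_inv c (snd c q) = q"
  using assms by (simp add: chart_inv_def)

text \<open>\<open>tangent_space\<close> collects vectors written in any chart around
  \<open>p\<close>. The chain rule for the transition map rewrites them in the given chart, the new
  components being the derivative of the transition applied to the old ones.\<close>

lemma tangent_space_coord:
  fixes X :: "('p, 'a::real_normed_vector) manifold"
  assumes X: "smooth_atlas X" and c: "c \<in> charts X" "p \<in> fst c" and v: "v \<in> tangent_space X p"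
  shows "\<exists>w. v = coord_vector X c p w"
proof -
  obtain d w where d: "d \<in> charts X" "p \<in> fst d" and v: "v = coord_vector X d p w"
    using v by (auto simp: tangent_space_def)
  note dc = smooth_atlas_chart[OF X d(1)] and cc = smooth_atlas_chart[OF X c(1)]
  let ?S = "snd d ` (fst d \<inter> fst c)" and ?T = "snd c \<circ> chart_inv d"
  have S: "open ?S" "smooth_on ?S ?T"
    using X c(1) d(1) unfolding smooth_atlas_def by blast+
  have pS: "snd d p \<in> ?S" using c(2) d(2) by blast
  have Tp: "?T (snd d p) = snd c p" using chart_inv_coord[OF dc(2) d(2)] by simp
  have T: "(?T has_derivative frechet_derivative ?T (at (snd d p))) (at (snd d p))"
    using smooth_on_imp_differentiable[OF S(2) pS] frechet_derivative_works by blast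
  have "coord_vector X d p w g = coord_vector X c p (frechet_derivative ?T (at (snd d p)) w) g" for g
  proof (cases "g \<in> smooth_funs X")
    case True
    let ?G = "g \<circ> chart_inv c"
    have "?G differentiable (at (snd c p))"
      by (rule smooth_on_imp_differentiable[OF smooth_funs_coord[OF c(1) True]]) (use c in blast)
    then have "(?G has_derivative frechet_derivative ?G (at (snd c p))) (at (?T (snd d p)))"
      unfolding Tp frechet_derivative_works .
    then have "((\<lambda>x. ?G (?T x)) has_derivative (\<lambda>x. frechet_derivative ?G (at (snd c p))
        (frechet_derivative ?T (at (snd d p)) x))) (at (snd d p))"
      by (rule has_derivative_compose[OF T])
    then have "((g \<circ> chart_inv d) has_derivative (\<lambda>x. frechet_derivative ?G (at (snd c p))
        (frechet_derivative ?T (at (snd d p)) x))) (at (snd d p))"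
    proof (rule has_derivative_transform_within_open[OF _ S(1) pS])
      show "?G (?T x) = (g \<circ> chart_inv d) x" if "x \<in> ?S" for x
        using that chart_inv_coord[OF dc(2)] chart_inv_coord[OF cc(2)] by auto
    qed
    from frechet_derivative_at[OF this] show ?thesis
      using True by (simp add: coord_vector_def fun_eq_iff)
  qed (simp add: coord_vector_def)
  then show ?thesis unfolding v by blast
qed

lemma tangent_vector_apply:
  fixes X :: "('p, 'a::real_normed_vector) manifold"
  assumes "smooth_atlas X" "c \<in> charts X" "fst e \<in> fst c" "e \<in> pts (tangent_manifold X)"
    "g \<in> smooth_funs X"
  shows "snd e g = frechet_derivative (g \<circ> chart_inv c) (at (snd c (fst e))) (vector_coord X c e)"
proof -
  have "snd e \<in> tangent_space X (fst e)"
    using assms(4) by (auto simp: tangent_manifold_def)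
  then obtain w where "snd e = coord_vector X c (fst e) w"
    using tangent_space_coord[OF assms(1-3)] by metis
  \<comment> \<open>\<open>vector_coord\<close> is a chosen preimage under
    \<open>coord_vector\<close>, so \<open>coord_vector\<close> returns \<open>snd e\<close> from it
    once \<open>snd e\<close> is known to lie in the range.\<close>
  then have "snd e = coord_vector X c (fst e) (vector_coord X c e)"
    unfolding vector_coord_def by (simp add: f_inv_into_f[OF rangeI])
  then have "snd e g = coord_vector X c (fst e) (vector_coord X c e) g" by simp
  then show ?thesis using assms(5) by (simp add: coord_vector_def)
qed

lemma tangent_vector_chart:
  assumes "smooth_atlas X" "e \<in> pts (tangent_manifold X)"
  obtains c where "c \<in> charts X" "fst e \<in> fst c"
proof (rule smooth_atlas_cover[OF assms(1)])
  show "fst e \<in> pts X" using assms(2) by (auto simp: tangent_manifold_def)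
qed

context
  fixes X :: "('p, 'a::real_normed_vector) manifold" and e
  assumes X: "smooth_atlas X" and e: "e \<in> pts (tangent_manifold X)"
begin

private lemma tangent_vector_has_derivative:
  assumes c: "c \<in> charts X" "fst e \<in> fst c" and f: "f \<in> smooth_funs X"
  shows "((f \<circ> chart_inv c) has_derivative frechet_derivative (f \<circ> chart_inv c) (at (snd c (fst e))))
    (at (snd c (fst e)))"
  using smooth_on_imp_differentiable[OF smooth_funs_coord[OF c(1) f], of "snd c (fst e)"] c(2)
    frechet_derivative_works by blast

text \<open>The chart image is open, so the coordinate expression of \<open>f\<close> may be
  replaced by any \<open>g\<close> that agrees with it there. Sums and products are then covered by
  the usual derivative rules.\<close>

private lemma tangent_vector_eqI:
  assumes c: "c \<in> charts X" "fst e \<in> fst c" and f: "f \<in> smooth_funs X"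
    and g: "(g has_derivative g') (at (snd c (fst e)))"
    and eq: "\<And>q. q \<in> fst c \<Longrightarrow> g (snd c q) = f q"
  shows "snd e f = g' (vector_coord X c e)"
proof -
  note cc = smooth_atlas_chart[OF X c(1)]
  have "((f \<circ> chart_inv c) has_derivative g') (at (snd c (fst e)))"
    by (rule has_derivative_transform_within_open[OF g cc(3)])
      (use c(2) eq chart_inv_coord[OF cc(2)] in auto)
  from frechet_derivative_at[OF this] show ?thesis
    by (simp add: tangent_vector_apply[OF X c e f])
qed

lemma tangent_vector_add:
  assumes f: "f \<in> smooth_funs X" and g: "g \<in> smooth_funs X"
  shows "snd e (\<lambda>x\<in>pts X. f x + g x) = snd e f + snd e g"
proof -
  obtain c where c: "c \<in> charts X" "fst e \<in> fst c" using tangent_vector_chart[OF X e] .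
  note cc = smooth_atlas_chart[OF X c(1)]
  show ?thesis
    unfolding tangent_vector_apply[OF X c e f] tangent_vector_apply[OF X c e g]
    by (rule tangent_vector_eqI[OF c smooth_funs_add[OF X f g]
          has_derivative_add[OF tangent_vector_has_derivative[OF c f] tangent_vector_has_derivative[OF c g]]])
      (use cc(1) chart_inv_coord[OF cc(2)] in auto)
qed

lemma tangent_vector_mult:
  assumes f: "f \<in> smooth_funs X" and g: "g \<in> smooth_funs X"
  shows "snd e (\<lambda>x\<in>pts X. f x * g x) = f (fst e) * snd e g + snd e f * g (fst e)"
proof -
  obtain c where c: "c \<in> charts X" "fst e \<in> fst c" using tangent_vector_chart[OF X e] .
  note cc = smooth_atlas_chart[OF X c(1)]
  have "snd e (\<lambda>x\<in>pts X. f x * g x) =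
      (f \<circ> chart_inv c) (snd c (fst e)) * frechet_derivative (g \<circ> chart_inv c) (at (snd c (fst e))) (vector_coord X c e)
      + frechet_derivative (f \<circ> chart_inv c) (at (snd c (fst e))) (vector_coord X c e) * (g \<circ> chart_inv c) (snd c (fst e))"
    by (rule tangent_vector_eqI[OF c smooth_funs_mult[OF X f g]
          has_derivative_mult[OF tangent_vector_has_derivative[OF c f] tangent_vector_has_derivative[OF c g]]])
      (use cc(1) chart_inv_coord[OF cc(2)] in auto)
  then show ?thesis
    using chart_inv_coord[OF cc(2) c(2)]
    by (simp add: tangent_vector_apply[OF X c e f] tangent_vector_apply[OF X c e g])
qed

lemma tangent_vector_const: "snd e (\<lambda>x\<in>pts X. r) = 0"
proof -
  obtain c where c: "c \<in> charts X" "fst e \<in> fst c" using tangent_vector_chart[OF X e] .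
  note cc = smooth_atlas_chart[OF X c(1)]
  show ?thesis
    by (rule tangent_vector_eqI[OF c smooth_funs_const[OF X] has_derivative_const[of r]])
      (use cc(1) in auto)
qed

end

text \<open>In coordinates the family consists of base points \<open>fst (\<phi> x)\<close> with
  components \<open>snd (\<phi> x)\<close>, and its value on \<open>g\<close> is the derivative of
  \<open>g\<close> in that moving direction.\<close>

lemma loc_smooth_tangent_apply:
  fixes X :: "('p, 'a::real_normed_vector) manifold"
  assumes fd: "fin_dim TYPE('a)" and X: "smooth_atlas X" and d: "d \<in> charts X"
    and f: "loc_smooth c (Sigma (fst d) (tangent_space X), \<lambda>e. (snd d (fst e), vector_coord X d e)) f p"
    and g: "g \<in> smooth_funs X"
  shows "loc_smooth c vec_chart (\<lambda>q. snd (f q) g) p"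
proof -
  note dc = smooth_atlas_chart[OF X d]
  obtain V \<phi> where V: "p \<in> fst c" "open V" "snd c p \<in> V" "smooth_on V \<phi>"
    "\<And>q. q \<in> fst c \<Longrightarrow> snd c q \<in> V \<Longrightarrow> f q \<in> Sigma (fst d) (tangent_space X) \<and>
      \<phi> (snd c q) = (snd d (fst (f q)), vector_coord X d (f q))"
    using f by (rule loc_smoothE) simp
  \<comment> \<open>\<open>V\<close> may contain points that are not coordinates of anything, where
    \<open>\<phi>\<close> is unrelated to \<open>f\<close>. The preimage keeps the base coordinate
    where \<open>g\<close> has a smooth expression.\<close>
  let ?V = "V \<inter> (\<lambda>x. fst (\<phi> x)) -` (snd d ` fst d)"
  have op: "open ?V"
    by (rule continuous_open_preimage[OF continuous_on_fst[OF smooth_on_imp_continuous_on[OF V(4)]] V(2) dc(3)])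
  have sm: "smooth_on ?V \<phi>" by (rule smooth_on_subset[OF V(4)]) blast
  show ?thesis
  proof (rule loc_smooth_vecI[OF V(1) op])
    show "snd c p \<in> ?V" using V(3) V(5)[OF V(1,3)] by auto
    show "smooth_on ?V (\<lambda>x. frechet_derivative (g \<circ> chart_inv d) (at (fst (\<phi> x))) (snd (\<phi> x)))"
      by (rule smooth_on_frechet_apply[OF fd op _
            smooth_on_bounded_linear[OF bounded_linear_fst op sm]
            smooth_on_bounded_linear[OF bounded_linear_snd op sm] smooth_funs_coord[OF d g]]) blast
    fix q assume q: "q \<in> fst c" "snd c q \<in> ?V"
    then have fq: "f q \<in> Sigma (fst d) (tangent_space X)"
      "\<phi> (snd c q) = (snd d (fst (f q)), vector_coord X d (f q))"
      using V(5)[of q] by blast+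
    then have "fst (f q) \<in> fst d" "f q \<in> pts (tangent_manifold X)"
      using dc(1) by (auto simp: tangent_manifold_def)
    from tangent_vector_apply[OF X d this g] show
      "frechet_derivative (g \<circ> chart_inv d) (at (fst (\<phi> (snd c q)))) (snd (\<phi> (snd c q))) = snd (f q) g"
      by (simp add: fq(2))
  qed
qed

lemma smooth_map_compose:
  fixes Y :: "('q, 'b::real_normed_vector) manifold"
  assumes X: "smooth_atlas X" and Y: "fin_dim TYPE('b)" "smooth_atlas Y"
    and f: "smooth_map X Y f" and g: "smooth_map Y Z g"
  shows "smooth_map X Z (\<lambda>x. g (f x))"
proof (rule smooth_mapI)
  have sub: "f ` pts X \<subseteq> pts Y" "g ` pts Y \<subseteq> pts Z" using f g by (auto simp: smooth_map_def)
  then show "(\<lambda>x. g (f x)) ` pts X \<subseteq> pts Z" by blast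
  fix c e p assume c: "c \<in> charts X" "p \<in> fst c" and e: "e \<in> charts Z" "g (f p) \<in> fst e"
  note cc = smooth_atlas_chart[OF X c(1)]
  obtain d where d: "d \<in> charts Y" "f p \<in> fst d"
    using smooth_atlas_cover[OF Y(2), of "f p"] sub(1) cc(1) c(2) by blast
  show "loc_smooth c e (\<lambda>x. g (f x)) p"
    by (rule smooth_map_loc_compose[OF Y g smooth_map_imp_loc_smooth[OF f c(1) d(1) cc(2) c(2) d(2)] d(1) e])
qed (rule smooth_atlas_chart(3)[OF X])


section \<open>The action of a generalized Lie algebroid on functions\<close>

locale gla =
  fixes F :: "('f, 't::real_normed_vector, 'n, 'b::real_normed_vector, 'k::real_normed_vector) vbundle"
    and M :: "('m, 'a::real_normed_vector) manifold"
    and h :: "'m \<Rightarrow> 'n" and \<eta> :: "'n \<Rightarrow> 'm"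
    and br :: "('n \<Rightarrow> 'f) \<Rightarrow> ('n \<Rightarrow> 'f) \<Rightarrow> 'n \<Rightarrow> 'f"
    and \<rho> :: "'f \<Rightarrow> 'm \<times> 'm tangent_vector"
  assumes gla: "gen_lie_algebroid F M h \<eta> br \<rho>"
begin

abbreviation N where "N \<equiv> vb_base F"
abbreviation A where "A \<equiv> gla_act F M h \<eta> \<rho>"
text \<open>\<open>sec_map\<close> reads a section at the preimage of the point under
  \<open>h \<circ> \<eta>\<close>; the action of \<open>z\<close> at \<open>y\<close> therefore sees
  only \<open>z (shift y)\<close>.\<close>

abbreviation shift where "shift \<equiv> inv_into (pts N) (h \<circ> \<eta>)"

lemma vb: "vector_bundle F"
  using gla by (simp add: gen_lie_algebroid_def)

lemma atlas_M: "fin_dim TYPE('a)" "smooth_atlas M"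
  using gla by (auto simp: gen_lie_algebroid_def smooth_manifold_def)

lemmas vbD = vector_bundleD[OF vb]

lemma diffeo: "diffeomorphism M N h" "diffeomorphism N M \<eta>"
  using gla by (auto simp: gen_lie_algebroid_def)

lemma morphism: "vb_morphism F (tangent_bundle M) \<rho> \<eta>"
  using gla by (simp add: gen_lie_algebroid_def)

lemma bij_h: "bij_betw h (pts M) (pts N)" and bij_\<eta>: "bij_betw \<eta> (pts N) (pts M)"
  using diffeo by (auto simp: diffeomorphism_def)

lemma bij_h\<eta>: "bij_betw (h \<circ> \<eta>) (pts N) (pts N)"
  using bij_betw_trans[OF bij_\<eta> bij_h] .

text \<open>The third equation splits \<open>shift\<close> into the inverses of \<open>h\<close> and
  \<open>\<eta>\<close>, which are smooth because both maps are diffeomorphisms.\<close>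

lemma shift:
  assumes "y \<in> pts N"
  shows "shift y \<in> pts N" "h (\<eta> (shift y)) = y"
    "shift y = inv_into (pts N) \<eta> (inv_into (pts M) h y)"
proof -
  show s: "shift y \<in> pts N" and hs: "h (\<eta> (shift y)) = y"
    using assms bij_h\<eta> f_inv_into_f[of y "h \<circ> \<eta>" "pts N"] inv_into_into[of y "h \<circ> \<eta>" "pts N"]
    by (auto simp: bij_betw_def)
  have "\<eta> (shift y) \<in> pts M" using s bij_\<eta> by (auto simp: bij_betw_def)
  then have "inv_into (pts M) h y = \<eta> (shift y)"
    using hs bij_h by (metis bij_betw_inv_into_left)
  then show "shift y = inv_into (pts N) \<eta> (inv_into (pts M) h y)"
    using s bij_\<eta> by (metis bij_betw_inv_into_left)
qed

lemma pullback: "f \<in> smooth_funs N \<Longrightarrow> (\<lambda>x\<in>pts M. f (h x)) \<in> smooth_funs M"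
  using smooth_funs_compose[OF atlas_M(2) vbD(3,4)] diffeo(1) by (auto simp: diffeomorphism_def)

lemma anchor_fibre:
  assumes "a \<in> fibre F x"
  shows "\<rho> a \<in> pts (tangent_manifold M)" "fst (\<rho> a) = \<eta> x"
  using assms morphism by (auto simp: vb_morphism_def smooth_map_def tangent_bundle_def fibre_def)

text \<open>Pushing a tangent vector forward along \<open>h\<close> means applying it to functions
  pulled back by \<open>h\<close>; the action thus becomes a tangent vector of \<open>M\<close>
  applied to a function on \<open>M\<close>.\<close>

lemma act_eq:
  assumes "y \<in> pts N" "f \<in> smooth_funs N"
  shows "A z f y = snd (\<rho> (z (shift y))) (\<lambda>x\<in>pts M. f (h x))"
  using assms
  by (simp add: gla_act_def vf_apply_def gla_anchor_def sec_map_def tangent_bundle_def tangent_map_def)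

lemma act_extensional: "A z f \<in> extensional (pts N)"
  by (simp add: gla_act_def vf_apply_def)

text \<open>The tangent vector acting at \<open>y\<close> depends on \<open>y\<close> through the
  inverses of \<open>h\<close> and \<open>\<eta>\<close>, the section and the anchor, all of them
  smooth, and a smooth family of tangent vectors sends a smooth function to a smooth
  function.\<close>

lemma act_smooth:
  assumes z: "z \<in> sections F" and f: "f \<in> smooth_funs N"
  shows "A z f \<in> smooth_funs N"
  unfolding smooth_funs_iff[OF vbD(4)]
proof (intro conjI ballI act_extensional)
  fix c y assume c: "c \<in> charts N" "y \<in> fst c"
  note cc = smooth_atlas_chart[OF vbD(4) c(1)]
  let ?\<psi> = "\<lambda>y. \<rho> (z (inv_into (pts N) \<eta> (inv_into (pts M) h y)))"
  have inv: "smooth_map N M (inv_into (pts M) h)" "smooth_map M N (inv_into (pts N) \<eta>)"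
    using diffeo by (auto simp: diffeomorphism_def)
  have zs: "smooth_map N (vb_total F) z" using z by (auto simp: sections_def)
  have rs: "smooth_map (vb_total F) (tangent_manifold M) \<rho>"
    using morphism by (simp add: vb_morphism_def tangent_bundle_def)
  have sm: "smooth_map N (tangent_manifold M) ?\<psi>"
    by (rule smooth_map_compose[OF vbD(4,1,2) smooth_map_compose[OF vbD(4,3,4)
          smooth_map_compose[OF vbD(4) atlas_M inv] zs] rs])
  have yN: "y \<in> pts N" using c cc(1) by blast
  then have \<psi>y: "?\<psi> y \<in> pts (tangent_manifold M)"
    using sm by (auto simp: smooth_map_def)
  then obtain d where d: "d \<in> charts M" "fst (?\<psi> y) \<in> fst d"
    using tangent_vector_chart[OF atlas_M(2)] by metis
  let ?d = "(Sigma (fst d) (tangent_space M), \<lambda>e. (snd d (fst e), vector_coord M d e))"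
  have "loc_smooth c ?d ?\<psi> y"
  proof (rule smooth_map_imp_loc_smooth[OF sm c(1) _ cc(2) c(2)])
    show "?d \<in> charts (tangent_manifold M)" using d(1) by (simp add: tangent_manifold_def)
    show "?\<psi> y \<in> fst ?d" using \<psi>y d(2) by (auto simp: tangent_manifold_def mem_Times_iff)
  qed
  from loc_smooth_tangent_apply[OF atlas_M d(1) this pullback[OF f]]
  show "loc_smooth c vec_chart (A z f) y"
  proof (rule loc_smooth_cong[OF _ open_UNIV])
    fix q assume "q \<in> fst c"
    then have "q \<in> pts N" using cc(1) by blast
    then show "snd (?\<psi> q) (\<lambda>x\<in>pts M. f (h x)) = A z f q"
      by (simp add: act_eq[OF _ f] shift(3))
  qed simp
qed

context
  fixes z y
  assumes z: "z \<in> sections F" and y: "y \<in> pts N"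
begin

private lemma fib: "z (shift y) \<in> fibre F (shift y)"
  using section_fibre[OF z shift(1)[OF y]] .

private lemma tv: "\<rho> (z (shift y)) \<in> pts (tangent_manifold M)" "h (fst (\<rho> (z (shift y)))) = y"
  "fst (\<rho> (z (shift y))) \<in> pts M"
  using anchor_fibre[OF fib] shift[OF y] bij_\<eta> by (auto simp: bij_betw_def)

lemma act_add:
  assumes f: "f \<in> smooth_funs N" and g: "g \<in> smooth_funs N"
  shows "A z (\<lambda>x\<in>pts N. f x + g x) y = A z f y + A z g y"
proof -
  have eq: "(\<lambda>x\<in>pts M. (\<lambda>x\<in>pts N. f x + g x) (h x)) =
      (\<lambda>x\<in>pts M. (\<lambda>x\<in>pts M. f (h x)) x + (\<lambda>x\<in>pts M. g (h x)) x)"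
    using bij_h by (auto simp: bij_betw_def fun_eq_iff)
  show ?thesis
    unfolding act_eq[OF y f] act_eq[OF y g] act_eq[OF y smooth_funs_add[OF vbD(4) f g]] eq
    by (rule tangent_vector_add[OF atlas_M(2) tv(1) pullback[OF f] pullback[OF g]])
qed

lemma act_mult:
  assumes f: "f \<in> smooth_funs N" and g: "g \<in> smooth_funs N"
  shows "A z (\<lambda>x\<in>pts N. f x * g x) y = f y * A z g y + A z f y * g y"
proof -
  have eq: "(\<lambda>x\<in>pts M. (\<lambda>x\<in>pts N. f x * g x) (h x)) =
      (\<lambda>x\<in>pts M. (\<lambda>x\<in>pts M. f (h x)) x * (\<lambda>x\<in>pts M. g (h x)) x)"
    using bij_h by (auto simp: bij_betw_def fun_eq_iff)
  have "A z (\<lambda>x\<in>pts N. f x * g x) y = (\<lambda>x\<in>pts M. f (h x)) (fst (\<rho> (z (shift y)))) * A z g y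
      + A z f y * (\<lambda>x\<in>pts M. g (h x)) (fst (\<rho> (z (shift y))))"
    unfolding act_eq[OF y f] act_eq[OF y g] act_eq[OF y smooth_funs_mult[OF vbD(4) f g]] eq
    by (rule tangent_vector_mult[OF atlas_M(2) tv(1) pullback[OF f] pullback[OF g]])
  then show ?thesis using tv by simp
qed

lemma act_const: "A z (\<lambda>x\<in>pts N. r) y = 0"
proof -
  have eq: "(\<lambda>x\<in>pts M. (\<lambda>x\<in>pts N. r) (h x)) = (\<lambda>x\<in>pts M. r)"
    using bij_h by (auto simp: bij_betw_def fun_eq_iff)
  show ?thesis
    unfolding act_eq[OF y smooth_funs_const[OF vbD(4)]] eq
    by (rule tangent_vector_const[OF atlas_M(2) tv(1)])
qed

lemma act_sec_add:
  assumes u: "u \<in> sections F" and f: "f \<in> smooth_funs N"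
  shows "A (sec_add F z u) f y = A z f y + A u f y"
proof -
  have "\<rho> (vb_add F (z (shift y)) (u (shift y))) =
      vb_add (tangent_bundle M) (\<rho> (z (shift y))) (\<rho> (u (shift y)))"
    using morphism shift(1)[OF y] fib section_fibre[OF u shift(1)[OF y]]
    by (simp add: vb_morphism_def)
  then show ?thesis
    using shift(1)[OF y] pullback[OF f] unfolding act_eq[OF y f]
    by (simp add: sec_add_def tangent_bundle_def)
qed

lemma act_sec_mult_shift:
  assumes f: "f \<in> smooth_funs N"
  shows "A (sec_mult F g z) f y = g (shift y) * A z f y"
proof -
  have "\<rho> (vb_scale F (g (shift y)) (z (shift y))) =
      vb_scale (tangent_bundle M) (g (shift y)) (\<rho> (z (shift y)))"
    using morphism shift(1)[OF y] fib by (simp add: vb_morphism_def)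
  then show ?thesis
    using shift(1)[OF y] pullback[OF f] unfolding act_eq[OF y f]
    by (simp add: sec_mult_def tangent_bundle_def)
qed

end

end


section \<open>Bump functions and nonvanishing sections\<close>

text \<open>The power of \<open>t\<close> makes this family closed under differentiation up to
  linear combinations, so one induction on the order gives smoothness of all members at
  once.\<close>

definition flat_exp :: "nat \<Rightarrow> real \<Rightarrow> real"
  where "flat_exp n t = (if t > 0 then exp (- inverse t) / t ^ n else 0)"

text \<open>On the right the substitution \<open>t = inverse s\<close> gives
  \<open>s ^ n / exp s\<close>, which tends to 0; on the left the function is 0.\<close>

lemma flat_exp_tendsto_0: "(flat_exp n \<longlongrightarrow> 0) (at 0)"
proof (rule filterlim_split_at)
  show "(flat_exp n \<longlongrightarrow> 0) (at_left 0)"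
    by (rule tendsto_eventually) (auto simp: flat_exp_def eventually_at_filter)
  have "((\<lambda>s. flat_exp n (inverse s)) \<longlongrightarrow> 0) at_top"
  proof (rule Lim_transform_eventually[OF tendsto_power_div_exp_0[of n]])
    show "\<forall>\<^sub>F s in at_top. s ^ n / exp s = flat_exp n (inverse s)"
      using eventually_gt_at_top[of "0::real"]
      by eventually_elim (simp add: flat_exp_def exp_minus field_simps)
  qed
  then show "(flat_exp n \<longlongrightarrow> 0) (at_right 0)"
    by (simp add: filterlim_at_right_to_top)
qed

lemma flat_exp_deriv:
  "(flat_exp n has_real_derivative flat_exp (n + 2) t - real n * flat_exp (n + 1) t) (at t)"
proof -
  consider "t > 0" | "t < 0" | "t = 0" by linarith
  then show ?thesis
  proof cases
    case 1
    have "((\<lambda>t. exp (- inverse t) / t ^ n) has_real_derivative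
        exp (- inverse t) / t ^ (n + 2) - real n * (exp (- inverse t) / t ^ (n + 1))) (at t)"
    proof (induction n)
      case 0
      show ?case
        using 1 by (auto intro!: derivative_eq_intros simp: field_simps power2_eq_square)
    next
      case (Suc n)
      have "((\<lambda>t. exp (- inverse t) / t ^ n * inverse t) has_real_derivative
          exp (- inverse t) / t ^ (Suc n + 2) - real (Suc n) * (exp (- inverse t) / t ^ (Suc n + 1))) (at t)"
        by (rule DERIV_cong[OF DERIV_mult[OF Suc DERIV_inverse]])
          (use 1 in \<open>simp_all add: field_simps power2_eq_square\<close>)
      then show ?case by (simp add: field_simps)
    qed
    then have "((\<lambda>t. exp (- inverse t) / t ^ n) has_real_derivative
        flat_exp (n + 2) t - real n * flat_exp (n + 1) t) (at t)"
      using 1 by (simp add: flat_exp_def)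
    then show ?thesis
      by (rule has_field_derivative_transform_within_open[where S = "{0<..}"])
        (use 1 in \<open>auto simp: flat_exp_def\<close>)
  next
    case 2
    have "((\<lambda>t. 0) has_real_derivative flat_exp (n + 2) t - real n * flat_exp (n + 1) t) (at t)"
      using 2 by (simp add: flat_exp_def)
    then show ?thesis
      by (rule has_field_derivative_transform_within_open[where S = "{..<0}"])
        (use 2 in \<open>auto simp: flat_exp_def\<close>)
  next
    case 3
    \<comment> \<open>The difference quotient at 0 is the next member
      \<open>flat_exp (n + 1)\<close> of the family, whose limit at 0 is known.\<close>
    have "((\<lambda>h. (flat_exp n (0 + h) - flat_exp n 0) / h) \<longlongrightarrow> 0) (at 0)"
      by (rule Lim_transform_eventually[OF flat_exp_tendsto_0[of "n + 1"]])
        (auto simp: flat_exp_def eventually_at_filter)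
    then show ?thesis using 3 by (simp add: DERIV_def flat_exp_def)
  qed
qed

lemma smooth_on_flat_exp: "smooth_on UNIV (flat_exp n)"
proof -
  have "C_k k UNIV (flat_exp n)" for k
  proof (induction k arbitrary: n)
    case 0
    show ?case
      using flat_exp_deriv by (auto intro!: continuous_at_imp_continuous_on DERIV_isCont)
  next
    case (Suc k)
    show ?case
    proof (rule C_k_SucI[OF open_UNIV])
      show "(flat_exp n has_derivative
          (\<lambda>v. v * (flat_exp (n + 2) t - real n * flat_exp (n + 1) t))) (at t)" for t
        using flat_exp_deriv[of n t] by (simp add: has_field_derivative_def mult_commute_abs)
      fix v
      have "C_k k UNIV (\<lambda>t. v * flat_exp (n + 2) t + (- v * real n) * flat_exp (n + 1) t)"
        by (intro C_k_add C_k_bounded_linear[OF bounded_linear_mult_right] Suc open_UNIV)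
      then show "C_k k UNIV (\<lambda>t. v * (flat_exp (n + 2) t - real n * flat_exp (n + 1) t))"
        by (simp add: algebra_simps)
    qed
  qed
  then show ?thesis by (simp add: smooth_on_def)
qed

text \<open>Supplies compact neighbourhoods for an arbitrary norm, built up one vector at a time as
  continuous images of products of compact sets.\<close>

lemma compact_coordinate_cube:
  fixes B :: "'a::real_normed_vector set"
  assumes "finite B"
  shows "compact ((\<lambda>t. \<Sum>b\<in>B. t b *\<^sub>R b) ` (B \<rightarrow> {- r..r}))"
  using assms
proof (induction B rule: finite_induct)
  case empty
  show ?case by (simp add: image_constant_conv)
next
  case (insert a B)
  let ?K = "\<lambda>B. (\<lambda>t. \<Sum>b\<in>B. t b *\<^sub>R b) ` (B \<rightarrow> {- r..r})"
  let ?f = "\<lambda>p. fst p *\<^sub>R a + snd p"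
  have "?K (insert a B) = ?f ` ({- r..r} \<times> ?K B)"
  proof (intro equalityI subsetI)
    fix x assume "x \<in> ?K (insert a B)"
    then obtain t where t: "t \<in> insert a B \<rightarrow> {- r..r}" and x: "x = (\<Sum>b\<in>insert a B. t b *\<^sub>R b)"
      by (rule imageE)
    have "x = ?f (t a, \<Sum>b\<in>B. t b *\<^sub>R b)" using insert.hyps x by simp
    moreover have "(t a, \<Sum>b\<in>B. t b *\<^sub>R b) \<in> {- r..r} \<times> ?K B"
      using t by (intro SigmaI imageI) (auto simp: Pi_iff)
    ultimately show "x \<in> ?f ` ({- r..r} \<times> ?K B)" by (rule image_eqI)
  next
    fix x assume "x \<in> ?f ` ({- r..r} \<times> ?K B)"
    then obtain s t where s: "s \<in> {- r..r}" "t \<in> B \<rightarrow> {- r..r}"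
      and x: "x = s *\<^sub>R a + (\<Sum>b\<in>B. t b *\<^sub>R b)" by auto
    have "(\<Sum>b\<in>B. (t(a := s)) b *\<^sub>R b) = (\<Sum>b\<in>B. t b *\<^sub>R b)"
      using insert.hyps by (intro sum.cong) auto
    then have "x = (\<Sum>b\<in>insert a B. (t(a := s)) b *\<^sub>R b)"
      using insert.hyps x by simp
    moreover have "t(a := s) \<in> insert a B \<rightarrow> {- r..r}" using s by auto
    ultimately show "x \<in> ?K (insert a B)" by (rule image_eqI)
  qed
  moreover have "compact (?f ` ({- r..r} \<times> ?K B))"
    by (intro compact_continuous_image compact_Times compact_Icc insert.IH continuous_intros)
  ultimately show ?case by simp
qed

text \<open>\<open>\<beta>\<close> is \<open>flat_exp 0\<close> of \<open>r\<^sup>2\<close> minus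
  the sum of the squared coordinates of \<open>x - x0\<close>. It vanishes unless that sum is below
  \<open>r\<^sup>2\<close>, which forces every coordinate into the interval from \<open>- r\<close>
  to \<open>r\<close> and hence \<open>x\<close> into the cube \<open>K\<close>.\<close>

lemma bump_function:
  fixes x0 :: "'a::real_normed_vector"
  assumes fd: "fin_dim TYPE('a)" and U: "open U" "x0 \<in> U"
  obtains \<beta> :: "'a \<Rightarrow> real" and K
  where "smooth_on UNIV \<beta>" "\<beta> x0 \<noteq> 0" "compact K" "K \<subseteq> U" "\<And>x. \<beta> x \<noteq> 0 \<Longrightarrow> x \<in> K"
proof -
  obtain B :: "'a set" and \<phi> where B: "finite B" "\<And>b. b \<in> B \<Longrightarrow> bounded_linear (\<phi> b)"
    "\<And>x. (\<Sum>b\<in>B. \<phi> b x *\<^sub>R b) = x"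
    using fin_dim_coordinates[OF fd] by metis
  obtain e where e: "e > 0" "ball x0 e \<subseteq> U" using U openE by blast
  define S where "S = (\<Sum>b\<in>B. norm b)"
  have S: "S \<ge> 0" by (simp add: S_def sum_nonneg)
  \<comment> \<open>Points of the cube have distance at most \<open>r * S\<close> from
    \<open>x0\<close>. The denominator \<open>S + 1\<close> makes this less than \<open>e\<close>
    and remains nonzero for \<open>S = 0\<close>, as happens in dimension 0.\<close>
  define r where "r = e / (S + 1)"
  have r: "r > 0" "r * S < e" using e(1) S by (auto simp: r_def field_simps)
  define K where "K = (+) x0 ` (\<lambda>t. \<Sum>b\<in>B. t b *\<^sub>R b) ` (B \<rightarrow> {- r..r})"
  define \<beta> where "\<beta> x = flat_exp 0 (r\<^sup>2 + (\<Sum>b\<in>B. (- \<phi> b (x - x0)) *\<^sub>R \<phi> b (x - x0)))" for x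
  have \<phi>0: "\<phi> b 0 = 0" if "b \<in> B" for b
    using B(2)[OF that] by (rule linear_simps)
  show thesis
  proof
    have s: "smooth_on UNIV (\<lambda>x. \<phi> b (x - x0))" if "b \<in> B" for b
      using smooth_on_bounded_linear[OF B(2)[OF that] open_UNIV
          smooth_on_add[OF open_UNIV smooth_on_id[OF open_UNIV] smooth_on_const[OF open_UNIV]], of "- x0"]
      by simp
    have ms: "smooth_on UNIV (\<lambda>x. - \<phi> b (x - x0))" if "b \<in> B" for b
      by (rule smooth_on_bounded_linear[OF _ open_UNIV s[OF that]])
        (rule bounded_linear_minus[OF bounded_linear_ident])
    have "smooth_on UNIV (\<lambda>x. r\<^sup>2 + (\<Sum>b\<in>B. (- \<phi> b (x - x0)) *\<^sub>R \<phi> b (x - x0)))"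
      by (intro smooth_on_add smooth_on_sum smooth_on_scaleR smooth_on_const open_UNIV s ms)
    moreover have "fin_dim TYPE(real)"
      unfolding fin_dim_def by (intro exI[of _ "{1}"]) (auto simp: span_singleton)
    ultimately show "smooth_on UNIV \<beta>"
      unfolding \<beta>_def by (intro smooth_on_compose[OF _ open_UNIV _ _ smooth_on_flat_exp]) auto
    show "\<beta> x0 \<noteq> 0"
      using r(1) \<phi>0 by (simp add: \<beta>_def flat_exp_def)
    show "compact K"
      unfolding K_def by (intro compact_continuous_image compact_coordinate_cube B(1) continuous_intros)
    show "K \<subseteq> U"
    proof
      fix x assume "x \<in> K"
      then obtain t where t: "t \<in> B \<rightarrow> {- r..r}" "x = x0 + (\<Sum>b\<in>B. t b *\<^sub>R b)"
        by (auto simp: K_def)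
      have "norm (\<Sum>b\<in>B. t b *\<^sub>R b) \<le> (\<Sum>b\<in>B. r * norm b)"
        using t(1) by (intro sum_norm_le) (auto intro!: mult_right_mono simp: abs_le_iff Pi_iff)
      also have "\<dots> = r * S" by (simp add: S_def sum_distrib_left)
      finally show "x \<in> U" using e(2) r(2) t(2) by (auto simp: dist_norm)
    qed
    fix x assume "\<beta> x \<noteq> 0"
    then have "(\<Sum>b\<in>B. (\<phi> b (x - x0))\<^sup>2) < r\<^sup>2"
      by (auto simp: \<beta>_def flat_exp_def sum_negf power2_eq_square split: if_splits)
    moreover have "(\<phi> b (x - x0))\<^sup>2 \<le> (\<Sum>b\<in>B. (\<phi> b (x - x0))\<^sup>2)" if "b \<in> B" for b
      using B(1) that by (intro member_le_sum) auto
    ultimately have "\<bar>\<phi> b (x - x0)\<bar>\<^sup>2 < r\<^sup>2" if "b \<in> B" for b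
      using order_le_less_trans that by (metis power2_abs)
    then have "\<bar>\<phi> b (x - x0)\<bar> < r" if "b \<in> B" for b
      using power2_less_imp_less[of "\<bar>\<phi> b (x - x0)\<bar>" r] r(1) that by simp
    then have "(\<lambda>b. \<phi> b (x - x0)) \<in> B \<rightarrow> {- r..r}"
      by (force simp: abs_less_iff)
    then have "x0 + (\<Sum>b\<in>B. \<phi> b (x - x0) *\<^sub>R b) \<in> K"
      unfolding K_def by (intro imageI)
    then show "x \<in> K" by (simp add: B(3))
  qed
qed

lemma topspace_manifold_topology:
  assumes "smooth_atlas X"
  shows "topspace (manifold_topology X) = pts X"
proof
  show "topspace (manifold_topology X) \<subseteq> pts X"
    using openin_topspace[of "manifold_topology X"] unfolding openin_manifold_topology[OF assms] by blast
  have "fst c \<inter> pts X = fst c" if "c \<in> charts X" for c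
    using smooth_atlas_chart(1)[OF assms that] by blast
  then have "openin (manifold_topology X) (pts X)"
    using smooth_atlas_chart(3)[OF assms] by (simp add: openin_manifold_topology[OF assms])
  then show "pts X \<subseteq> topspace (manifold_topology X)" by (rule openin_subset)
qed

text \<open>\<open>chart_inv c\<close> is continuous by the definition of the topology, so it
  carries \<open>K\<close> to a compact set, and compact sets of a Hausdorff space are closed. This
  is what permits extension by zero from a chart.\<close>

lemma closedin_chart_compact:
  assumes X: "smooth_manifold X" and c: "c \<in> charts X" and K: "compact K" "K \<subseteq> snd c ` fst c"
  shows "closedin (manifold_topology X) (chart_inv c ` K)"
proof (rule compactin_imp_closedin[OF smooth_manifoldD(3)[OF X]])
  note at = smooth_manifoldD(2)[OF X] and cc = smooth_atlas_chart[OF smooth_manifoldD(2)[OF X] c]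
  have "continuous_map (top_of_set (snd c ` fst c)) (manifold_topology X) (chart_inv c)"
    unfolding continuous_map_def
  proof (intro conjI allI impI)
    show "chart_inv c \<in> topspace (top_of_set (snd c ` fst c)) \<rightarrow> topspace (manifold_topology X)"
      using cc chart_inv_coord[OF cc(2)] by (auto simp: topspace_manifold_topology[OF at])
    fix U assume "openin (manifold_topology X) U"
    then have "open (snd c ` (fst c \<inter> U))" using c by (simp add: openin_manifold_topology[OF at])
    moreover have "{x \<in> topspace (top_of_set (snd c ` fst c)). chart_inv c x \<in> U} = snd c ` (fst c \<inter> U)"
      using chart_inv_coord[OF cc(2)] by auto
    ultimately show "openin (top_of_set (snd c ` fst c))
        {x \<in> topspace (top_of_set (snd c ` fst c)). chart_inv c x \<in> U}"
      using cc(3) by (auto simp: openin_open_eq)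
  qed
  then show "compactin (manifold_topology X) (chart_inv c ` K)"
    by (rule image_compactin[rotated]) (use K in \<open>simp add: compactin_subtopology\<close>)
qed

text \<open>The coordinate in the trivialisation is prescribed as a bump function at
  \<open>y\<close> times \<open>k\<close>, and the section is extended by zero. It is zero off a
  closed set inside the trivialised chart domain, so it is zero near every point outside that
  domain.\<close>

lemma exists_nonvanishing_section:
  fixes E :: "('e, 't::real_normed_vector, 'p, 'a::real_normed_vector, 'k::real_normed_vector) vbundle"
    and k :: 'k
  assumes E: "vector_bundle E" and W: "(W, \<Phi>) \<in> vb_trivs E" "y \<in> W" and k: "k \<noteq> 0"
  shows "\<exists>v\<in>sections E. \<Phi> (v y) \<noteq> 0"
proof -
  note E' = vector_bundleD[OF E]
  note triv = E'(9)[OF W(1)]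
  note Wop = local_trivialisation_open[OF E'(4) triv]
  have N: "smooth_manifold (vb_base E)" using E by (simp add: vector_bundle_def)
  have "y \<in> pts (vb_base E)" using W(2) Wop(1) by blast
  then obtain c where c: "c \<in> charts (vb_base E)" "y \<in> fst c"
    using smooth_atlas_cover[OF E'(4)] by metis
  note cc = smooth_atlas_chart[OF E'(4) c(1)]
  let ?U = "snd c ` (fst c \<inter> W)"
  obtain \<beta> :: "'a \<Rightarrow> real" and K where \<beta>: "smooth_on UNIV \<beta>" "\<beta> (snd c y) \<noteq> 0"
    and K: "compact K" "K \<subseteq> ?U" "\<And>x. \<beta> x \<noteq> 0 \<Longrightarrow> x \<in> K"
    using bump_function[OF E'(3) Wop(2)[OF c(1)], of "snd c y"] c(2) W(2) by blast
  let ?C = "chart_inv c ` K"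
  have C: "?C \<subseteq> fst c \<inter> W" using K(2) chart_inv_coord[OF cc(2)] by auto
  have "closedin (manifold_topology (vb_base E)) ?C"
    by (rule closedin_chart_compact[OF N c(1) K(1)]) (use K(2) in blast)
  then have opC: "openin (manifold_topology (vb_base E)) (pts (vb_base E) - ?C)"
    by (simp add: closedin_def topspace_manifold_topology[OF E'(4)])
  define v where "v = (\<lambda>q\<in>pts (vb_base E). if q \<in> fst c \<inter> W
    then inv_into (fibre E q) \<Phi> (\<beta> (snd c q) *\<^sub>R k) else vb_zero E q)"
  have bij: "bij_betw \<Phi> (fibre E q) UNIV" if "q \<in> W" for q
    using local_trivialisation_bij[OF E'(4) triv that] .
  have v_in: "v q \<in> fibre E q \<and> \<Phi> (v q) = \<beta> (snd c q) *\<^sub>R k" if "q \<in> fst c \<inter> W" for q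
  proof -
    have "\<beta> (snd c q) *\<^sub>R k \<in> \<Phi> ` fibre E q" using bij[of q] that by (simp add: bij_betw_def)
    moreover have "q \<in> pts (vb_base E)" using that Wop(1) by blast
    ultimately show ?thesis
      using that by (simp add: v_def inv_into_into f_inv_into_f)
  qed
  \<comment> \<open>At points of the domain off \<open>?C\<close> the bump function vanishes, so
    both branches of the definition give the zero vector there.\<close>
  have v_out: "v q = vb_zero E q" if q: "q \<in> pts (vb_base E)" "q \<notin> ?C" for q
  proof (cases "q \<in> fst c \<inter> W")
    case True
    have "\<beta> (snd c q) = 0"
      using K(3)[of "snd c q"] q(2) chart_inv_coord[OF cc(2), of q] True by force
    then have "\<Phi> (v q) = \<Phi> (vb_zero E q)"
      using v_in[OF True] local_trivialisation_linear(1)[OF triv, of q] True by simp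
    then show ?thesis
      using bij[of q] v_in[OF True] E'(6)[OF q(1)] True by (auto simp: bij_betw_def inj_on_def)
  qed (use q in \<open>auto simp: v_def\<close>)
  have "v \<in> sections E"
  proof (rule sectionI[OF E])
    show "v \<in> extensional (pts (vb_base E))" by (simp add: v_def)
    show "v x \<in> fibre E x" if "x \<in> pts (vb_base E)" for x
      using v_in[of x] v_out[OF that] E'(6)[OF that] C by (metis subsetD)
    fix p assume p: "p \<in> pts (vb_base E)"
    show "\<exists>W \<Phi> d. (W, \<Phi>) \<in> vb_trivs E \<and> d \<in> charts (vb_base E) \<and> p \<in> W \<and>
        loc_smooth d vec_chart (\<lambda>x. \<Phi> (v x)) p"
    proof (cases "p \<in> fst c \<inter> W")
      case True
      have "loc_smooth c vec_chart (\<lambda>q. \<beta> (snd c q) *\<^sub>R k) p"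
        using True
        by (intro loc_smooth_scaleR loc_smooth_smooth_on[OF E'(3) loc_smooth_chart \<beta>(1) open_UNIV]
            loc_smooth_const) (auto simp: vec_chart_def)
      then have "loc_smooth c vec_chart (\<lambda>x. \<Phi> (v x)) p"
      proof (rule loc_smooth_cong[OF _ Wop(2)[OF c(1)]])
        fix q assume "q \<in> fst c" "snd c q \<in> ?U"
        then have "q \<in> fst c \<inter> W" using cc(2) by (auto dest: inj_onD)
        then show "\<beta> (snd c q) *\<^sub>R k = \<Phi> (v q)" using v_in by simp
      qed (use True in blast)
      then show ?thesis using W(1) c(1) True by blast
    next
      case False
      obtain W' \<Phi>' where W': "(W', \<Phi>') \<in> vb_trivs E" "p \<in> W'"
        using vector_bundle_triv[OF E p] by metis
      obtain d where d: "d \<in> charts (vb_base E)" "p \<in> fst d"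
        using smooth_atlas_cover[OF E'(4) p] by metis
      note triv' = E'(9)[OF W'(1)] and dc = smooth_atlas_chart[OF E'(4) d(1)]
      let ?V = "W' \<inter> (pts (vb_base E) - ?C)"
      have "openin (manifold_topology (vb_base E)) W'"
        using triv' by (simp add: local_trivialisation_def)
      then have "openin (manifold_topology (vb_base E)) ?V" using opC by (rule openin_Int)
      then have op: "open (snd d ` (fst d \<inter> ?V))"
        using d(1) unfolding openin_manifold_topology[OF E'(4)] by blast
      have "loc_smooth d vec_chart (\<lambda>x. 0::'k) p"
        using d(2) by (intro loc_smooth_const) (auto simp: vec_chart_def)
      then have "loc_smooth d vec_chart (\<lambda>x. \<Phi>' (v x)) p"
      proof (rule loc_smooth_cong[OF _ op])
        show "snd d p \<in> snd d ` (fst d \<inter> ?V)" using False C W'(2) d(2) p by blast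
        fix q assume "q \<in> fst d" "snd d q \<in> snd d ` (fst d \<inter> ?V)"
        then have q: "q \<in> ?V" using inj_on_image_mem_iff[OF dc(2), of q "fst d \<inter> ?V"] by blast
        then show "0 = \<Phi>' (v q)"
          using v_out[of q] local_trivialisation_linear(1)[OF triv', of q] by simp
      qed
      then show ?thesis using W' d(1) by blast
    qed
  qed
  moreover have "\<Phi> (v y) \<noteq> 0" using v_in[of y] c(2) W(2) \<beta>(2) k by simp
  ultimately show ?thesis by blast
qed


section \<open>Tensoriality of the anchor\<close>

context gla
begin

lemma br_section: "u \<in> sections F \<Longrightarrow> v \<in> sections F \<Longrightarrow> br u v \<in> sections F"
  using gla by (simp add: gen_lie_algebroid_def lie_bracket_on_def)

lemma br_add:
  assumes "u \<in> sections F" "v \<in> sections F" "w \<in> sections F"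
  shows "br (sec_add F u v) w = sec_add F (br u w) (br v w)"
    "br w (sec_add F u v) = sec_add F (br w u) (br w v)"
  using gla assms by (simp_all add: gen_lie_algebroid_def lie_bracket_on_def)

lemma br_self: "u \<in> sections F \<Longrightarrow> br u u = sec_zero F"
  using gla by (simp add: gen_lie_algebroid_def lie_bracket_on_def)

lemma br_leibniz:
  assumes "u \<in> sections F" "v \<in> sections F" "f \<in> smooth_funs N"
  shows "br u (sec_mult F f v) = sec_add F (sec_mult F f (br u v)) (sec_mult F (A u f) v)"
  using gla assms by (simp add: gen_lie_algebroid_def)

lemmas closed = sec_add_section[OF vb] sec_mult_section[OF vb] br_section act_smooth

section \<open>The bracket in the coordinates of one fibre\<close>

context
  fixes W \<Phi> y
  assumes W: "(W, \<Phi>) \<in> vb_trivs F" "y \<in> W"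
begin

private lemma yN: "y \<in> pts N"
  using local_trivialisation_open(1)[OF vbD(4) vbD(9)[OF W(1)]] W(2) by blast

private lemma coord:
  assumes "u \<in> sections F"
  shows "v \<in> sections F \<Longrightarrow> \<Phi> (sec_add F u v y) = \<Phi> (u y) + \<Phi> (v y)"
    "\<Phi> (sec_mult F f u y) = f y *\<^sub>R \<Phi> (u y)" "\<Phi> (sec_zero F y) = 0"
  using local_trivialisation_linear[OF vbD(9)[OF W(1)] W(2)] section_fibre[OF _ yN] yN assms
  by (simp_all add: sec_add_def sec_mult_def sec_zero_def)

text \<open>Polarisation of \<open>[u + v, u + v] = 0\<close>. Passing to \<open>\<Phi>\<close> at
  \<open>y\<close> places the identity in the vector space \<open>'k\<close>, where terms can be
  cancelled.\<close>

private lemma coord_br_swap: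
  assumes u: "u \<in> sections F" and v: "v \<in> sections F"
  shows "\<Phi> (br u v y) = - \<Phi> (br v u y)"
proof -
  have "\<Phi> (br (sec_add F u v) (sec_add F u v) y) = \<Phi> (br u v y) + \<Phi> (br v u y)"
    using u v by (simp add: br_add closed coord(1) coord(3)[OF u] br_self[OF u] br_self[OF v] sec_zero_section[OF vb])
  moreover have "\<Phi> (br (sec_add F u v) (sec_add F u v) y) = 0"
    unfolding br_self[OF closed(1)[OF u v]] by (rule coord(3)[OF u])
  ultimately show ?thesis by (simp add: eq_neg_iff_add_eq_0)
qed

text \<open>The rule for the first slot follows from the Leibniz rule in the second by exchanging
  the arguments before and after.\<close>

private lemma coord_br_mult:
  assumes u: "u \<in> sections F" and v: "v \<in> sections F" and f: "f \<in> smooth_funs N"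
  shows "\<Phi> (br u (sec_mult F f v) y) = f y *\<^sub>R \<Phi> (br u v y) + A u f y *\<^sub>R \<Phi> (v y)"
    "\<Phi> (br (sec_mult F f u) v y) = f y *\<^sub>R \<Phi> (br u v y) - A v f y *\<^sub>R \<Phi> (u y)"
proof -
  have *: "\<Phi> (br u (sec_mult F f v) y) = f y *\<^sub>R \<Phi> (br u v y) + A u f y *\<^sub>R \<Phi> (v y)"
    if "u \<in> sections F" "v \<in> sections F" for u v
    using that f by (simp add: br_leibniz coord(1,2) closed)
  show "\<Phi> (br u (sec_mult F f v) y) = f y *\<^sub>R \<Phi> (br u v y) + A u f y *\<^sub>R \<Phi> (v y)"
    using *[OF u v] .
  show "\<Phi> (br (sec_mult F f u) v y) = f y *\<^sub>R \<Phi> (br u v y) - A v f y *\<^sub>R \<Phi> (u y)"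
    using *[OF v u] coord_br_swap[OF closed(2)[OF f u] v] coord_br_swap[OF u v] by simp
qed

text \<open>Expand \<open>[f u, g v]\<close> in both possible orders.\<close>

lemma shift_relation:
  assumes u: "u \<in> sections F" and v: "v \<in> sections F" and f: "f \<in> smooth_funs N" and g: "g \<in> smooth_funs N"
  shows "((f (shift y) - f y) * A u g y) *\<^sub>R \<Phi> (v y) + ((g (shift y) - g y) * A v f y) *\<^sub>R \<Phi> (u y) = 0"
proof -
  have "\<Phi> (br (sec_mult F f u) (sec_mult F g v) y) =
      g y *\<^sub>R (f y *\<^sub>R \<Phi> (br u v y) - A v f y *\<^sub>R \<Phi> (u y)) + (f (shift y) * A u g y) *\<^sub>R \<Phi> (v y)"
    using u v f g by (simp add: coord_br_mult closed act_sec_mult_shift[OF _ yN])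
  \<comment> \<open>Here the first slot is expanded before the second, so \<open>shift\<close> falls
    on \<open>g\<close> instead of \<open>f\<close>. The \<open>br u v\<close> terms agree in both
    expansions; what is left measures the failure of linearity of the anchor.\<close>
  moreover have "\<Phi> (br (sec_mult F f u) (sec_mult F g v) y) =
      f y *\<^sub>R (g y *\<^sub>R \<Phi> (br u v y) + A u g y *\<^sub>R \<Phi> (v y)) - (g (shift y) * A v f y) *\<^sub>R \<Phi> (u y)"
    using coord_br_mult(2)[OF u closed(2)[OF g v] f] u v f g
    by (simp add: coord_br_mult closed act_sec_mult_shift[OF _ yN])
  ultimately show ?thesis by (simp add: algebra_simps)
qed

end

text \<open>\<open>act_sec_mult_shift\<close> produces \<open>g (shift y)\<close>, so only the case
  where this differs from \<open>g y\<close> is at stake. In that case the action at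
  \<open>y\<close> vanishes and both sides are 0.\<close>

lemma act_sec_mult:
  assumes u: "u \<in> sections F" and f: "f \<in> smooth_funs N" and g: "g \<in> smooth_funs N" and y: "y \<in> pts N"
  shows "A (sec_mult F g u) f y = g y * A u f y"
proof (cases "g (shift y) = g y")
  case True
  then show ?thesis using act_sec_mult_shift[OF u y f] by simp
next
  case False
  have "A u f y = 0"
  proof (cases "\<exists>k::'k. k \<noteq> 0")
    case True
    obtain W \<Phi> where W: "(W, \<Phi>) \<in> vb_trivs F" "y \<in> W"
      using vector_bundle_triv[OF vb y] by metis
    obtain v where v: "v \<in> sections F" "\<Phi> (v y) \<noteq> 0"
      using True exists_nonvanishing_section[OF vb W] by blast
    \<comment> \<open>With both sections equal to \<open>v\<close> and both functions equal to
      \<open>g\<close>, the relation is twice \<open>(g (shift y) - g y) * A v g y\<close> times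
      \<open>\<Phi> (v y)\<close>.\<close>
    have "A v g y = 0"
      using shift_relation[OF W v(1) v(1) g g] v(2) False
      by (simp flip: scaleR_add_left)
    \<comment> \<open>In this instance the second summand carries the factor \<open>A v g y\<close>,
      just shown to be 0, so the first one vanishes too.\<close>
    then show ?thesis
      using shift_relation[OF W u v(1) g f] v(2) False by simp
  next
    case False
    \<comment> \<open>The type fibre is zero here, so every section equals 0 times itself, and the
      action pulls out the scalar 0.\<close>
    have "sec_mult F (\<lambda>_. 0) u = u"
    proof
      fix x
      show "sec_mult F (\<lambda>_. 0) u x = u x"
      proof (cases "x \<in> pts N")
        case True
        obtain W \<Phi> where W: "(W, \<Phi>) \<in> vb_trivs F" "x \<in> W"
          using vector_bundle_triv[OF vb True] by metis
        have "inj_on \<Phi> (fibre F x)"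
          using local_trivialisation_bij[OF vbD(4) vbD(9)[OF W(1)] W(2)] by (simp add: bij_betw_def)
        moreover have "\<Phi> (vb_scale F 0 (u x)) = \<Phi> (u x)" using \<open>\<not> (\<exists>k::'k. k \<noteq> 0)\<close> by metis
        ultimately show ?thesis
          using True section_fibre[OF u True] vbD(8)[OF True] by (simp add: sec_mult_def inj_on_def)
      next
        case False
        then show ?thesis using u by (simp add: sec_mult_def sections_def extensional_def)
      qed
    qed
    then show ?thesis using act_sec_mult_shift[OF u y f, of "\<lambda>_. 0"] by simp
  qed
  then show ?thesis using act_sec_mult_shift[OF u y f] by simp
qed

end


section \<open>Alternating forms\<close>

lemma tuples_Cons [simp]: "z # zs \<in> tuples E (Suc q) \<longleftrightarrow> z \<in> sections E \<and> zs \<in> tuples E q"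
  by (auto simp: tuples_def)

lemma tuples_0: "tuples E 0 = {[]}"
  by (auto simp: tuples_def)

lemma tuples_SucE:
  assumes "zs \<in> tuples E (Suc q)"
  obtains z zs' where "zs = z # zs'" "z \<in> sections E" "zs' \<in> tuples E q"
  using assms by (cases zs) (auto simp: tuples_def)

lemma tuples_length: "zs \<in> tuples E q \<Longrightarrow> length zs = q"
  by (simp add: tuples_def)

lemma tuples_nth: "zs \<in> tuples E q \<Longrightarrow> i < q \<Longrightarrow> zs ! i \<in> sections E"
  by (auto simp: tuples_def)

lemma tuples_update: "zs \<in> tuples E q \<Longrightarrow> u \<in> sections E \<Longrightarrow> zs[i := u] \<in> tuples E q"
  using set_update_subset_insert[of zs i u] by (auto simp: tuples_def)

lemma tuples_permute: "zs \<in> tuples E q \<Longrightarrow> \<sigma> permutes {..<q} \<Longrightarrow> permute_list \<sigma> zs \<in> tuples E q"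
  by (auto simp: tuples_def)

lemma tuples_omit: "zs \<in> tuples E (Suc q) \<Longrightarrow> i \<le> q \<Longrightarrow> omit i zs \<in> tuples E q"
  using set_take_subset[of i zs] set_drop_subset[of "Suc i" zs] by (auto simp: tuples_def omit_def)

lemma omit_Cons [simp]: "omit 0 (z # zs) = zs" "omit (Suc i) (z # zs) = z # omit i zs"
  by (simp_all add: omit_def)

section \<open>Permutations generated by adjacent exchanges\<close>

lemma permute_list_adjacent:
  "permute_list (Transposition.transpose (length xs) (Suc (length xs))) (xs @ u # v # ys) = xs @ v # u # ys"
proof (rule nth_equalityI)
  fix i assume "i < length (permute_list (Transposition.transpose (length xs) (Suc (length xs))) (xs @ u # v # ys))"
  then have i: "i < length (xs @ u # v # ys)" by simp
  have perm: "Transposition.transpose (length xs) (Suc (length xs)) permutes {..<length (xs @ u # v # ys)}"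
    by (intro permutes_swap_id) auto
  consider "i < length xs" | "i = length xs" | "i = Suc (length xs)" | k where "i = Suc (Suc (length xs)) + k"
    by (metis add.commute less_iff_Suc_add linorder_neqE_nat not_less_eq add_Suc_right add_Suc)
  then show "permute_list (Transposition.transpose (length xs) (Suc (length xs))) (xs @ u # v # ys) ! i = (xs @ v # u # ys) ! i"
    unfolding permute_list_nth[OF perm i]
    by cases (use i in \<open>auto simp: transpose_def nth_append\<close>)
qed simp

lemma permute_list_update:
  assumes "\<sigma> permutes {..<length zs}"
  shows "(permute_list \<sigma> zs)[i := w] = permute_list \<sigma> (zs[\<sigma> i := w])"
proof (rule nth_equalityI)
  fix k assume "k < length ((permute_list \<sigma> zs)[i := w])"
  then have k: "k < length zs" by simp
  then have "\<sigma> k < length zs" "\<sigma> k = \<sigma> i \<longleftrightarrow> k = i"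
    using permutes_in_image[OF assms] permutes_inj[OF assms] by (auto dest: injD)
  then show "(permute_list \<sigma> zs)[i := w] ! k = permute_list \<sigma> (zs[\<sigma> i := w]) ! k"
    using k assms by (cases "k = i") (simp_all add: permute_list_nth)
qed simp

text \<open>The exchange of \<open>a\<close> and \<open>Suc b\<close> is that of \<open>b\<close>
  and \<open>Suc b\<close> conjugated by that of \<open>a\<close> and \<open>b\<close>: three sign
  changes amount to one.\<close>

lemma alternating_transpose:
  fixes \<omega> :: "'z list \<Rightarrow> real"
  assumes swap: "\<And>xs u v ys. length (xs @ u # v # ys) = q \<Longrightarrow> set (xs @ u # v # ys) \<subseteq> S \<Longrightarrow>
      \<omega> (xs @ u # v # ys) = - \<omega> (xs @ v # u # ys)"
    and "a < b" "b < q" "length zs = q" "set zs \<subseteq> S"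
  shows "\<omega> (permute_list (Transposition.transpose a b) zs) = - \<omega> zs"
  using assms(2-)
proof (induction b arbitrary: zs)
  case (Suc b)
  have adj: "\<omega> (permute_list (Transposition.transpose b (Suc b)) zs) = - \<omega> zs"
    if "length zs = q" "set zs \<subseteq> S" for zs
  proof -
    have eq: "zs = take b zs @ zs ! b # zs ! Suc b # drop (Suc (Suc b)) zs" (is "_ = ?r")
      using Suc.prems that by (metis Cons_nth_drop_Suc Suc_lessD append_take_drop_id)
    have "length (take b zs) = b" using Suc.prems that by simp
    then have "permute_list (Transposition.transpose b (Suc b)) ?r = take b zs @ zs ! Suc b # zs ! b # drop (Suc (Suc b)) zs"
      using permute_list_adjacent[of "take b zs"] by simp
    moreover have "\<omega> ?r = - \<omega> (take b zs @ zs ! Suc b # zs ! b # drop (Suc (Suc b)) zs)"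
      by (rule swap) (use that eq in auto)
    ultimately show ?thesis using eq by (metis minus_equation_iff)
  qed
  show ?case
  proof (cases "a = b")
    case False
    then have ab: "a < b" "b < q" using Suc.prems by auto
    have perm: "Transposition.transpose a b permutes {..<length zs}" if "length zs = q" for zs :: "'z list"
      using that ab by (intro permutes_swap_id) auto
    have perm': "Transposition.transpose b (Suc b) permutes {..<length zs}" if "length zs = q" for zs :: "'z list"
      using that Suc.prems by (intro permutes_swap_id) auto
    have "permute_list (Transposition.transpose a (Suc b)) zs =
        permute_list (Transposition.transpose a b) (permute_list (Transposition.transpose b (Suc b)) (permute_list (Transposition.transpose a b) zs))"
      using Suc.prems perm perm'
      by (simp add: transpose_comp_triple[of a "Suc b" b, symmetric] permute_list_compose)
    then show ?thesis
      using Suc.IH[OF ab] adj Suc.prems perm perm' by simp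
  qed (use adj Suc.prems in simp)
qed simp

text \<open>A permutation of \<open>{..<q}\<close> is a product of transpositions, each contributing
  a factor -1. The induction varies \<open>zs\<close>, since the remaining factors act on the list
  already exchanged.\<close>

lemma alternating_permute:
  fixes \<omega> :: "'z list \<Rightarrow> real"
  assumes swap: "\<And>xs u v ys. length (xs @ u # v # ys) = q \<Longrightarrow> set (xs @ u # v # ys) \<subseteq> S \<Longrightarrow>
      \<omega> (xs @ u # v # ys) = - \<omega> (xs @ v # u # ys)"
    and "\<sigma> permutes {..<q}" "length zs = q" "set zs \<subseteq> S"
  shows "\<omega> (permute_list \<sigma> zs) = of_int (sign \<sigma>) * \<omega> zs"
  using assms(2) finite_lessThan[of q] assms(3-)
proof (induction arbitrary: zs rule: permutes_induct)
  case (swap a b p)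
  have perm: "Transposition.transpose a b permutes {..<q}"
    using swap.hyps by (intro permutes_swap_id)
  have tr: "\<omega> (permute_list (Transposition.transpose a b) zs) = - \<omega> zs"
  proof (cases "a < b")
    case True
    then show ?thesis using alternating_transpose[where \<omega> = \<omega> and q = q and S = S, OF assms(1)] swap by simp
  next
    case False
    then have "b < a" using swap.hyps by simp
    then show ?thesis
      using alternating_transpose[where \<omega> = \<omega> and q = q and S = S, OF assms(1), of b a zs] swap by (simp add: transpose_commute)
  qed
  have "\<omega> (permute_list (Transposition.transpose a b \<circ> p) zs) = \<omega> (permute_list p (permute_list (Transposition.transpose a b) zs))"
    using swap by (simp add: permute_list_compose)
  also have "\<dots> = of_int (sign p) * \<omega> (permute_list (Transposition.transpose a b) zs)"
    using swap perm by simp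
  also have "\<dots> = of_int (sign (Transposition.transpose a b \<circ> p)) * \<omega> zs"
    using swap perm by (simp add: tr sign_compose sign_swap_id permutation_swap_id
        permutes_imp_permutation[OF finite_lessThan])
  finally show ?case .
qed simp

section \<open>Rules for forms and interior products\<close>

lemma form_smooth: "\<omega> \<in> forms E q \<Longrightarrow> zs \<in> tuples E q \<Longrightarrow> \<omega> zs \<in> smooth_funs (vb_base E)"
  by (auto simp: forms_def PiE_iff)

lemma form_extensional: "\<omega> \<in> forms E q \<Longrightarrow> \<omega> \<in> extensional (tuples E q)"
  by (auto simp: forms_def PiE_iff)

lemma smooth_funs_extensional: "f \<in> smooth_funs X \<Longrightarrow> f \<in> extensional (pts X)"
  by (simp add: smooth_funs_def)

lemma form_eqI:
  assumes "\<omega> \<in> forms E q" "\<theta> \<in> forms E q"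
    "\<And>zs x. zs \<in> tuples E q \<Longrightarrow> x \<in> pts (vb_base E) \<Longrightarrow> \<omega> zs x = \<theta> zs x"
  shows "\<omega> = \<theta>"
proof (rule extensionalityI[OF form_extensional[OF assms(1)] form_extensional[OF assms(2)]])
  fix zs assume zs: "zs \<in> tuples E q"
  show "\<omega> zs = \<theta> zs"
    by (rule extensionalityI[OF smooth_funs_extensional[OF form_smooth[OF assms(1) zs]]
          smooth_funs_extensional[OF form_smooth[OF assms(2) zs]] assms(3)[OF zs]])
qed

lemma form_slot_add:
  "\<omega> \<in> forms E q \<Longrightarrow> zs \<in> tuples E q \<Longrightarrow> i < q \<Longrightarrow> u \<in> sections E \<Longrightarrow> v \<in> sections E \<Longrightarrow>
   x \<in> pts (vb_base E) \<Longrightarrow> \<omega> (zs[i := sec_add E u v]) x = \<omega> (zs[i := u]) x + \<omega> (zs[i := v]) x"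
  by (simp add: forms_def)

lemma form_slot_mult:
  "\<omega> \<in> forms E q \<Longrightarrow> zs \<in> tuples E q \<Longrightarrow> i < q \<Longrightarrow> f \<in> smooth_funs (vb_base E) \<Longrightarrow>
   u \<in> sections E \<Longrightarrow> x \<in> pts (vb_base E) \<Longrightarrow> \<omega> (zs[i := sec_mult E f u]) x = f x * \<omega> (zs[i := u]) x"
  by (simp add: forms_def)

lemma form_permute:
  "\<omega> \<in> forms E q \<Longrightarrow> zs \<in> tuples E q \<Longrightarrow> \<sigma> permutes {..<q} \<Longrightarrow> x \<in> pts (vb_base E) \<Longrightarrow>
   \<omega> (permute_list \<sigma> zs) x = of_int (sign \<sigma>) * \<omega> zs x"
  by (simp add: forms_def)

lemma form_Cons_add:
  assumes "\<omega> \<in> forms E (Suc q)" "zs \<in> tuples E q" "u \<in> sections E" "v \<in> sections E" "x \<in> pts (vb_base E)"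
  shows "\<omega> (sec_add E u v # zs) x = \<omega> (u # zs) x + \<omega> (v # zs) x"
  using form_slot_add[OF assms(1), of "u # zs" 0 u v x] assms by simp

lemma form_swap:
  assumes "\<omega> \<in> forms E q" "xs @ u # v # ys \<in> tuples E q" "x \<in> pts (vb_base E)"
  shows "\<omega> (xs @ u # v # ys) x = - \<omega> (xs @ v # u # ys) x"
proof -
  let ?\<tau> = "Transposition.transpose (length xs) (Suc (length xs))"
  have "?\<tau> permutes {..<q}"
    using assms(2) by (intro permutes_swap_id) (auto simp: tuples_def)
  from form_permute[OF assms(1,2) this assms(3)] show ?thesis
    by (simp add: permute_list_adjacent sign_swap_id)
qed

lemma formsI:
  assumes "\<omega> \<in> extensional (tuples E q)"
    "\<And>zs. zs \<in> tuples E q \<Longrightarrow> \<omega> zs \<in> smooth_funs (vb_base E)"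
    "\<And>zs i u v x. zs \<in> tuples E q \<Longrightarrow> i < q \<Longrightarrow> u \<in> sections E \<Longrightarrow> v \<in> sections E \<Longrightarrow>
       x \<in> pts (vb_base E) \<Longrightarrow> \<omega> (zs[i := sec_add E u v]) x = \<omega> (zs[i := u]) x + \<omega> (zs[i := v]) x"
    "\<And>zs i f u x. zs \<in> tuples E q \<Longrightarrow> i < q \<Longrightarrow> f \<in> smooth_funs (vb_base E) \<Longrightarrow> u \<in> sections E \<Longrightarrow>
       x \<in> pts (vb_base E) \<Longrightarrow> \<omega> (zs[i := sec_mult E f u]) x = f x * \<omega> (zs[i := u]) x"
    "\<And>zs \<sigma> x. zs \<in> tuples E q \<Longrightarrow> \<sigma> permutes {..<q} \<Longrightarrow> x \<in> pts (vb_base E) \<Longrightarrow>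
       \<omega> (permute_list \<sigma> zs) x = of_int (sign \<sigma>) * \<omega> zs x"
  shows "\<omega> \<in> forms E q"
  unfolding forms_def mem_Collect_eq PiE_iff
  by (intro conjI ballI allI impI assms(1); (rule assms(2-5); assumption))

text \<open>Reduces alternation to exchanges of neighbours, the shape in which it can be proved by
  splitting off the first list entry.\<close>

lemma formsI_swap:
  assumes "\<omega> \<in> extensional (tuples E q)"
    "\<And>zs. zs \<in> tuples E q \<Longrightarrow> \<omega> zs \<in> smooth_funs (vb_base E)"
    "\<And>zs i u v x. zs \<in> tuples E q \<Longrightarrow> i < q \<Longrightarrow> u \<in> sections E \<Longrightarrow> v \<in> sections E \<Longrightarrow>
       x \<in> pts (vb_base E) \<Longrightarrow> \<omega> (zs[i := sec_add E u v]) x = \<omega> (zs[i := u]) x + \<omega> (zs[i := v]) x"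
    "\<And>zs i f u x. zs \<in> tuples E q \<Longrightarrow> i < q \<Longrightarrow> f \<in> smooth_funs (vb_base E) \<Longrightarrow> u \<in> sections E \<Longrightarrow>
       x \<in> pts (vb_base E) \<Longrightarrow> \<omega> (zs[i := sec_mult E f u]) x = f x * \<omega> (zs[i := u]) x"
    and swap: "\<And>xs u v ys x. xs @ u # v # ys \<in> tuples E q \<Longrightarrow> x \<in> pts (vb_base E) \<Longrightarrow>
       \<omega> (xs @ u # v # ys) x = - \<omega> (xs @ v # u # ys) x"
  shows "\<omega> \<in> forms E q"
proof (rule formsI[OF assms(1-4)])
  fix zs \<sigma> x assume *: "zs \<in> tuples E q" "\<sigma> permutes {..<q}" "x \<in> pts (vb_base E)"
  show "\<omega> (permute_list \<sigma> zs) x = of_int (sign \<sigma>) * \<omega> zs x"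
  proof (rule alternating_permute[where \<omega> = "\<lambda>zs. \<omega> zs x" and S = "sections E" and q = q])
    fix xs u v ys
    assume "length (xs @ u # v # ys) = q" "set (xs @ u # v # ys) \<subseteq> sections E"
    then have "xs @ u # v # ys \<in> tuples E q" unfolding tuples_def by blast
    then show "\<omega> (xs @ u # v # ys) x = - \<omega> (xs @ v # u # ys) x" using *(3) by (rule swap)
  qed (use * in \<open>simp_all add: tuples_def\<close>)
qed

text \<open>Moving the entry at position \<open>j\<close> to the front costs \<open>j\<close> adjacent exchanges.\<close>

lemma form_insert:
  assumes \<omega>: "\<omega> \<in> forms E (Suc q)" and w: "w \<in> sections E" and ys: "ys \<in> tuples E q"
    and x: "x \<in> pts (vb_base E)" and "j \<le> q"
  shows "\<omega> (take j ys @ w # drop j ys) x = (-1) ^ j * \<omega> (w # ys) x"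
  using assms(5)
proof (induction j)
  case (Suc j)
  have j: "j < length ys" using Suc.prems ys by (simp add: tuples_length)
  have set: "set (take j ys) \<subseteq> set ys" "set (drop (Suc j) ys) \<subseteq> set ys" "ys ! j \<in> set ys"
    using j by (auto dest: in_set_takeD in_set_dropD)
  have "take (Suc j) ys @ w # drop (Suc j) ys = take j ys @ ys ! j # w # drop (Suc j) ys"
    using j by (simp add: take_Suc_conv_app_nth)
  moreover have "\<omega> (take j ys @ ys ! j # w # drop (Suc j) ys) x = - \<omega> (take j ys @ w # ys ! j # drop (Suc j) ys) x"
    by (rule form_swap[OF \<omega> _ x]) (use j w ys set in \<open>auto simp: tuples_def\<close>)
  moreover have "ys ! j # drop (Suc j) ys = drop j ys" using j by (rule Cons_nth_drop_Suc)
  ultimately show ?case using Suc by simp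
qed simp

text \<open>Moves an entry from the front into the gap left by the omitted one; this turns bracket
  terms of \<open>ext_d\<close> into bracket terms of \<open>lie_deriv\<close>.\<close>

lemma form_omit:
  assumes \<omega>: "\<omega> \<in> forms E (Suc q)" and w: "w \<in> sections E" and zs: "zs \<in> tuples E (Suc q)"
    and x: "x \<in> pts (vb_base E)" and j: "j \<le> q"
  shows "\<omega> (w # omit j zs) x = (-1) ^ j * \<omega> (zs[j := w]) x"
proof -
  have "j < length zs" using j zs by (simp add: tuples_length)
  then have "take j (omit j zs) @ w # drop j (omit j zs) = zs[j := w]"
    by (simp add: omit_def upd_conv_take_nth_drop)
  then have "\<omega> (zs[j := w]) x = (-1) ^ j * \<omega> (w # omit j zs) x"
    using form_insert[OF \<omega> w tuples_omit[OF zs j] x j] by simp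
  then show ?thesis by (simp flip: mult.assoc power_add)
qed

lemma int_prod_apply: "zs \<in> tuples E q \<Longrightarrow> int_prod E z q \<omega> zs = \<omega> (z # zs)"
  by (simp add: int_prod_def)

context
  fixes E :: "('e, 't::real_normed_vector, 'p, 'a::real_normed_vector, 'k::real_normed_vector) vbundle"
  assumes E: "vector_bundle E"
begin

lemma int_prod_form:
  assumes \<omega>: "\<omega> \<in> forms E (Suc q)" and z: "z \<in> sections E"
  shows "int_prod E z q \<omega> \<in> forms E q"
proof (rule formsI_swap)
  show "int_prod E z q \<omega> \<in> extensional (tuples E q)" by (simp add: int_prod_def)
  fix xs u v ys x assume *: "xs @ u # v # ys \<in> tuples E q" "x \<in> pts (vb_base E)"
  then have "xs @ v # u # ys \<in> tuples E q" by (auto simp: tuples_def)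
  then show "int_prod E z q \<omega> (xs @ u # v # ys) x = - int_prod E z q \<omega> (xs @ v # u # ys) x"
    using form_swap[OF \<omega>, of "z # xs" u v ys x] * z by (simp add: int_prod_apply)
next
  fix zs i u v x
  assume *: "zs \<in> tuples E q" "i < q" "u \<in> sections E" "v \<in> sections E" "x \<in> pts (vb_base E)"
  then show "int_prod E z q \<omega> (zs[i := sec_add E u v]) x = int_prod E z q \<omega> (zs[i := u]) x + int_prod E z q \<omega> (zs[i := v]) x"
    using form_slot_add[OF \<omega>, of "z # zs" "Suc i" u v x] z
    by (simp add: int_prod_apply tuples_update sec_add_section[OF E])
next
  fix zs i f u x
  assume "zs \<in> tuples E q" "i < q" "f \<in> smooth_funs (vb_base E)" "u \<in> sections E" "x \<in> pts (vb_base E)"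
  then show "int_prod E z q \<omega> (zs[i := sec_mult E f u]) x = f x * int_prod E z q \<omega> (zs[i := u]) x"
    using form_slot_mult[OF \<omega>, of "z # zs" "Suc i" f u x] z
    by (simp add: int_prod_apply tuples_update sec_mult_section[OF E])
next
  fix zs assume "zs \<in> tuples E q"
  then show "int_prod E z q \<omega> zs \<in> smooth_funs (vb_base E)"
    using form_smooth[OF \<omega>, of "z # zs"] z by (simp add: int_prod_apply)
qed

lemma form_zero_form: "form_zero E q \<in> forms E q"
proof (rule formsI_swap)
  show "form_zero E q zs \<in> smooth_funs (vb_base E)" if "zs \<in> tuples E q" for zs
    using that smooth_funs_const[OF vector_bundleD(4)[OF E]] by (simp add: form_zero_def)
  fix xs u v ys x assume "xs @ u # v # ys \<in> tuples E q"
  moreover from this have "xs @ v # u # ys \<in> tuples E q" by (auto simp: tuples_def)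
  moreover assume "x \<in> pts (vb_base E)"
  ultimately show "form_zero E q (xs @ u # v # ys) x = - form_zero E q (xs @ v # u # ys) x"
    by (simp add: form_zero_def)
qed (simp_all add: form_zero_def tuples_update sec_add_section[OF E] sec_mult_section[OF E])

text \<open>The difference of two forms, as it occurs when Cartan's formula is solved for the
  interior product of \<open>d \<omega>\<close>.\<close>

lemma form_diff_form:
  assumes \<omega>: "\<omega> \<in> forms E q" and \<theta>: "\<theta> \<in> forms E q"
  shows "form_add E q \<omega> (form_scale E q (- 1) \<theta>) \<in> forms E q"
proof (rule formsI_swap)
  note at = vector_bundleD(4)[OF E]
  have eq: "form_add E q \<omega> (form_scale E q (- 1) \<theta>) zs = (\<lambda>x\<in>pts (vb_base E). \<omega> zs x + (\<lambda>x\<in>pts (vb_base E).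
      (\<lambda>x\<in>pts (vb_base E). - 1) x * \<theta> zs x) x)" if "zs \<in> tuples E q" for zs
    using that by (auto simp: form_add_def form_scale_def)
  show "form_add E q \<omega> (form_scale E q (- 1) \<theta>) zs \<in> smooth_funs (vb_base E)" if "zs \<in> tuples E q" for zs
    unfolding eq[OF that]
    by (intro smooth_funs_add smooth_funs_mult smooth_funs_const at form_smooth[OF \<omega> that] form_smooth[OF \<theta> that])
  fix xs u v ys x assume *: "xs @ u # v # ys \<in> tuples E q" "x \<in> pts (vb_base E)"
  moreover from this have "xs @ v # u # ys \<in> tuples E q" by (auto simp: tuples_def)
  ultimately show "form_add E q \<omega> (form_scale E q (- 1) \<theta>) (xs @ u # v # ys) x =
      - form_add E q \<omega> (form_scale E q (- 1) \<theta>) (xs @ v # u # ys) x"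
    using form_swap[OF \<omega> *] form_swap[OF \<theta> *] by (simp add: form_add_def form_scale_def)
qed (simp_all add: form_add_def form_scale_def tuples_update sec_add_section[OF E] sec_mult_section[OF E]
    form_slot_add[OF \<omega>] form_slot_add[OF \<theta>] form_slot_mult[OF \<omega>] form_slot_mult[OF \<theta>] algebra_simps)

end


section \<open>Lie derivative and exterior differential\<close>

lemma smooth_funs_diff:
  assumes "smooth_atlas X" "f \<in> smooth_funs X" "g \<in> smooth_funs X"
  shows "(\<lambda>x\<in>pts X. f x - g x) \<in> smooth_funs X"
proof -
  have "(\<lambda>x\<in>pts X. f x - g x) = (\<lambda>x\<in>pts X. f x + (\<lambda>x\<in>pts X. (\<lambda>x\<in>pts X. - 1) x * g x) x)"
    by auto
  also have "\<dots> \<in> smooth_funs X"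
    by (intro smooth_funs_add smooth_funs_mult smooth_funs_const assms)
  finally show ?thesis .
qed

lemma smooth_funs_sum:
  assumes "smooth_atlas X" "\<And>i. i \<in> I \<Longrightarrow> f i \<in> smooth_funs X"
  shows "(\<lambda>x\<in>pts X. \<Sum>i\<in>I. f i x) \<in> smooth_funs X"
  using assms(2)
proof (induction I rule: infinite_finite_induct)
  case (insert i I)
  have "(\<lambda>x\<in>pts X. \<Sum>i\<in>insert i I. f i x) = (\<lambda>x\<in>pts X. f i x + (\<lambda>x\<in>pts X. \<Sum>i\<in>I. f i x) x)"
    using insert.hyps by auto
  also have "\<dots> \<in> smooth_funs X"
    using insert by (intro smooth_funs_add assms(1)) auto
  finally show ?case .
qed (simp_all add: smooth_funs_const assms(1))

lemma smooth_fun_eq_restrict: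
  assumes "f \<in> smooth_funs X" "\<And>x. x \<in> pts X \<Longrightarrow> f x = g x"
  shows "f = (\<lambda>x\<in>pts X. g x)"
  using assms by (intro extensionalityI[OF smooth_funs_extensional]) auto

context gla
begin

abbreviation "L \<equiv> lie_deriv F A br"
abbreviation "d \<equiv> ext_d F A br"

lemma act_scale:
  assumes "z \<in> sections F" "f \<in> smooth_funs N" "x \<in> pts N"
  shows "A z (\<lambda>x\<in>pts N. r * f x) x = r * A z f x"
proof -
  have "(\<lambda>x\<in>pts N. r * f x) = (\<lambda>x\<in>pts N. (\<lambda>x\<in>pts N. r) x * f x)" by auto
  then show ?thesis
    using act_mult[OF assms(1,3) smooth_funs_const[OF vbD(4)] assms(2)] act_const[OF assms(1,3)] assms(3)
    by simp
qed

lemma lie_deriv_apply: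
  "zs \<in> tuples F q \<Longrightarrow> x \<in> pts N \<Longrightarrow>
   L z q \<omega> zs x = A z (\<omega> zs) x - (\<Sum>i<q. \<omega> (zs[i := br z (zs ! i)]) x)"
  by (simp add: lie_deriv_def)

lemma tuples_update_br:
  assumes "zs \<in> tuples F q" "z \<in> sections F" "i < q"
  shows "zs[i := br z (zs ! i)] \<in> tuples F q"
  using assms by (intro tuples_update br_section tuples_nth)

text \<open>For a factor \<open>f\<close> in slot \<open>i\<close>, the derivation rule for
  \<open>A z\<close> and the Leibniz rule for the bracket in that slot both produce
  \<open>A z f\<close> times the value of \<open>\<omega>\<close>, and these cancel in the
  difference. For a permutation the sum over the slots is reindexed.\<close>

lemma lie_deriv_form:
  assumes z: "z \<in> sections F" and \<omega>: "\<omega> \<in> forms F q"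
  shows "L z q \<omega> \<in> forms F q"
proof (rule formsI)
  show "L z q \<omega> \<in> extensional (tuples F q)" by (simp add: lie_deriv_def)
next
  fix zs assume zs: "zs \<in> tuples F q"
  have "L z q \<omega> zs = (\<lambda>x\<in>pts N. A z (\<omega> zs) x - (\<lambda>x\<in>pts N. \<Sum>i<q. \<omega> (zs[i := br z (zs ! i)]) x) x)"
    using zs by (auto simp: lie_deriv_def)
  also have "\<dots> \<in> smooth_funs N"
    by (intro smooth_funs_diff smooth_funs_sum vbD(4) act_smooth z form_smooth[OF \<omega>] zs
        tuples_update_br) auto
  finally show "L z q \<omega> zs \<in> smooth_funs N" .
next
  fix zs i u v x
  assume zs: "zs \<in> tuples F q" and i: "i < q" and u: "u \<in> sections F" and v: "v \<in> sections F"
    and x: "x \<in> pts N"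
  let ?T = "\<lambda>w. zs[i := w]"
  have T: "?T w \<in> tuples F q" if "w \<in> sections F" for w using tuples_update[OF zs that] .
  have "\<omega> (?T (sec_add F u v)) = (\<lambda>x\<in>pts N. \<omega> (?T u) x + \<omega> (?T v) x)"
    using form_slot_add[OF \<omega> zs i u v] closed(1)[OF u v]
    by (intro smooth_fun_eq_restrict[OF form_smooth[OF \<omega> T]])
  then have 1: "A z (\<omega> (?T (sec_add F u v))) x = A z (\<omega> (?T u)) x + A z (\<omega> (?T v)) x"
    using act_add[OF z x form_smooth[OF \<omega> T[OF u]] form_smooth[OF \<omega> T[OF v]]] by simp
  have 2: "\<omega> ((?T (sec_add F u v))[j := br z (?T (sec_add F u v) ! j)]) x =
      \<omega> ((?T u)[j := br z (?T u ! j)]) x + \<omega> ((?T v)[j := br z (?T v ! j)]) x" if j: "j < q" for j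
  proof (cases "j = i")
    case True
    then show ?thesis
      using form_slot_add[OF \<omega> zs i closed(3)[OF z u] closed(3)[OF z v] x] i zs
      by (simp add: br_add(2)[OF u v z] tuples_length)
  next
    case False
    then show ?thesis
      using form_slot_add[OF \<omega> tuples_update_br[OF zs z j] i u v x]
      by (simp add: list_update_swap)
  qed
  show "L z q \<omega> (zs[i := sec_add F u v]) x = L z q \<omega> (zs[i := u]) x + L z q \<omega> (zs[i := v]) x"
    using 1 2 T u v x by (simp add: lie_deriv_apply closed sum.distrib)
next
  fix zs i f u x
  assume zs: "zs \<in> tuples F q" and i: "i < q" and f: "f \<in> smooth_funs N" and u: "u \<in> sections F"
    and x: "x \<in> pts N"
  let ?T = "\<lambda>w. zs[i := w]"
  have T: "?T w \<in> tuples F q" if "w \<in> sections F" for w using tuples_update[OF zs that] .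
  have "\<omega> (?T (sec_mult F f u)) = (\<lambda>x\<in>pts N. f x * \<omega> (?T u) x)"
    using form_slot_mult[OF \<omega> zs i f u] closed(2)[OF f u]
    by (intro smooth_fun_eq_restrict[OF form_smooth[OF \<omega> T]])
  then have 1: "A z (\<omega> (?T (sec_mult F f u))) x = f x * A z (\<omega> (?T u)) x + A z f x * \<omega> (?T u) x"
    using act_mult[OF z x f form_smooth[OF \<omega> T[OF u]]] by simp
  \<comment> \<open>The bracket is taken with the product only in slot \<open>i\<close>, hence the
    correction at \<open>j = i\<close>.\<close>
  have "\<omega> ((?T (sec_mult F f u))[j := br z (?T (sec_mult F f u) ! j)]) x =
      f x * \<omega> ((?T u)[j := br z (?T u ! j)]) x + (if j = i then A z f x * \<omega> (?T u) x else 0)"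
    if j: "j < q" for j
  proof (cases "j = i")
    case True
    have "\<omega> (?T (br z (sec_mult F f u))) x = f x * \<omega> (?T (br z u)) x + A z f x * \<omega> (?T u) x"
      unfolding br_leibniz[OF z u f]
      using form_slot_add[OF \<omega> zs i closed(2)[OF f closed(3)[OF z u]] closed(2)[OF closed(4)[OF z f] u] x]
        form_slot_mult[OF \<omega> zs i f closed(3)[OF z u] x]
        form_slot_mult[OF \<omega> zs i closed(4)[OF z f] u x] by simp
    then show ?thesis using True i zs by (simp add: tuples_length)
  next
    case False
    then show ?thesis
      using form_slot_mult[OF \<omega> tuples_update_br[OF zs z j] i f u x]
      by (simp add: list_update_swap)
  qed
  then have "(\<Sum>j<q. \<omega> ((?T (sec_mult F f u))[j := br z (?T (sec_mult F f u) ! j)]) x) =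
      f x * (\<Sum>j<q. \<omega> ((?T u)[j := br z (?T u ! j)]) x) + A z f x * \<omega> (?T u) x"
    using i by (simp add: sum.distrib sum_distrib_left)
  then show "L z q \<omega> (zs[i := sec_mult F f u]) x = f x * L z q \<omega> (zs[i := u]) x"
    using 1 T u f x by (simp add: lie_deriv_apply closed algebra_simps)
next
  fix zs \<sigma> x assume zs: "zs \<in> tuples F q" and \<sigma>: "\<sigma> permutes {..<q}" and x: "x \<in> pts N"
  let ?s = "of_int (sign \<sigma>) :: real"
  have \<sigma>': "\<sigma> permutes {..<length zs}" using \<sigma> zs by (simp add: tuples_length)
  have "\<omega> (permute_list \<sigma> zs) = (\<lambda>x\<in>pts N. ?s * \<omega> zs x)"
    using form_permute[OF \<omega> zs \<sigma>]
    by (intro smooth_fun_eq_restrict[OF form_smooth[OF \<omega> tuples_permute[OF zs \<sigma>]]])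
  then have 1: "A z (\<omega> (permute_list \<sigma> zs)) x = ?s * A z (\<omega> zs) x"
    using act_scale[OF z form_smooth[OF \<omega> zs] x] by simp
  have "\<omega> ((permute_list \<sigma> zs)[i := br z (permute_list \<sigma> zs ! i)]) x =
      ?s * \<omega> (zs[\<sigma> i := br z (zs ! \<sigma> i)]) x" if i: "i < q" for i
  proof -
    have "\<sigma> i < q" using permutes_in_image[OF \<sigma>, of i] i by simp
    then show ?thesis
      using form_permute[OF \<omega> tuples_update_br[OF zs z] \<sigma> x] permute_list_update[OF \<sigma>'] i zs
      by (simp add: permute_list_nth[OF \<sigma>'] tuples_length)
  qed
  then have "(\<Sum>i<q. \<omega> ((permute_list \<sigma> zs)[i := br z (permute_list \<sigma> zs ! i)]) x) =
      ?s * (\<Sum>i<q. \<omega> (zs[\<sigma> i := br z (zs ! \<sigma> i)]) x)"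
    by (simp add: sum_distrib_left)
  also have "(\<Sum>i<q. \<omega> (zs[\<sigma> i := br z (zs ! \<sigma> i)]) x) = (\<Sum>i<q. \<omega> (zs[i := br z (zs ! i)]) x)"
    using sum.permute[OF \<sigma>, of "\<lambda>i. \<omega> (zs[i := br z (zs ! i)]) x"] by (simp add: o_def)
  finally show "L z q \<omega> (permute_list \<sigma> zs) x = ?s * L z q \<omega> zs x"
    using 1 zs \<sigma> x by (simp add: lie_deriv_apply tuples_permute algebra_simps)
qed

section \<open>The exterior differential\<close>

lemma tuples_br_omit:
  assumes zs: "zs \<in> tuples F (Suc q)" and ij: "i < j" "j \<le> q"
  shows "br (zs ! i) (zs ! j) # omit i (omit j zs) \<in> tuples F q"
proof -
  obtain r where r: "q = Suc r" using ij by (cases q) auto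
  have "br (zs ! i) (zs ! j) \<in> sections F"
    using ij by (intro br_section tuples_nth[OF zs]) auto
  moreover have "omit i (omit j zs) \<in> tuples F r"
    using tuples_omit[OF tuples_omit[OF zs, unfolded r], of j i] ij r by simp
  ultimately show ?thesis using r by simp
qed

lemma ext_d_apply:
  "zs \<in> tuples F (Suc q) \<Longrightarrow> x \<in> pts N \<Longrightarrow>
   d q \<omega> zs x = (\<Sum>i\<le>q. (-1) ^ i * A (zs ! i) (\<omega> (omit i zs)) x) +
     (\<Sum>j\<le>q. \<Sum>i<j. (-1) ^ (i + j) * \<omega> (br (zs ! i) (zs ! j) # omit i (omit j zs)) x)"
  by (simp add: ext_d_def)

lemma ext_d_extensional: "d q \<omega> \<in> extensional (tuples F (Suc q))"
  by (simp add: ext_d_def)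

lemma ext_d_0:
  assumes "z \<in> sections F" "x \<in> pts N"
  shows "d 0 \<omega> [z] x = A z (\<omega> []) x"
  using assms by (simp add: ext_d_apply tuples_0)

text \<open>Index 0 is split off from both sums. The pairs containing it supply the bracket terms of
  \<open>L\<close>; the remaining indices and pairs give \<open>d\<close> of the interior product
  with the opposite sign.\<close>

lemma ext_d_Suc:
  assumes z: "z \<in> sections F" and \<omega>: "\<omega> \<in> forms F (Suc q)" and zs: "zs \<in> tuples F (Suc q)"
    and x: "x \<in> pts N"
  shows "d (Suc q) \<omega> (z # zs) x = L z (Suc q) \<omega> zs x - d q (int_prod F z q \<omega>) zs x"
proof -
  let ?i = "int_prod F z q \<omega>" and ?b = "\<lambda>i j. br (zs ! i) (zs ! j)"
  have A: "(\<Sum>i\<le>Suc q. (-1) ^ i * A ((z # zs) ! i) (\<omega> (omit i (z # zs))) x) =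
      A z (\<omega> zs) x - (\<Sum>i\<le>q. (-1) ^ i * A (zs ! i) (?i (omit i zs)) x)"
    unfolding sum.atMost_Suc_shift
    by (simp add: int_prod_apply[OF tuples_omit[OF zs]] sum_negf)
  \<comment> \<open>The exponent \<open>Suc j\<close> belongs to the pair of positions 0 and
    \<open>Suc j\<close> in \<open>z # zs\<close>; moving the bracket to slot \<open>j\<close> of
    \<open>zs\<close> costs \<open>(-1) ^ j\<close> and leaves a single minus sign.\<close>
  have 1: "(-1) ^ Suc j * \<omega> (br z (zs ! j) # omit j zs) x = - \<omega> (zs[j := br z (zs ! j)]) x"
    if "j \<le> q" for j
  proof -
    have "br z (zs ! j) \<in> sections F" using tuples_nth[OF zs] that z by (intro br_section) auto
    from form_omit[OF \<omega> this zs x that] show ?thesis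
      by (simp flip: mult.assoc power_add)
  qed
  \<comment> \<open>Shifting both indices by one preserves the sign \<open>(-1) ^ (i + j)\<close>;
    the minus comes from moving \<open>z\<close> in front of the bracket.\<close>
  have 2: "\<omega> (?b i j # z # omit i (omit j zs)) x = - ?i (?b i j # omit i (omit j zs)) x"
    if ij: "i < j" "j \<le> q" for i j
  proof -
    have "?b i j # omit i (omit j zs) \<in> tuples F q"
      using tuples_br_omit[OF zs ij] .
    then show ?thesis
      using form_swap[OF \<omega>, of "[]" "?b i j" z "omit i (omit j zs)" x] z x
      by (cases q) (simp_all add: int_prod_apply tuples_0)
  qed
  have B: "(\<Sum>j\<le>Suc q. \<Sum>i<j. (-1) ^ (i + j) *
        \<omega> (br ((z # zs) ! i) ((z # zs) ! j) # omit i (omit j (z # zs))) x) =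
      (\<Sum>j\<le>q. (-1) ^ Suc j * \<omega> (br z (zs ! j) # omit j zs) x +
        (\<Sum>i<j. (-1) ^ (i + j) * \<omega> (?b i j # z # omit i (omit j zs)) x))"
    unfolding sum.atMost_Suc_shift sum.lessThan_Suc_shift by simp
  also have "\<dots> = (\<Sum>j\<le>q. - \<omega> (zs[j := br z (zs ! j)]) x -
        (\<Sum>i<j. (-1) ^ (i + j) * ?i (?b i j # omit i (omit j zs)) x))"
    by (intro sum.cong refl) (simp add: 1 2 sum_negf del: power_Suc)
  also have "\<dots> = - (\<Sum>j<Suc q. \<omega> (zs[j := br z (zs ! j)]) x) -
      (\<Sum>j\<le>q. \<Sum>i<j. (-1) ^ (i + j) * ?i (?b i j # omit i (omit j zs)) x)"
    by (simp add: sum_subtractf sum_negf lessThan_Suc_atMost)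
  finally have B': "(\<Sum>j\<le>Suc q. \<Sum>i<j. (-1) ^ (i + j) *
        \<omega> (br ((z # zs) ! i) ((z # zs) ! j) # omit i (omit j (z # zs))) x) = \<dots>" .
  have "z # zs \<in> tuples F (Suc (Suc q))" using z zs by simp
  from ext_d_apply[OF this x, of \<omega>] show ?thesis
    unfolding A B' ext_d_apply[OF zs x] lie_deriv_apply[OF zs x] by simp
qed

text \<open>Polarisation of \<open>[u + v, u + v] = 0\<close>, carried out on the real values of
  \<open>\<omega>\<close>, where terms can be cancelled.\<close>

lemma form_br_swap:
  assumes \<omega>: "\<omega> \<in> forms F (Suc q)" and zs: "zs \<in> tuples F q" and u: "u \<in> sections F" and v: "v \<in> sections F"
    and x: "x \<in> pts N"
  shows "\<omega> (br u v # zs) x = - \<omega> (br v u # zs) x"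
proof -
  let ?o = "\<omega> (sec_zero F # zs) x"
  have expand: "?o = ?o + \<omega> (br u v # zs) x + (\<omega> (br v u # zs) x + ?o)"
    if u: "u \<in> sections F" and v: "v \<in> sections F" for u v
  proof -
    have "sec_zero F = sec_add F (sec_add F (br u u) (br v u)) (sec_add F (br u v) (br v v))"
      using br_self[OF closed(1)[OF u v]] br_add u v by (simp add: closed)
    then have "?o = \<omega> (br u u # zs) x + \<omega> (br v u # zs) x + (\<omega> (br u v # zs) x + \<omega> (br v v # zs) x)"
      using u v by (simp add: form_Cons_add[OF \<omega> zs _ _ x] closed)
    then show ?thesis by (simp add: br_self u v)
  qed
  \<comment> \<open>For equal arguments every bracket is the zero section, and the expansion equates
    \<open>?o\<close> with four times itself.\<close>
  have "?o = 0" using expand[OF u u] by (simp add: br_self[OF u])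
  then show ?thesis using expand[OF u v] by simp
qed

lemma ext_d_scale:
  assumes \<omega>: "\<omega> \<in> forms F q"
  shows "d q (form_scale F q r \<omega>) = form_scale F (Suc q) r (d q \<omega>)"
proof (intro extensionalityI[OF ext_d_extensional] ext)
  show "form_scale F (Suc q) r (d q \<omega>) \<in> extensional (tuples F (Suc q))"
    by (simp add: form_scale_def)
  fix zs x assume zs: "zs \<in> tuples F (Suc q)"
  have A: "A (zs ! i) (form_scale F q r \<omega> (omit i zs)) x = r * A (zs ! i) (\<omega> (omit i zs)) x"
    if "i \<le> q" "x \<in> pts N" for i
    using act_scale[OF tuples_nth[OF zs] form_smooth[OF \<omega> tuples_omit[OF zs]]] that tuples_omit[OF zs]
    by (simp add: form_scale_def)
  have B: "form_scale F q r \<omega> (br (zs ! i) (zs ! j) # omit i (omit j zs)) x =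
      r * \<omega> (br (zs ! i) (zs ! j) # omit i (omit j zs)) x" if "i < j" "j \<le> q" "x \<in> pts N" for i j
    using tuples_br_omit[OF zs that(1,2)] that(3) by (simp add: form_scale_def)
  show "d q (form_scale F q r \<omega>) zs x = form_scale F (Suc q) r (d q \<omega>) zs x"
  proof (cases "x \<in> pts N")
    case True
    have "d q (form_scale F q r \<omega>) zs x = r * d q \<omega> zs x"
      unfolding ext_d_apply[OF zs True] distrib_left sum_distrib_left
      by (intro arg_cong2[of _ _ _ _ "(+)"] sum.cong refl) (simp_all add: A B True)
    then show ?thesis using zs True by (simp add: form_scale_def)
  qed (use zs in \<open>simp add: ext_d_def form_scale_def\<close>)
qed

lemma ext_d_add:
  assumes \<omega>: "\<omega> \<in> forms F q" and \<theta>: "\<theta> \<in> forms F q"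
  shows "d q (form_add F q \<omega> \<theta>) = form_add F (Suc q) (d q \<omega>) (d q \<theta>)"
proof (intro extensionalityI[OF ext_d_extensional] ext)
  show "form_add F (Suc q) (d q \<omega>) (d q \<theta>) \<in> extensional (tuples F (Suc q))"
    by (simp add: form_add_def)
  fix zs x assume zs: "zs \<in> tuples F (Suc q)"
  have A: "A (zs ! i) (form_add F q \<omega> \<theta> (omit i zs)) x =
      A (zs ! i) (\<omega> (omit i zs)) x + A (zs ! i) (\<theta> (omit i zs)) x" if "i \<le> q" "x \<in> pts N" for i
    using act_add[OF tuples_nth[OF zs] _ form_smooth[OF \<omega> tuples_omit[OF zs]]
        form_smooth[OF \<theta> tuples_omit[OF zs]]] that tuples_omit[OF zs]
    by (simp add: form_add_def)
  have B: "form_add F q \<omega> \<theta> (br (zs ! i) (zs ! j) # omit i (omit j zs)) x =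
      \<omega> (br (zs ! i) (zs ! j) # omit i (omit j zs)) x + \<theta> (br (zs ! i) (zs ! j) # omit i (omit j zs)) x"
    if "i < j" "j \<le> q" "x \<in> pts N" for i j
    using tuples_br_omit[OF zs that(1,2)] that(3) by (simp add: form_add_def)
  show "d q (form_add F q \<omega> \<theta>) zs x = form_add F (Suc q) (d q \<omega>) (d q \<theta>) zs x"
  proof (cases "x \<in> pts N")
    case True
    have 1: "(\<Sum>i\<le>q. (-1) ^ i * A (zs ! i) (form_add F q \<omega> \<theta> (omit i zs)) x) =
        (\<Sum>i\<le>q. (-1) ^ i * A (zs ! i) (\<omega> (omit i zs)) x) + (\<Sum>i\<le>q. (-1) ^ i * A (zs ! i) (\<theta> (omit i zs)) x)"
      unfolding sum.distrib[symmetric] by (intro sum.cong refl) (simp add: A True distrib_left)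
    have 2: "(\<Sum>j\<le>q. \<Sum>i<j. (-1) ^ (i + j) * form_add F q \<omega> \<theta> (br (zs ! i) (zs ! j) # omit i (omit j zs)) x) =
        (\<Sum>j\<le>q. \<Sum>i<j. (-1) ^ (i + j) * \<omega> (br (zs ! i) (zs ! j) # omit i (omit j zs)) x) +
        (\<Sum>j\<le>q. \<Sum>i<j. (-1) ^ (i + j) * \<theta> (br (zs ! i) (zs ! j) # omit i (omit j zs)) x)"
      unfolding sum.distrib[symmetric] by (intro sum.cong refl) (simp add: B True distrib_left)
    have "d q (form_add F q \<omega> \<theta>) zs x = d q \<omega> zs x + d q \<theta> zs x"
      unfolding ext_d_apply[OF zs True] 1 2 by simp
    then show ?thesis using zs True by (simp add: form_add_def)
  qed (use zs in \<open>simp add: ext_d_def form_add_def\<close>)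
qed

text \<open>Cartan's formula in all degrees at once; the branch for degree 0 reflects that the
  interior product kills functions.\<close>

lemma ext_d_Cons:
  assumes z: "z \<in> sections F" and \<omega>: "\<omega> \<in> forms F q" and zs: "zs \<in> tuples F q" and x: "x \<in> pts N"
  shows "d q \<omega> (z # zs) x =
    L z q \<omega> zs x - (case q of 0 \<Rightarrow> 0 | Suc r \<Rightarrow> d r (int_prod F z r \<omega>) zs x)"
proof (cases q)
  case 0
  then show ?thesis using zs ext_d_0[OF z x, of \<omega>] x by (simp add: tuples_0 lie_deriv_def)
next
  case (Suc r)
  then show ?thesis using ext_d_Suc[OF z _ _ x, of \<omega> r zs] \<omega> zs by simp
qed

text \<open>Stated as an equality of forms, including the values off \<open>tuples\<close>, since
  both sides become arguments of \<open>d\<close>.\<close>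

lemma int_prod_int_prod_swap:
  assumes \<omega>: "\<omega> \<in> forms F (Suc (Suc q))" and u: "u \<in> sections F" and v: "v \<in> sections F"
  shows "int_prod F v q (int_prod F u (Suc q) \<omega>) =
    form_scale F q (- 1) (int_prod F u q (int_prod F v (Suc q) \<omega>))"
proof (rule extensionalityI[of _ "tuples F q"])
  fix zs assume zs: "zs \<in> tuples F q"
  have vs: "v # zs \<in> tuples F (Suc q)" "u # zs \<in> tuples F (Suc q)" using zs u v by simp_all
  have sm: "\<omega> (u # v # zs) \<in> smooth_funs N" using zs u v by (intro form_smooth[OF \<omega>]) simp
  show "int_prod F v q (int_prod F u (Suc q) \<omega>) zs =
    form_scale F q (- 1) (int_prod F u q (int_prod F v (Suc q) \<omega>)) zs"
  proof (rule extensionalityI[of _ "pts N"])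
    fix x assume "x \<in> pts N"
    then show "int_prod F v q (int_prod F u (Suc q) \<omega>) zs x =
        form_scale F q (- 1) (int_prod F u q (int_prod F v (Suc q) \<omega>)) zs x"
      using form_swap[OF \<omega>, of "[]" u v zs x] zs vs u v by (simp add: int_prod_apply form_scale_def)
  qed (use zs vs smooth_funs_extensional[OF sm] in \<open>simp_all add: int_prod_apply form_scale_def\<close>)
qed (simp_all add: int_prod_def form_scale_def)

text \<open>After two uses of Cartan's formula the action terms and the slot terms come in pairs of
  opposite sign, and the bracket of \<open>u\<close> and \<open>v\<close> is skew. The remainder is
  \<open>d\<close> of the twice contracted form, skew because interior products anticommute and
  \<open>d\<close> respects real factors.\<close>

lemma ext_d_swap_0_1:
  assumes \<omega>: "\<omega> \<in> forms F (Suc q)" and u: "u \<in> sections F" and v: "v \<in> sections F"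
    and zs: "zs \<in> tuples F q" and x: "x \<in> pts N"
  shows "d (Suc q) \<omega> (u # v # zs) x = - d (Suc q) \<omega> (v # u # zs) x"
proof -
  \<comment> \<open>The remainder is present only if two entries can be contracted in
    \<open>\<omega>\<close>, whose degree is \<open>Suc q\<close>; hence the case
    \<open>q = 0\<close>.\<close>
  define II where "II u v = (case q of 0 \<Rightarrow> 0 |
    Suc r \<Rightarrow> d r (int_prod F v r (int_prod F u (Suc r) \<omega>)) zs x)" for u v
  have II: "II u v = - II v u"
  proof (cases q)
    case (Suc r)
    have "int_prod F u r (int_prod F v (Suc r) \<omega>) \<in> forms F r"
      using \<omega> u v Suc by (intro int_prod_form[OF vb]) simp_all
    from ext_d_scale[OF this, of "- 1"] show ?thesis
      using \<omega> Suc u v zs x int_prod_int_prod_swap[of \<omega> r u v]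
      by (simp add: II_def form_scale_def)
  qed (simp add: II_def)
  have "d (Suc q) \<omega> (u # v # zs) x = A u (\<omega> (v # zs)) x - A v (\<omega> (u # zs)) x - \<omega> (br u v # zs) x
      - (\<Sum>i<q. \<omega> (v # zs[i := br u (zs ! i)]) x) + (\<Sum>i<q. \<omega> (u # zs[i := br v (zs ! i)]) x) + II u v"
    if u: "u \<in> sections F" and v: "v \<in> sections F" for u v
  proof -
    have vs: "v # zs \<in> tuples F (Suc q)" using v zs by simp
    have *: "int_prod F u q \<omega> \<in> forms F q" using int_prod_form[OF vb \<omega> u] .
    have "d (Suc q) \<omega> (u # v # zs) x = L u (Suc q) \<omega> (v # zs) x - d q (int_prod F u q \<omega>) (v # zs) x"
      using ext_d_Suc[OF u \<omega> vs x] .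
    also have "L u (Suc q) \<omega> (v # zs) x =
        A u (\<omega> (v # zs)) x - (\<omega> (br u v # zs) x + (\<Sum>i<q. \<omega> (v # zs[i := br u (zs ! i)]) x))"
      unfolding lie_deriv_apply[OF vs x] sum.lessThan_Suc_shift by simp
    also have "d q (int_prod F u q \<omega>) (v # zs) x = L v q (int_prod F u q \<omega>) zs x - II u v"
      using ext_d_Cons[OF v * zs x] by (auto simp: II_def split: nat.splits)
    also have "L v q (int_prod F u q \<omega>) zs x =
        A v (\<omega> (u # zs)) x - (\<Sum>i<q. \<omega> (u # zs[i := br v (zs ! i)]) x)"
      using zs v by (simp add: lie_deriv_apply[OF zs x] int_prod_apply tuples_update_br)
    finally show ?thesis by simp
  qed
  from this[OF u v] this[OF v u] show ?thesis
    using form_br_swap[OF \<omega> zs u v x] II by simp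
qed

lemma ext_d_form: "\<omega> \<in> forms F q \<Longrightarrow> d q \<omega> \<in> forms F (Suc q)"
proof (induction q arbitrary: \<omega>)
  case (0 \<omega>)
  show ?case
  proof (rule formsI_swap[OF ext_d_extensional])
    fix zs assume "zs \<in> tuples F (Suc 0)"
    then obtain z where z: "zs = [z]" "z \<in> sections F"
      by (rule tuples_SucE) (simp add: tuples_0)
    have "\<omega> [] \<in> smooth_funs N" using form_smooth[OF 0] by (simp add: tuples_0)
    have "d 0 \<omega> zs = A z (\<omega> [])"
    proof (rule extensionalityI[of _ "pts N"])
      show "d 0 \<omega> zs \<in> extensional (pts N)" using z by (simp add: ext_d_def tuples_0)
    qed (use z ext_d_0 act_extensional in auto)
    then show "d 0 \<omega> zs \<in> smooth_funs N" using act_smooth[OF z(2) \<open>\<omega> [] \<in> smooth_funs N\<close>] by simp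
  next
    fix zs i u v x assume zs: "zs \<in> tuples F (Suc 0)" and "i < Suc 0"
      and uv: "u \<in> sections F" "v \<in> sections F" and x: "x \<in> pts N"
    then have *: "zs[i := w] = [w]" for w by (cases zs) (auto dest: tuples_length)
    show "d 0 \<omega> (zs[i := sec_add F u v]) x = d 0 \<omega> (zs[i := u]) x + d 0 \<omega> (zs[i := v]) x"
      using act_sec_add[OF uv(1) x uv(2) form_smooth[OF 0]] uv x
      by (simp add: * ext_d_0 closed tuples_0)
  next
    fix zs i f u x assume zs: "zs \<in> tuples F (Suc 0)" and "i < Suc 0"
      and f: "f \<in> smooth_funs N" and u: "u \<in> sections F" and x: "x \<in> pts N"
    then have *: "zs[i := w] = [w]" for w by (cases zs) (auto dest: tuples_length)
    \<comment> \<open>Linearity of a differential of degree 1 over functions is exactly the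
      tensoriality of the anchor.\<close>
    show "d 0 \<omega> (zs[i := sec_mult F f u]) x = f x * d 0 \<omega> (zs[i := u]) x"
      using act_sec_mult[OF u form_smooth[OF 0] f x] f u x
      by (simp add: * ext_d_0 closed tuples_0)
  \<comment> \<open>The exchange condition is vacuous: a list of length 1 has no two neighbouring
    entries.\<close>
  qed (auto simp: tuples_def)
next
  case (Suc q \<omega>)
  \<comment> \<open>The form \<open>L z \<omega> - d (i z \<omega>)\<close>, available by the
    induction hypothesis; it is \<open>d \<omega>\<close> with first entry fixed to
    \<open>z\<close>.\<close>
  define H where "H z = form_add F (Suc q) (L z (Suc q) \<omega>)
    (form_scale F (Suc q) (- 1) (d q (int_prod F z q \<omega>)))" for z
  have H: "H z \<in> forms F (Suc q)" if "z \<in> sections F" for z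
    unfolding H_def
    using that Suc by (intro form_diff_form[OF vb] lie_deriv_form Suc.IH int_prod_form[OF vb])
  have dH: "d (Suc q) \<omega> (z # zs) = H z zs" if z: "z \<in> sections F" and zs: "zs \<in> tuples F (Suc q)" for z zs
  proof (rule extensionalityI[of _ "pts N"])
    show "d (Suc q) \<omega> (z # zs) \<in> extensional (pts N)" using z zs by (simp add: ext_d_def)
    show "H z zs \<in> extensional (pts N)" using zs by (simp add: H_def form_add_def)
    show "d (Suc q) \<omega> (z # zs) x = H z zs x" if "x \<in> pts N" for x
      using ext_d_Suc[OF z Suc.prems zs that] zs that by (simp add: H_def form_add_def form_scale_def)
  qed
  have swap01: "d (Suc q) \<omega> (u # v # zs) x = - d (Suc q) \<omega> (v # u # zs) x"
    if "u \<in> sections F" "v \<in> sections F" "zs \<in> tuples F q" "x \<in> pts N" for u v zs x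
    using ext_d_swap_0_1[OF Suc.prems that] .
  show ?case
  proof (rule formsI_swap[OF ext_d_extensional])
    fix zs assume "zs \<in> tuples F (Suc (Suc q))"
    then show "d (Suc q) \<omega> zs \<in> smooth_funs N"
      by (elim tuples_SucE[of zs]) (simp add: dH form_smooth[OF H])
  next
    fix xs u v ys x assume *: "xs @ u # v # ys \<in> tuples F (Suc (Suc q))" and x: "x \<in> pts N"
    show "d (Suc q) \<omega> (xs @ u # v # ys) x = - d (Suc q) \<omega> (xs @ v # u # ys) x"
    proof (cases xs)
      case Nil
      then have "u \<in> sections F" "v \<in> sections F" "ys \<in> tuples F q" using * by simp_all
      from swap01[OF this x] show ?thesis by (simp only: Nil append_Nil)
    next
      case (Cons z xs')
      then have z: "z \<in> sections F" and t: "xs' @ u # v # ys \<in> tuples F (Suc q)"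
        "xs' @ v # u # ys \<in> tuples F (Suc q)" using * by (auto simp: tuples_def)
      show ?thesis
        using form_swap[OF H[OF z] t(1) x] by (simp add: Cons dH[OF z t(1)] dH[OF z t(2)])
    qed
  next
    fix zs i u v x assume zs: "zs \<in> tuples F (Suc (Suc q))" and i: "i < Suc (Suc q)"
      and u: "u \<in> sections F" and v: "v \<in> sections F" and x: "x \<in> pts N"
    obtain z z' ys where zs': "zs = z # z' # ys" and z: "z \<in> sections F" "z' \<in> sections F"
      and ys: "ys \<in> tuples F q"
      using zs by (elim tuples_SucE) simp
    show "d (Suc q) \<omega> (zs[i := sec_add F u v]) x = d (Suc q) \<omega> (zs[i := u]) x + d (Suc q) \<omega> (zs[i := v]) x"
    proof (cases i)
      case 0
      \<comment> \<open>Exchanging the first two entries puts \<open>z'\<close> in front, and the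
        varying entry becomes the leading slot of the form \<open>H z'\<close>.\<close>
      have "d (Suc q) \<omega> (w # z' # ys) x = - H z' (w # ys) x" if "w \<in> sections F" for w
        using swap01[OF that z(2) ys x] dH[OF z(2), of "w # ys"] that ys by simp
      then show ?thesis
        using 0 u v form_Cons_add[OF H[OF z(2)] ys u v x] by (simp add: zs' closed)
    next
      case (Suc k)
      have t: "z' # ys \<in> tuples F (Suc q)" using z ys by simp
      have "d (Suc q) \<omega> (zs[i := w]) = H z ((z' # ys)[k := w])" if "w \<in> sections F" for w
        unfolding zs' Suc list_update_code(3) using dH[OF z(1) tuples_update[OF t that]] .
      then show ?thesis
        using form_slot_add[OF H[OF z(1)] t _ u v x, of k] i closed(1)[OF u v] u v by (simp only: Suc Suc_less_eq)
    qed
  next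
    fix zs i f u x assume zs: "zs \<in> tuples F (Suc (Suc q))" and i: "i < Suc (Suc q)"
      and f: "f \<in> smooth_funs N" and u: "u \<in> sections F" and x: "x \<in> pts N"
    obtain z z' ys where zs': "zs = z # z' # ys" and z: "z \<in> sections F" "z' \<in> sections F"
      and ys: "ys \<in> tuples F q"
      using zs by (elim tuples_SucE) simp
    show "d (Suc q) \<omega> (zs[i := sec_mult F f u]) x = f x * d (Suc q) \<omega> (zs[i := u]) x"
    proof (cases i)
      case 0
      have "d (Suc q) \<omega> (w # z' # ys) x = - H z' (w # ys) x" if "w \<in> sections F" for w
        using swap01[OF that z(2) ys x] dH[OF z(2), of "w # ys"] that ys by simp
      then show ?thesis
        using 0 u f form_slot_mult[OF H[OF z(2)], of "u # ys" 0 f u x] x ys by (simp add: zs' closed)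
    next
      case (Suc k)
      have t: "z' # ys \<in> tuples F (Suc q)" using z ys by simp
      have "d (Suc q) \<omega> (zs[i := w]) = H z ((z' # ys)[k := w])" if "w \<in> sections F" for w
        unfolding zs' Suc list_update_code(3) using dH[OF z(1) tuples_update[OF t that]] .
      then show ?thesis
        using form_slot_mult[OF H[OF z(1)] t _ f u x, of k] i closed(2)[OF f u] u by (simp only: Suc Suc_less_eq)
    qed
  qed
qed


section \<open>Cartan's formula and uniqueness\<close>

lemma cartan_ext_d: "cartan_formula F A br d"
  unfolding cartan_formula_def
proof (intro ballI ext)
  fix z \<omega> q assume z: "z \<in> sections F" and \<omega>: "\<omega> \<in> graded_forms F"
  then have \<omega>q: "\<omega> q \<in> forms F q" by (simp add: graded_forms_def)
  let ?R = "graded_add F (graded_raise F d (graded_int_prod F z \<omega>)) (graded_int_prod F z (graded_raise F d \<omega>)) q"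
  have "graded_lie_deriv F A br z \<omega> q = ?R"
  proof (rule extensionalityI[of _ "tuples F q"])
    fix zs assume zs: "zs \<in> tuples F q"
    show "graded_lie_deriv F A br z \<omega> q zs = ?R zs"
    proof (rule extensionalityI[of _ "pts N"])
      fix x assume x: "x \<in> pts N"
      show "graded_lie_deriv F A br z \<omega> q zs x = ?R zs x"
        using ext_d_Cons[OF z \<omega>q zs x] zs x
        by (cases q) (simp_all add: graded_lie_deriv_def graded_add_def graded_raise_def
            graded_int_prod_def form_add_def form_zero_def int_prod_apply)
    qed (use zs in \<open>simp_all add: graded_lie_deriv_def graded_add_def form_add_def lie_deriv_def\<close>)
  qed (simp_all add: graded_lie_deriv_def graded_add_def form_add_def lie_deriv_def)
  then show "graded_lie_deriv F A br z \<omega> q x y = ?R x y" for x y by simp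
qed

text \<open>The formula is tested on the family concentrated in degree \<open>q\<close>, whose
  component of degree \<open>q\<close> involves \<open>D\<close> only at \<open>\<omega>\<close>
  and, for positive \<open>q\<close>, at its interior product with \<open>z\<close>.\<close>

lemma cartan_component:
  assumes D: "cartan_formula F A br D" and z: "z \<in> sections F" and \<omega>: "\<omega> \<in> forms F q"
    and zs: "zs \<in> tuples F q" and x: "x \<in> pts N"
  shows "L z q \<omega> zs x = (case q of 0 \<Rightarrow> 0 | Suc r \<Rightarrow> D r (int_prod F z r \<omega>) zs x) + D q \<omega> (z # zs) x"
proof -
  define \<Omega> where "\<Omega> = (\<lambda>n. form_zero F n)(q := \<omega>)"
  have "{n. \<Omega> n \<noteq> form_zero F n} \<subseteq> {q}" by (auto simp: \<Omega>_def)
  then have "\<Omega> \<in> graded_forms F"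
    using \<omega> finite_subset[of _ "{q}"] form_zero_form[OF vb] by (auto simp: graded_forms_def \<Omega>_def)
  then have "graded_lie_deriv F A br z \<Omega> q zs x =
      graded_add F (graded_raise F D (graded_int_prod F z \<Omega>)) (graded_int_prod F z (graded_raise F D \<Omega>)) q zs x"
    using D z by (simp add: cartan_formula_def)
  then show ?thesis
    using zs x by (cases q) (simp_all add: graded_lie_deriv_def graded_add_def graded_raise_def
        graded_int_prod_def form_add_def form_zero_def int_prod_apply \<Omega>_def)
qed

text \<open>Both sides are forms, hence determined by their values on tuples. A tuple of positive
  length has a first entry, and contracting with it is what brings Cartan's formula into
  play.\<close>

lemma cartan_unique:
  assumes D: "degree_one_map F D" "cartan_formula F A br D"
  shows "\<omega> \<in> forms F q \<Longrightarrow> D q \<omega> = d q \<omega>"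
proof (induction q arbitrary: \<omega>)
  case (0 \<omega>)
  show ?case
  proof (rule form_eqI)
    show "D 0 \<omega> \<in> forms F (Suc 0)" using D(1) 0 by (simp add: degree_one_map_def)
    show "d 0 \<omega> \<in> forms F (Suc 0)" using ext_d_form[OF 0] .
    fix zs x assume zs: "zs \<in> tuples F (Suc 0)" and x: "x \<in> pts N"
    obtain z zs' where *: "zs = z # zs'" "z \<in> sections F" "zs' \<in> tuples F 0"
      using zs by (rule tuples_SucE)
    show "D 0 \<omega> zs x = d 0 \<omega> zs x"
      using cartan_component[OF D(2) *(2) 0 *(3) x] cartan_component[OF cartan_ext_d *(2) 0 *(3) x]
      by (simp add: *(1))
  qed
next
  case (Suc q \<omega>)
  show ?case
  proof (rule form_eqI)
    show "D (Suc q) \<omega> \<in> forms F (Suc (Suc q))" using D(1) Suc.prems by (simp add: degree_one_map_def)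
    show "d (Suc q) \<omega> \<in> forms F (Suc (Suc q))" using ext_d_form[OF Suc.prems] .
    fix zs x assume zs: "zs \<in> tuples F (Suc (Suc q))" and x: "x \<in> pts N"
    obtain z zs' where *: "zs = z # zs'" "z \<in> sections F" "zs' \<in> tuples F (Suc q)"
      using zs by (rule tuples_SucE)
    show "D (Suc q) \<omega> zs x = d (Suc q) \<omega> zs x"
      using cartan_component[OF D(2) *(2) Suc.prems *(3) x] cartan_component[OF cartan_ext_d *(2) Suc.prems *(3) x]
        Suc.IH[OF int_prod_form[OF vb Suc.prems *(2)]]
      by (simp add: *(1))
  qed
qed

end

theorem theorem4p7:
  fixes F :: "('f, 't::real_normed_vector, 'n, 'b::real_normed_vector, 'k::real_normed_vector) vbundle"
    and M :: "('m, 'a::real_normed_vector) manifold"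
    and h :: "'m \<Rightarrow> 'n" and \<eta> :: "'n \<Rightarrow> 'm"
    and br :: "('n \<Rightarrow> 'f) \<Rightarrow> ('n \<Rightarrow> 'f) \<Rightarrow> 'n \<Rightarrow> 'f"
    and \<rho> :: "'f \<Rightarrow> 'm \<times> 'm tangent_vector"
  assumes "gen_lie_algebroid F M h \<eta> br \<rho>"
  defines "A \<equiv> gla_act F M h \<eta> \<rho>"
  defines "d \<equiv> ext_d F A br"
  shows "degree_one_map F d \<and> real_linear_map F d \<and> cartan_formula F A br d \<and>
    (\<forall>D. degree_one_map F D \<and> cartan_formula F A br D \<longrightarrow>
         (\<forall>q. \<forall>\<omega>\<in>forms F q. D q \<omega> = d q \<omega>))"
proof -
  interpret gla F M h \<eta> br \<rho> using assms(1) by unfold_locales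
  show ?thesis
    unfolding d_def A_def
  proof (intro conjI allI impI ballI)
    show "degree_one_map F (ext_d F (gla_act F M h \<eta> \<rho>) br)"
      using ext_d_form by (simp add: degree_one_map_def)
    show "real_linear_map F (ext_d F (gla_act F M h \<eta> \<rho>) br)"
      using ext_d_add ext_d_scale by (simp add: real_linear_map_def)
  qed (use cartan_ext_d cartan_unique in blast)+
qed

end
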